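(* Let $G$ be an infinite transient network. Then for each vertex $v$ of $G$, the oriented wired uniform spanning forest measure $\mathsf{OWUSF}_G$ is a stationary measure for the wired cycle-breaking dynamics rooted at $v$, i.e. for the transition kernel $p^v(\cdot,\cdot)$. (Equivalently: if $F$ has law $\mathsf{OWUSF}_G$ and $E$ is an independent oriented edge chosen from $\{e: e^-=v\}$ with probability proportional to conductance, then $U(F,E)$ has law $\mathsf{OWUSF}_G$.)
   Context: A network is a locally finite, connected (multi)graph $G$ with a positive conductance $c(e)$ on each unoriented edge. $c(v)$ is the sum of the conductances of the edges adjacent to $v$, self-loops counted twice. Oriented edges $e$ go from tail $e^-$ to head $e^+$, have reversal $-e$, and have the conductance of the underlying unoriented edge. The random walk on $G$ jumps from $v$ along an oriented edge $e$ with $e^-=v$ with probability $c(e)/c(v)$ (a self-loop gives two oriented edges). $G$ is transient if this walk is. $\mathsf{OWUSF}_G$. For a path that is finite or visits each vertex finitely often, its loop-erasure is obtained by erasing cycles chronologically as they are created. For $G$ transient, $\mathsf{OWUSF}_G$ is the law of the random oriented forest $F$ produced by Wilson's algorithm rooted at infinity: enumerate the vertices $v_1,v_2,\dots$; let $F_0=\emptyset$; given $F_i$, run an independent random walk from $v_{i+1}$ stopped if and when it hits the set of vertices already included in $F_i$; let $F_{i+1}$ be the union of $F_i$ with the loop-erasure of this path, oriented chronologically; set $F=\bigcup_i F_i$. The law does not depend on the enumeration. Let $\mathcal F(G)$ be the set of oriented spanning forests $f$ of $G$ (cycle-free, containing every vertex) such that every vertex has exactly one outward-pointing edge in $f$,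 with the product $\sigma$-algebra. The past of a vertex $v$ in $f$ is the set of vertices $u$ for which there is a directed path from $u$ to $v$ in $f$. Update. For $f\in\mathcal F(G)$ and an oriented edge $e$ of $G$, the update $U(f,e)\in\mathcal F(G)$ is defined as follows. If $e$ or $-e$ is in $f$, or $e$ is a self-loop, then $U(f,e)=f$. Otherwise: (i) if $e^+$ is in the past of $e^-$ in $f$, so that there is a directed path $\langle e_1,\dots,e_k,d\rangle$ from $e^+$ to $e^-$ in $f$, then $U(f,e)=f\cup\{-e,-e_1,\dots,-e_k\}\setminus\{d,e_k,\dots,e_1\}$; (ii) if $e^+$ is not in the past of $e^-$ in $f$, let $d$ be the unique oriented edge of $f$ with $d^-=e^-$, and $U(f,e)=f\cup\{e\}\setminus\{d\}$. Dynamics. The wired cycle-breaking dynamics rooted at $v$ is the Markov chain on $\mathcal F(G)$ with transition probabilities $p^v(f_0,f_1)=\frac{1}{c(v)}\,c(\{e: e^-=v\text{ and }U(f_0,e)=f_1\})$, where $c$ of a set of oriented edges is the sum of their conductances. That is, one chooses an oriented edge $e$ with $e^-=v$ with probability proportional to its conductance and moves to $U(f_0,e)$. *)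

theory Defs
  imports "HOL-Probability.Probability" "Graph_Theory.Graph_Theory"
begin

text \<open>
  A multigraph is given by its oriented edges: the unoriented edges are the pairs
  \<open>{e, arev e}\<close>. Since \<open>arev e \<noteq> e\<close> for all \<open>e \<in> arcs G\<close>, a self-loop is a pair of
  two distinct arcs, both having tail and head at its vertex. As \<open>G\<close> is symmetric,
  strong connectedness is connectedness, and finiteness of \<open>out_arcs G v\<close> is
  finiteness of the set of edges adjacent to \<open>v\<close>. All vertices and edges live in
  \<open>verts G\<close> and \<open>arcs G\<close>; outside of \<open>arcs G\<close> the library fixes \<open>arev\<close> to be the identity.
\<close>

locale network = bidirected_digraph G arev
  for G :: "('v, 'e) pre_digraph" and arev :: "'e \<Rightarrow> 'e" +
  fixes c :: "'e \<Rightarrow> real"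
  assumes connected: "strongly_connected G"
    and locally_finite: "v \<in> verts G \<Longrightarrow> finite (out_arcs G v)"
    and conductance_pos: "e \<in> arcs G \<Longrightarrow> 0 < c e"
    and conductance_arev: "e \<in> arcs G \<Longrightarrow> c (arev e) = c e"
begin

subsection \<open>Random walk\<close>

text \<open>Both orientations of a self-loop at \<open>v\<close> lie in \<open>out_arcs G v\<close>, so it counts twice.\<close>

definition vertex_conductance :: "'v \<Rightarrow> real" where
  "vertex_conductance v = (\<Sum>e\<in>out_arcs G v. c e)"

definition step_law :: "'v \<Rightarrow> 'e measure" where
  "step_law v = point_measure (arcs G)
     (\<lambda>e. if tail G e = v then ennreal (c e / vertex_conductance v) else 0)"

definition step_kernel :: "'v \<Rightarrow> nat \<Rightarrow> (nat \<Rightarrow> 'e) \<Rightarrow> 'e measure" where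
  "step_kernel v n \<omega> = step_law (case n of 0 \<Rightarrow> v | Suc m \<Rightarrow> head G (\<omega> m))"

text \<open>
  A trajectory is the sequence \<open>\<omega>\<close> of the arcs that are crossed; the position at time \<open>n\<close>
  is \<open>tail G (\<omega> n)\<close>. The law of the walk started at \<open>v\<close> is the measure on trajectories
  given by the Ionescu-Tulcea theorem.
\<close>

definition walk_law :: "'v \<Rightarrow> (nat \<Rightarrow> 'e) measure" where
  "walk_law v = projective_family.lim UNIV
     (Ionescu_Tulcea.CI (step_kernel v) (\<lambda>_. count_space (arcs G)))
     (\<lambda>_. count_space (arcs G))"

definition transient :: bool where
  "transient \<longleftrightarrow> (\<forall>v\<in>verts G.
     measure (walk_law v) {\<omega> \<in> space (walk_law v). \<exists>n. tail G (\<omega> (Suc n)) = v} < 1)"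


subsection \<open>Wilson's algorithm rooted at infinity\<close>

text \<open>
  Crossing \<open>e\<close> extends the current loop-free path \<open>p\<close> by \<open>e\<close>; if \<open>head G e\<close> was already
  visited by \<open>p @ [e]\<close>, then everything after that visit is erased.
\<close>

definition loop_erase :: "'e list \<Rightarrow> 'e list" where
  "loop_erase = foldl (\<lambda>p e. takeWhile (\<lambda>a. tail G a \<noteq> head G e) (p @ [e])) []"

text \<open>
  For an infinite path that visits each vertex finitely often, the arcs of the loop-erasure
  are those which are eventually present and never erased again.
\<close>

definition loop_erasure_infinite :: "(nat \<Rightarrow> 'e) \<Rightarrow> 'e set" where
  "loop_erasure_infinite \<omega> =
     {e. eventually (\<lambda>n. e \<in> set (loop_erase (map \<omega> [0..<n]))) sequentially}"

definition loop_erasure_stopped :: "'v set \<Rightarrow> (nat \<Rightarrow> 'e) \<Rightarrow> 'e set" where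
  "loop_erasure_stopped S \<omega> =
     (if \<exists>n. tail G (\<omega> n) \<in> S
      then set (loop_erase (map \<omega> [0..<(LEAST n. tail G (\<omega> n) \<in> S)]))
      else loop_erasure_infinite \<omega>)"

text \<open>\<open>X i\<close> is the trajectory that is run from the \<open>i\<close>-th vertex of the enumeration.\<close>

primrec wilson :: "(nat \<Rightarrow> nat \<Rightarrow> 'e) \<Rightarrow> nat \<Rightarrow> 'e set" where
  "wilson X 0 = {}"
| "wilson X (Suc i) = wilson X i \<union>
     loop_erasure_stopped (tail G ` wilson X i \<union> head G ` wilson X i) (X i)"

definition wilson_forest :: "(nat \<Rightarrow> nat \<Rightarrow> 'e) \<Rightarrow> 'e set" where
  "wilson_forest X = (\<Union>i. wilson X i)"


subsection \<open>Oriented spanning forests\<close>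

text \<open>
  Sets of oriented edges with the product \<open>\<sigma>\<close>-algebra, i.e. the one generated by the
  events \<open>e \<in> f\<close> for \<open>e \<in> arcs G\<close>.
\<close>

definition config_space :: "'e set measure" where
  "config_space = vimage_algebra (Pow (arcs G)) (\<lambda>f. \<lambda>e\<in>arcs G. e \<in> f)
     (\<Pi>\<^sub>M e\<in>arcs G. count_space (UNIV :: bool set))"

text \<open>
  Cycles of the unoriented graph: an arc may not be followed back along its own reversal,
  as \<open>cycle [e, arev e]\<close> holds for every arc \<open>e\<close> that is not a self-loop.
\<close>

definition unoriented_cycle :: "'e list \<Rightarrow> bool" where
  "unoriented_cycle p \<longleftrightarrow> cycle p \<and> (\<forall>e\<in>set p. arev e \<notin> set p)"

text \<open>
  In an oriented forest each edge is oriented in one way only, and the underlying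
  unoriented graph, whose arcs are \<open>f \<union> arev ` f\<close>, has no cycles.
  Being spanning holds by the requirement of an outward-pointing edge at each vertex.
\<close>

definition spanning_forests :: "'e set set" where
  "spanning_forests = {f. f \<subseteq> arcs G \<and>
     (\<forall>e\<in>f. arev e \<notin> f) \<and>
     \<not> (\<exists>p. unoriented_cycle p \<and> set p \<subseteq> f \<union> arev ` f) \<and>
     (\<forall>v\<in>verts G. \<exists>!e. e \<in> f \<and> tail G e = v)}"

text \<open>
  The law of the forest sampled by Wilson's algorithm with the walks started from
  \<open>enum 0, enum 1, \<dots>\<close>, seen as a measure on the set of oriented spanning forests. The
  restriction only discards a null event if \<open>G\<close> is transient; that no mass is lost is
  the assertion that the result is a probability measure.
\<close>

definition OWUSF :: "(nat \<Rightarrow> 'v) \<Rightarrow> 'e set measure" where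
  "OWUSF enum = restrict_space
     (distr (\<Pi>\<^sub>M i\<in>UNIV. walk_law (enum i)) config_space wilson_forest) spanning_forests"


subsection \<open>Wired cycle-breaking dynamics\<close>

definition directed_path :: "'e set \<Rightarrow> 'v \<Rightarrow> 'e list \<Rightarrow> 'v \<Rightarrow> bool" where
  "directed_path f u p w \<longleftrightarrow> apath u p w \<and> set p \<subseteq> f"

definition past :: "'e set \<Rightarrow> 'v \<Rightarrow> 'v set" where
  "past f w = {u. \<exists>p. directed_path f u p w}"

text \<open>In the second case, \<open>p = [e\<^sub>1, \<dots>, e\<^sub>k, d]\<close> with \<open>butlast p = [e\<^sub>1, \<dots>, e\<^sub>k]\<close>.\<close>

definition update :: "'e set \<Rightarrow> 'e \<Rightarrow> 'e set" where
  "update f e =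
     (if e \<in> f \<or> arev e \<in> f \<or> head G e = tail G e then f
      else if head G e \<in> past f (tail G e) then
        let p = (THE p. directed_path f (head G e) p (tail G e))
        in (f \<union> insert (arev e) (arev ` set (butlast p))) - set p
      else
        let d = (THE d. d \<in> f \<and> tail G d = tail G e)
        in (f \<union> {e}) - {d})"

definition transition_prob :: "'v \<Rightarrow> 'e set \<Rightarrow> 'e set \<Rightarrow> real" where
  "transition_prob v f\<^sub>0 f\<^sub>1 =
     (\<Sum>e \<in> {e \<in> out_arcs G v. update f\<^sub>0 e = f\<^sub>1}. c e) / vertex_conductance v"

end

text \<open>
  Stationarity of a probability measure for transition probabilities \<open>p x y\<close> under which
  each state has only countably many successors: \<open>\<mu> A\<close> is the integral of
  \<open>\<Sum>y\<in>A. p x y\<close> with respect to \<open>\<mu>\<close>.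
\<close>

definition stationary_measure :: "('s \<Rightarrow> 's \<Rightarrow> real) \<Rightarrow> 's measure \<Rightarrow> bool" where
  "stationary_measure p \<mu> \<longleftrightarrow> prob_space \<mu> \<and>
     (\<forall>A\<in>sets \<mu>. emeasure \<mu> A =
        (\<integral>\<^sup>+x. (\<integral>\<^sup>+y. ennreal (p x y) \<partial>count_space A) \<partial>\<mu>))"

end

theory Submission
  imports Defs
begin

text \<open>
  On finitely many vertices with everything else wired into the root, Wilson's algorithm
  samples a rooted forest with probability proportional to its weight. There the map
  \<open>(f, e) \<mapsto> (U(f, e), d)\<close>, with \<open>d\<close> the arc removed by the update, oriented out of the tail
  of \<open>e\<close>, is an involution preserving the product of the conductance of the chosen arc
  and the weight of the forest, which is stationarity for the wired forests.

  Running all Wilson algorithms with the same walks, the wired forests converge arc by arc to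
  \<open>F\<close>, because a transient walk eventually stops erasing any given arc. So the limit law does not
  depend on the enumeration. The update is not continuous, as a long path from \<open>head e\<close> to
  \<open>tail e\<close> may appear in the approximations only; but the first walk decides whether there is such
  a path when the enumeration starts at \<open>head e\<close>, so it converges almost surely for that enumeration.

  That Wilson's algorithm has the stated law on a finite set is shown by summing over walks: the
  probability of a loop-erased path is determined by escape probabilities, and these are
  bounded by ratios of partition sums because the probability that the root of \<open>z\<close> lies in a given
  set is superharmonic in \<open>z\<close>. One-sided bounds suffice, as the probabilities sum to one.
\<close>

text \<open>Pairs \<open>(f, e)\<close> are tracked because \<open>update f e\<close> alone does not
  determine \<open>e\<close>. For arcs \<open>e\<close>, \<open>d\<close> out of \<open>v\<close>,
  the involution gives an identity between two numbers \<open>wired_prob D Q\<close>, which mention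
  no walks. Each of them passes to the limit with an enumeration of its own, one beginning at
  \<open>head e\<close>, the other at \<open>head d\<close>; summing over \<open>e\<close> and
  \<open>d\<close> then gives stationarity on cylinder events. Enumerations may repeat vertices, so
  that \<open>head e\<close> can be put in front of a given one: a walk from a vertex already in the
  forest stops at time 0 and adds nothing.

  Forests are weighted by products of jump probabilities. For a fixed set \<open>D\<close> of
  non-roots these differ from products of conductances by the constant product of
  \<open>vertex_conductance\<close> over \<open>D\<close>, so the involution applies, and the weight
  of a path becomes the probability of walking along it.

  The walk is studied through weights of finite words: concatenation of words replaces the strong
  Markov property, and inequalities between sums of weights replace identities for the Green
  function.\<close>

context network
begin

section \<open>Rooted forests and the exchange of one arc\<close>

definition arc_rel :: "'e set \<Rightarrow> 'v rel" where
  "arc_rel f = (\<lambda>e. (tail G e, head G e)) ` f"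

text \<open>\<open>D\<close> is the set of non-roots. For finite \<open>D\<close> these are the
  wired spanning forests, all vertices outside \<open>D\<close> being merged into one root; for
  \<open>D = verts G\<close> there is no root at all. Acyclicity of the directed relation is enough:
  with at most one arc out of each vertex, an unoriented cycle would have to be a directed
  one.\<close>

definition forests :: "'v set \<Rightarrow> 'e set set" where
  "forests D = {f. f \<subseteq> arcs G \<and> inj_on (tail G) f \<and> tail G ` f = D \<and> acyclic (arc_rel f)}"

text \<open>Case (ii) of the update without its side conditions, so that \<open>e\<close> may
  already belong to \<open>f\<close>. This generality is used when arcs out of a vertex are
  averaged.\<close>

definition exchange :: "'e set \<Rightarrow> 'e \<Rightarrow> 'e set" where
  "exchange f e = insert e {a\<in>f. tail G a \<noteq> tail G e}"

definition out_arc :: "'e set \<Rightarrow> 'v \<Rightarrow> 'e" where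
  "out_arc f x = (THE d. d \<in> f \<and> tail G d = x)"

lemma arc_rel_insert [simp]:
  "arc_rel (insert e f) = insert (tail G e, head G e) (arc_rel f)"
  by (simp add: arc_rel_def)

lemma arc_rel_mono: "f \<subseteq> g \<Longrightarrow> arc_rel f \<subseteq> arc_rel g"
  by (auto simp: arc_rel_def)

lemma single_valued_arc_rel: "inj_on (tail G) f \<Longrightarrow> single_valued (arc_rel f)"
  by (auto simp: single_valued_def arc_rel_def inj_on_def)

text \<open>A path to \<open>z\<close> may be stopped at its first visit of \<open>z\<close>, and
  then does not use an arc leaving \<open>z\<close>.\<close>

lemma rtrancl_arc_rel_to:
  assumes "(u, z) \<in> (arc_rel f)\<^sup>*"
  shows "(u, z) \<in> (arc_rel {a\<in>f. tail G a \<noteq> z})\<^sup>*"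
  using assms
proof (induction rule: converse_rtrancl_induct)
  case (step x y)
  show ?case
  proof (cases "x = z")
    case False
    with step(1) have "(x, y) \<in> arc_rel {a\<in>f. tail G a \<noteq> z}"
      by (auto simp: arc_rel_def)
    then show ?thesis using step.IH by (rule converse_rtrancl_into_rtrancl)
  qed simp
qed simp

lemma rtrancl_arc_rel_avoid:
  assumes "(u, b) \<in> (arc_rel f)\<^sup>*" "(u, z) \<notin> (arc_rel f)\<^sup>*"
  shows "(u, b) \<in> (arc_rel {a\<in>f. tail G a \<noteq> z})\<^sup>*"
  using assms(1)
proof (induction rule: rtrancl_induct)
  case (step x y)
  from step(1) assms(2) have "x \<noteq> z" by auto
  with step(2) have "(x, y) \<in> arc_rel {a\<in>f. tail G a \<noteq> z}"
    by (auto simp: arc_rel_def)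
  with step(3) show ?case by simp
qed simp

lemma forestsD:
  assumes "f \<in> forests D"
  shows "f \<subseteq> arcs G" "inj_on (tail G) f" "tail G ` f = D" "acyclic (arc_rel f)"
  using assms by (auto simp: forests_def)

lemma out_arc_eq:
  assumes "inj_on (tail G) f" "d \<in> f" "tail G d = x"
  shows "out_arc f x = d"
  unfolding out_arc_def using assms by (intro the_equality) (auto simp: inj_on_def)

lemma out_arc_forest:
  assumes "f \<in> forests D" "x \<in> D"
  shows "out_arc f x \<in> f" "tail G (out_arc f x) = x"
proof -
  from assms obtain d where "d \<in> f" "tail G d = x"
    using forestsD(3) by blast
  moreover from this have "out_arc f x = d"
    using out_arc_eq forestsD(2)[OF assms(1)] by blast
  ultimately show "out_arc f x \<in> f" "tail G (out_arc f x) = x" by auto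
qed

lemma forest_terminal:
  assumes "f \<in> forests D" "b \<notin> D" "(b, x) \<in> (arc_rel f)\<^sup>*"
  shows "x = b"
  using assms(3)
proof (cases rule: converse_rtranclE)
  case (step y)
  then have "b \<in> tail G ` f" by (auto simp: arc_rel_def)
  then show ?thesis using assms forestsD(3) by auto
qed simp

text \<open>A cycle through the new arc would contain a path from \<open>head G e\<close> back to
  \<open>tail G e\<close>, and by \<open>np\<close> there is none.\<close>

lemma exchange_forest:
  assumes f: "f \<in> forests D" and e: "e \<in> arcs G" "tail G e \<in> D"
    and np: "(head G e, tail G e) \<notin> (arc_rel f)\<^sup>*"
  shows "exchange f e \<in> forests D"
proof -
  let ?g = "{a\<in>f. tail G a \<noteq> tail G e}"
  have sub: "(arc_rel ?g)\<^sup>* \<subseteq> (arc_rel f)\<^sup>*"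
    by (intro rtrancl_mono arc_rel_mono) auto
  have "acyclic (arc_rel ?g)"
    using forestsD(4)[OF f] by (rule acyclic_subset) (auto intro!: arc_rel_mono)
  with np sub have "acyclic (arc_rel (exchange f e))"
    by (auto simp: exchange_def acyclic_insert)
  moreover have "inj_on (tail G) (exchange f e)"
    using forestsD(2)[OF f] by (auto simp: exchange_def inj_on_def)
  moreover have "tail G ` exchange f e = D"
    using forestsD(3)[OF f] e by (auto simp: exchange_def)
  ultimately show ?thesis
    using forestsD(1)[OF f] e by (auto simp: forests_def exchange_def)
qed

text \<open>An exchange is undone by the arc it removes. The side condition of the reverse exchange
  holds because a path from \<open>head G d\<close> to \<open>tail G d\<close>, stopped at its first
  visit of \<open>tail G d\<close>, avoids the new arc and would close a cycle of \<open>f\<close>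
  together with \<open>d\<close>.\<close>

lemma exchange_exchange:
  assumes f: "f \<in> forests D" and e: "tail G e \<in> D"
    and np: "(head G e, tail G e) \<notin> (arc_rel f)\<^sup>*"
    and d: "d = out_arc f (tail G e)"
  shows "exchange (exchange f e) d = f" "(head G d, tail G d) \<notin> (arc_rel (exchange f e))\<^sup>*"
    "out_arc (exchange f e) (tail G d) = e"
proof -
  have df: "d \<in> f" "tail G d = tail G e"
    using out_arc_forest[OF f e] d by auto
  have eq: "{a \<in> exchange f e. tail G a \<noteq> tail G d} = {a\<in>f. tail G a \<noteq> tail G e}"
    using df by (auto simp: exchange_def)
  have f_eq: "f = insert d {a\<in>f. tail G a \<noteq> tail G e}"
    using df forestsD(2)[OF f] by (auto simp: inj_on_def)
  then show "exchange (exchange f e) d = f"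
    unfolding exchange_def[of "exchange f e"] eq by simp
  show "(head G d, tail G d) \<notin> (arc_rel (exchange f e))\<^sup>*"
  proof
    assume "(head G d, tail G d) \<in> (arc_rel (exchange f e))\<^sup>*"
    from rtrancl_arc_rel_to[OF this] have "(head G d, tail G d) \<in> (arc_rel f)\<^sup>*"
      unfolding eq using rtrancl_mono[OF arc_rel_mono[of "{a\<in>f. tail G a \<noteq> tail G e}" f]] by auto
    moreover have "(tail G d, head G d) \<in> arc_rel f"
      using df(1) by (simp add: arc_rel_def)
    ultimately have "(tail G d, tail G d) \<in> (arc_rel f)\<^sup>+" by auto
    with forestsD(4)[OF f] show False by (simp add: acyclic_def)
  qed
  have "inj_on (tail G) (exchange f e)"
    using forestsD(2)[OF f] by (auto simp: exchange_def inj_on_def)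
  then show "out_arc (exchange f e) (tail G d) = e"
    by (rule out_arc_eq) (auto simp: exchange_def df)
qed

text \<open>Both sides are \<open>h e * h d\<close> times the product over the common arcs. The
  weight \<open>h\<close> is arbitrary because it stands for conductances in the update and for jump
  probabilities in the averaging argument.\<close>

lemma prod_exchange:
  fixes h :: "'e \<Rightarrow> 'm::comm_monoid_mult"
  assumes f: "f \<in> forests D" "finite D" and e: "tail G e \<in> D"
    and d: "d = out_arc f (tail G e)"
  shows "h e * prod h f = h d * prod h (exchange f e)"
proof -
  have df: "d \<in> f" "tail G d = tail G e"
    using out_arc_forest[OF f(1) e] d by auto
  have fin: "finite f"
    using finite_image_iff[OF forestsD(2)[OF f(1)]] forestsD(3)[OF f(1)] f(2) by simp
  have f_eq: "f = insert d {a\<in>f. tail G a \<noteq> tail G e}"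
    using df forestsD(2)[OF f(1)] by (auto simp: inj_on_def)
  have "prod h f = h d * prod h {a\<in>f. tail G a \<noteq> tail G e}"
    by (subst f_eq, subst prod.insert) (use fin df in auto)
  moreover have "prod h (exchange f e) = h e * prod h {a\<in>f. tail G a \<noteq> tail G e}"
    unfolding exchange_def by (subst prod.insert) (use fin in auto)
  ultimately show ?thesis by (simp add: ac_simps)
qed

lemma insert_forest:
  assumes f: "f \<in> forests (D - {y})" and e: "y \<in> D" "e \<in> arcs G" "tail G e = y"
    and np: "(head G e, y) \<notin> (arc_rel f)\<^sup>*"
  shows "insert e f \<in> forests D" "e \<notin> f"
proof -
  have y: "y \<notin> tail G ` f" using forestsD(3)[OF f] by simp
  then show "e \<notin> f" using e by auto
  have "inj_on (tail G) (insert e f)"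
    using forestsD(2)[OF f] y e(3) by (auto simp: inj_on_insert)
  moreover have "tail G ` insert e f = D" using forestsD(3)[OF f] e by auto
  moreover have "acyclic (arc_rel (insert e f))"
    using forestsD(4)[OF f] np e(3) by (simp add: acyclic_insert)
  ultimately show "insert e f \<in> forests D"
    using forestsD(1)[OF f] e(2) by (auto simp: forests_def)
qed

lemma finite_forests:
  assumes "finite D"
  shows "finite (forests D)"
proof (rule finite_subset)
  show "forests D \<subseteq> Pow (\<Union>x\<in>D \<inter> verts G. out_arcs G x)"
  proof
    fix f assume f: "f \<in> forests D"
    have "a \<in> (\<Union>x\<in>D \<inter> verts G. out_arcs G x)" if "a \<in> f" for a
      using that forestsD(1)[OF f] forestsD(3)[OF f] by (auto simp: out_arcs_def)
    then show "f \<in> Pow (\<Union>x\<in>D \<inter> verts G. out_arcs G x)" by blast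
  qed
  show "finite (Pow (\<Union>x\<in>D \<inter> verts G. out_arcs G x))"
    using assms locally_finite by auto
qed

lemma finite_forest: "f \<in> forests D \<Longrightarrow> finite D \<Longrightarrow> finite f"
  using finite_image_iff[OF forestsD(2)] forestsD(3) by metis

subsection \<open>Directed paths\<close>

lemma cas_rtrancl:
  "cas u p w \<Longrightarrow> set p \<subseteq> f \<Longrightarrow> (u, w) \<in> (arc_rel f)\<^sup>*"
proof (induction p arbitrary: u)
  case (Cons e p)
  then have "(u, head G e) \<in> arc_rel f" "(head G e, w) \<in> (arc_rel f)\<^sup>*"
    by (auto simp: arc_rel_def)
  then show ?case by (rule converse_rtrancl_into_rtrancl)
qed simp

lemma rtrancl_directed_path:
  assumes "(u, w) \<in> (arc_rel f)\<^sup>*" "f \<subseteq> arcs G" "w \<in> verts G"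
  shows "\<exists>p. directed_path f u p w"
proof -
  from assms(1) have "\<exists>p. awalk u p w \<and> set p \<subseteq> f"
  proof (induction rule: converse_rtrancl_induct)
    case base
    then show ?case using assms(3) by (auto intro!: exI[of _ "[]"] simp: awalk_simps)
  next
    case (step y z)
    then obtain p e where "awalk z p w" "set p \<subseteq> f" "e \<in> f" "y = tail G e" "z = head G e"
      by (auto simp: arc_rel_def)
    then show ?case using assms(2)
      by (auto intro!: exI[of _ "e # p"] simp: awalk_Cons_iff)
  qed
  then obtain p where "awalk u p w" "set p \<subseteq> f" by blast
  then show ?thesis
    using apath_awalk_to_apath awalk_to_apath_subset unfolding directed_path_def by blast
qed

text \<open>Every walk in \<open>f\<close> shortens to a simple path, so the past can be handled as
  a reflexive transitive closure, which suits rule induction.\<close>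

lemma in_past_iff:
  assumes "f \<subseteq> arcs G" "w \<in> verts G"
  shows "u \<in> past f w \<longleftrightarrow> (u, w) \<in> (arc_rel f)\<^sup>*"
  using rtrancl_directed_path[OF _ assms] cas_rtrancl
  unfolding past_def directed_path_def apath_def awalk_def by blast

text \<open>With one arc out of each vertex a path is forced step by step, and simplicity decides
  where it stops. This gives meaning to the definite description in \<open>update\<close>.\<close>

lemma directed_path_unique:
  assumes "directed_path f u p w" "directed_path f u q w" "inj_on (tail G) f"
  shows "p = q"
  using assms(1,2)
proof (induction p arbitrary: u q)
  case Nil
  then show ?case
    by (metis apath_Nil_iff apath_nonempty_ends directed_path_def)
next
  case (Cons e p)
  have "apath u (e # p) w" "apath u q w" using Cons.prems by (auto simp: directed_path_def)
  then have "q \<noteq> []" using apath_nonempty_ends by (auto simp: apath_Nil_iff)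
  then obtain a r where q: "q = a # r" by (cases q) auto
  from Cons.prems have "a \<in> f" "e \<in> f" "tail G a = tail G e"
    by (auto simp: directed_path_def q apath_Cons_iff)
  with assms(3) have "a = e" by (auto simp: inj_on_def)
  with Cons q show ?case by (auto simp: directed_path_def apath_Cons_iff)
qed

lemma the_directed_path:
  assumes "directed_path f u p w" "inj_on (tail G) f"
  shows "(THE p. directed_path f u p w) = p"
  using assms directed_path_unique by (intro the_equality) auto

text \<open>The arc removed by the update, turned so that it leaves \<open>tail G e\<close>. In case
  (i) the removed arc at \<open>tail G e\<close> is the last one of the path and points into it,
  hence the \<open>arev\<close>. In the trivial case the value \<open>e\<close> makes
  \<open>(f, e)\<close> a fixed point of the involution.\<close>

definition undo_arc :: "'e set \<Rightarrow> 'e \<Rightarrow> 'e" where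
  "undo_arc f e =
     (if e \<in> f \<or> arev e \<in> f \<or> head G e = tail G e then e
      else if head G e \<in> past f (tail G e)
      then arev (last (THE p. directed_path f (head G e) p (tail G e)))
      else out_arc f (tail G e))"

section \<open>Reversing a directed path inside a forest\<close>

lemma cas_appendI: "cas u p x \<Longrightarrow> cas x q w \<Longrightarrow> cas u (p @ q) w"
  by (induction p arbitrary: u) (auto simp del: cas_append_iff)

lemma cas_arev:
  "cas u q w \<Longrightarrow> set q \<subseteq> arcs G \<Longrightarrow> cas w (map arev (rev q)) u"
  by (induction q arbitrary: u) (auto simp del: cas_append_iff intro!: cas_appendI)

lemma awalk_verts_conv_tails: "cas u p w \<Longrightarrow> awalk_verts u p = map (tail G) p @ [w]"
  by (induction p arbitrary: u) auto

lemma cas_map_tail: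
  "cas u p w \<Longrightarrow> p \<noteq> [] \<Longrightarrow> map (tail G) p = u # map (head G) (butlast p)"
proof (induction p arbitrary: u)
  case (Cons e p)
  show ?case
  proof (cases "p = []")
    case False
    with Cons.IH[of "head G e"] Cons.prems show ?thesis by auto
  qed (use Cons in auto)
qed simp

lemma cas_butlast: "cas u p w \<Longrightarrow> p \<noteq> [] \<Longrightarrow> cas u (butlast p) (tail G (last p)) \<and> head G (last p) = w"
  by (induction p arbitrary: u) auto

lemma forest_no_loop:
  assumes "f \<in> forests D" "a \<in> f"
  shows "head G a \<noteq> tail G a"
proof
  assume "head G a = tail G a"
  then have "(tail G a, tail G a) \<in> arc_rel f" using assms(2) by (force simp: arc_rel_def)
  then show False using forestsD(4)[OF assms(1)] by (auto simp: acyclic_def)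
qed

lemma forest_arev:
  assumes "f \<in> forests D" "a \<in> f"
  shows "arev a \<notin> f"
proof
  assume "arev a \<in> f"
  have "a \<in> arcs G" using assms forestsD(1) by blast
  have "(tail G a, head G a) \<in> arc_rel f" using assms(2) by (simp add: arc_rel_def)
  moreover have "(tail G (arev a), head G (arev a)) \<in> arc_rel f"
    using \<open>arev a \<in> f\<close> unfolding arc_rel_def by (rule imageI)
  then have "(head G a, tail G a) \<in> arc_rel f"
    using \<open>a \<in> arcs G\<close> by simp
  ultimately have "(tail G a, tail G a) \<in> (arc_rel f)\<^sup>+" by (meson trancl.simps)
  then show False using forestsD(4)[OF assms(1)] by (auto simp: acyclic_def)
qed

text \<open>In a functional relation the only way forward from a point of a cycle is along the
  cycle, so whatever is reached from there leads back.\<close>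

lemma single_valued_cycle:
  assumes "single_valued r" "(x, x) \<in> r\<^sup>+" "(x, y) \<in> r\<^sup>*"
  shows "(y, x) \<in> r\<^sup>*"
  using assms(3)
proof (induction rule: rtrancl_induct)
  case (step y z)
  have "(y, x) \<in> r\<^sup>+"
    using step.IH assms(2) by (auto simp: rtrancl_eq_or_trancl)
  then obtain z' where "(y, z') \<in> r" "(z', x) \<in> r\<^sup>*"
    by (meson tranclD)
  then show ?case using step.hyps(2) assms(1) by (auto dest: single_valuedD)
qed simp

text \<open>For \<open>p\<close> from \<open>head G e\<close> to \<open>tail G e\<close> this runs
  from the tail of the last arc of \<open>p\<close> to \<open>tail G e\<close>. The last arc of
  \<open>p\<close> is dropped, and \<open>arev e\<close> leads from \<open>head G e\<close> to the
  end.\<close>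

definition reversed_path :: "'e list \<Rightarrow> 'e \<Rightarrow> 'e list" where
  "reversed_path p e = map arev (rev (butlast p)) @ [arev e]"

text \<open>The old and the new path have the same tails \<open>?P\<close>, so there is still one
  arc out of each vertex of \<open>D\<close>. For acyclicity: in \<open>f'\<close> all of
  \<open>?P\<close> leads to \<open>tail G e\<close>, while nothing reachable from
  \<open>tail G e\<close> lies in \<open>?P\<close>. A cycle of \<open>f'\<close> that leads to
  \<open>tail G e\<close> contains it, hence avoids \<open>?P\<close>; one that does not lead there
  avoids \<open>?P\<close> too. Off \<open>?P\<close> the two forests agree, so it would be a cycle
  of \<open>f\<close>.\<close>

lemma reverse_path_forest:
  assumes f: "f \<in> forests D" and e: "e \<in> arcs G" "e \<notin> f" "arev e \<notin> f" "head G e \<noteq> tail G e"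
    and p: "directed_path f (head G e) p (tail G e)"
  defines "p' \<equiv> reversed_path p e"
  defines "f' \<equiv> (f - set p) \<union> set p'"
  shows "f' \<in> forests D" "directed_path f' (tail G (last p)) p' (tail G e)"
    "set p \<inter> set p' = {}" "f \<inter> set p' = {}" "p \<noteq> []"
proof -
  note fD = forestsD[OF f]
  have pf: "set p \<subseteq> f" and pa: "set p \<subseteq> arcs G" and cas: "cas (head G e) p (tail G e)"
    and dist: "distinct (map (tail G) p)" and vP: "tail G e \<notin> tail G ` set p"
    and v: "tail G e \<in> verts G"
    using p e(1) by (auto simp: directed_path_def apath_def awalk_def awalk_verts_conv_tails)
  show pne: "p \<noteq> []" using cas e(4) by auto
  then have bl: "set (butlast p) \<subseteq> set p" by (auto dest: in_set_butlastD)
  \<comment> \<open>Reversal turns heads into tails, and the tail of \<open>arev e\<close> is the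
    first vertex of \<open>p\<close>.\<close>
  have mt: "map (tail G) p' = rev (map (tail G) p)"
  proof -
    have "map (tail G \<circ> arev) (rev (butlast p)) = map (head G) (rev (butlast p))"
      using bl pa by auto
    then show ?thesis unfolding p'_def reversed_path_def
      using cas_map_tail[OF cas pne] e(1) by (simp add: rev_map)
  qed
  then have tp': "tail G ` set p' = tail G ` set p"
    by (metis list.set_map set_rev)
  have p'f: "f \<inter> set p' = {}"
    using forest_arev[OF f] bl pf e(3) unfolding p'_def reversed_path_def by auto
  then show "f \<inter> set p' = {}" "set p \<inter> set p' = {}" using pf by auto
  have p'a: "set p' \<subseteq> arcs G" using bl pa e(1) unfolding p'_def reversed_path_def by auto
  have cas': "cas (tail G (last p)) p' (tail G e)"
    unfolding p'_def reversed_path_def using cas_butlast[OF cas pne] cas_arev[of _ "butlast p"] bl pa e(1)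
    by (auto simp del: cas_append_iff intro!: cas_appendI)
  have "last p \<in> set p" using pne by simp
  then have "tail G (last p) \<in> verts G" using pa by auto
  then show "directed_path f' (tail G (last p)) p' (tail G e)"
    unfolding directed_path_def apath_def awalk_def
    using cas' p'a awalk_verts_conv_tails[OF cas'] mt dist vP tp' by (auto simp: f'_def)
  let ?P = "tail G ` set p"
  have inj': "inj_on (tail G) f'"
  proof -
    have "inj_on (tail G) (set p')" using mt dist
      by (metis distinct_map distinct_rev)
    moreover have "inj_on (tail G) (f - set p)" using fD(2) by (rule inj_on_diff)
    moreover have "tail G ` (f - set p) \<inter> tail G ` set p' = {}"
      unfolding tp' using fD(2) pf by (auto simp: inj_on_def)
    ultimately show ?thesis unfolding f'_def by (auto simp: inj_on_Un)
  qed
  have im': "tail G ` f' = D"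
    unfolding f'_def image_Un tp' using fD(3) pf by auto
  have P_to_v: "(x, tail G e) \<in> (arc_rel (set p'))\<^sup>*" if "x \<in> ?P" for x
  proof -
    from that have "x \<in> tail G ` set p'" unfolding tp' .
    then obtain a where a: "a \<in> set p'" "tail G a = x" by auto
    then obtain q r where q: "p' = q @ a # r" by (meson split_list)
    with cas' a have "cas x (a # r) (tail G e)"
      by (auto simp: cas_append_iff)
    then show ?thesis by (rule cas_rtrancl) (auto simp: q)
  qed
  have P_to_v_f: "(x, tail G e) \<in> (arc_rel f)\<^sup>*" if "x \<in> ?P" for x
  proof -
    from that obtain a where a: "a \<in> set p" "tail G a = x" by auto
    then obtain q r where q: "p = q @ a # r" by (meson split_list)
    with cas a have "cas x (a # r) (tail G e)"
      by (auto simp: cas_append_iff)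
    then show ?thesis by (rule cas_rtrancl) (use pf in \<open>auto simp: q\<close>)
  qed
  \<comment> \<open>Until \<open>?P\<close> is met, only arcs of \<open>f\<close> are followed; and
    meeting \<open>?P\<close> would close a cycle of \<open>f\<close>, since \<open>?P\<close> leads
    to \<open>tail G e\<close> in \<open>f\<close>.\<close>
  have from_v: "y \<notin> ?P \<and> (tail G e, y) \<in> (arc_rel f)\<^sup>*" if "(tail G e, y) \<in> (arc_rel f')\<^sup>*" for y
    using that
  proof (induction rule: rtrancl_induct)
    case base then show ?case using vP by simp
  next
    case (step y z)
    then have "(y, z) \<in> arc_rel f" using tp'[symmetric] by (auto simp: arc_rel_def f'_def)
    with step.IH have vz: "(tail G e, z) \<in> (arc_rel f)\<^sup>+" by (meson rtrancl_into_trancl1)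
    have "z \<notin> ?P"
    proof
      assume "z \<in> ?P"
      with P_to_v_f vz have "(tail G e, tail G e) \<in> (arc_rel f)\<^sup>+" by (meson trancl_rtrancl_trancl)
      with fD(4) show False by (auto simp: acyclic_def)
    qed
    with vz show ?case by auto
  qed
  have out: "(x, y) \<in> (arc_rel f)\<^sup>+"
    if "(x, y) \<in> (arc_rel f')\<^sup>+" "\<And>z. (x, z) \<in> (arc_rel f')\<^sup>* \<Longrightarrow> z \<notin> ?P" for x y
    using that(1)
  proof (induction rule: trancl_induct)
    case (base y)
    then have "(x, y) \<in> arc_rel f" using that(2)[of x] tp'[symmetric] by (auto simp: arc_rel_def f'_def)
    then show ?case by auto
  next
    case (step y z)
    moreover have "y \<notin> ?P" using that(2)[of y] step.hyps(1) by (auto dest: trancl_into_rtrancl)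
    ultimately have "(y, z) \<in> arc_rel f" using tp'[symmetric] by (auto simp: arc_rel_def f'_def)
    then show ?case using step.IH by auto
  qed
  have "(x, x) \<notin> (arc_rel f')\<^sup>+" for x
  proof
    assume cyc: "(x, x) \<in> (arc_rel f')\<^sup>+"
    have sv: "single_valued (arc_rel f')" using inj' by (rule single_valued_arc_rel)
    show False
    proof (cases "(x, tail G e) \<in> (arc_rel f')\<^sup>*")
      case True
      then have vx: "(tail G e, x) \<in> (arc_rel f')\<^sup>*" by (rule single_valued_cycle[OF sv cyc])
      have "z \<notin> ?P" if "(x, z) \<in> (arc_rel f')\<^sup>*" for z
        using from_v[of z] rtrancl_trans[OF vx that] by blast
      from out[OF cyc this] show False using fD(4) by (auto simp: acyclic_def)
    next
      case False
      have "z \<notin> ?P" if "(x, z) \<in> (arc_rel f')\<^sup>*" for z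
      proof
        assume "z \<in> ?P"
        from P_to_v[OF this] have "(z, tail G e) \<in> (arc_rel f')\<^sup>*"
          using rtrancl_mono[OF arc_rel_mono[of "set p'" f']] by (auto simp: f'_def)
        with that have "(x, tail G e) \<in> (arc_rel f')\<^sup>*" by (rule rtrancl_trans)
        with False show False by simp
      qed
      from out[OF cyc this] show False using fD(4) by (auto simp: acyclic_def)
    qed
  qed
  then have "acyclic (arc_rel f')" by (simp add: acyclic_def)
  then show "f' \<in> forests D" using inj' im' fD(1) p'a by (auto simp: forests_def f'_def)
qed

section \<open>The update as a weight-preserving involution\<close>

lemma update_trivial:
  assumes "e \<in> f \<or> arev e \<in> f \<or> head G e = tail G e"
  shows "update f e = f" "undo_arc f e = e"
  using assms by (auto simp: update_def undo_arc_def)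

lemma update_path:
  assumes "inj_on (tail G) f" "e \<notin> f" "arev e \<notin> f" "head G e \<noteq> tail G e"
    "directed_path f (head G e) p (tail G e)"
  shows "update f e = (f \<union> set (reversed_path p e)) - set p" "undo_arc f e = arev (last p)"
proof -
  have "head G e \<in> past f (tail G e)" using assms(5) by (auto simp: past_def)
  then show "update f e = (f \<union> set (reversed_path p e)) - set p" "undo_arc f e = arev (last p)"
    using assms(2-4) the_directed_path[OF assms(5,1)]
    by (auto simp: update_def undo_arc_def Let_def reversed_path_def)
qed

lemma update_exchange:
  assumes "f \<in> forests D" "tail G e \<in> D" "e \<notin> f" "arev e \<notin> f" "head G e \<noteq> tail G e"
    "head G e \<notin> past f (tail G e)"
  shows "update f e = exchange f e" "undo_arc f e = out_arc f (tail G e)"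
proof -
  show "undo_arc f e = out_arc f (tail G e)" using assms by (simp add: undo_arc_def)
  have "update f e = insert e f - {out_arc f (tail G e)}"
    using assms by (simp add: update_def out_arc_def)
  also have "\<dots> = exchange f e"
    using out_arc_forest[OF assms(1,2)] forestsD(2)[OF assms(1)] assms(3)
    by (auto simp: exchange_def inj_on_def)
  finally show "update f e = exchange f e" .
qed

text \<open>Each of the three cases is mapped to itself. In case (i) reversal keeps all
  conductances, and the last arc of the path is traded for \<open>e\<close>. The set
  \<open>D\<close> is arbitrary: finite sets are used for weights, and \<open>D = verts G\<close>
  for the limit forest.\<close>

theorem update_involution:
  assumes f: "f \<in> forests D" and e: "e \<in> arcs G" "tail G e \<in> D"
  defines "d \<equiv> undo_arc f e"
  shows "update f e \<in> forests D" "d \<in> arcs G" "tail G d = tail G e"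
    "update (update f e) d = f" "undo_arc (update f e) d = e"
    "finite D \<Longrightarrow> c e * prod c f = c d * prod c (update f e)"
proof -
  let ?v = "tail G e"
  have "update f e \<in> forests D \<and> d \<in> arcs G \<and> tail G d = tail G e \<and>
    update (update f e) d = f \<and> undo_arc (update f e) d = e \<and>
    (finite D \<longrightarrow> c e * prod c f = c d * prod c (update f e))"
  proof (cases "e \<in> f \<or> arev e \<in> f \<or> head G e = tail G e")
    case True
    then show ?thesis using f e update_trivial[OF True] by (simp add: d_def)
  next
    case nt: False
    then have nt': "e \<notin> f" "arev e \<notin> f" "head G e \<noteq> tail G e" by auto
    have v: "?v \<in> verts G" using e by auto
    show ?thesis
    proof (cases "head G e \<in> past f ?v")
      case True
      then obtain p where p: "directed_path f (head G e) p ?v" by (auto simp: past_def)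
      let ?p' = "reversed_path p e"
      note R = reverse_path_forest[OF f e(1) nt' p]
      have pf: "set p \<subseteq> f" using p by (simp add: directed_path_def)
      note U = update_path[OF forestsD(2)[OF f] nt' p]
      have U1: "update f e = (f - set p) \<union> set ?p'" using U(1) R(3) by auto
      have casp: "cas (head G e) p ?v" using p by (auto simp: directed_path_def apath_def awalk_def)
      define b where "b = last p"
      have "b \<in> set p" using R(5) by (simp add: b_def)
      then have b: "b \<in> f" "b \<in> arcs G" "b \<in> set p" "head G b = ?v"
        using pf forestsD(1)[OF f] cas_butlast[OF casp R(5)] unfolding b_def by blast+
      have d: "d = arev b" using U(2) by (simp add: d_def b_def)
      have dt: "tail G d = ?v" "head G d = tail G b" "d \<in> arcs G" using d b by auto
      have bl: "set (butlast p) \<subseteq> set p" by (auto dest: in_set_butlastD)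
      have pdis: "distinct p" using p distinct_verts_imp_distinct
        unfolding directed_path_def apath_def by blast
      have psplit: "p = butlast p @ [b]" using R(5) by (simp add: b_def)
      have bnot: "b \<notin> set (butlast p)" using pdis psplit by (metis distinct_append disjoint_iff list.set_intros(1))
      \<comment> \<open>The reverse update must fall in case (i) again: \<open>n1\<close>,
        \<open>n2\<close>, \<open>n3\<close> exclude the trivial case, and \<open>dp'\<close>
        supplies the path from \<open>head G d\<close> to \<open>tail G d\<close>.\<close>
      have "arev b \<notin> f" using forest_arev[OF f b(1)] .
      moreover have "arev b \<notin> set ?p'"
        using bnot nt'(1) b(1) unfolding reversed_path_def by (auto simp: arev_eq_iff)
      ultimately have n1: "d \<notin> update f e" unfolding U1 d by auto
      have n2: "arev d \<notin> update f e" unfolding U1 d using b R(3) by auto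
      have n3: "head G d \<noteq> tail G d" using dt forest_no_loop[OF f b(1)] b by auto
      have dp': "directed_path (update f e) (head G d) ?p' (tail G d)"
        using R(2) unfolding U1 dt b_def by simp
      have f'F: "update f e \<in> forests D" using R(1) unfolding U1 .
      note U' = update_path[OF forestsD(2)[OF f'F] n1 n2 n3 dp']
      \<comment> \<open>Dropping the last arc \<open>arev e\<close> of \<open>?p'\<close>, reversing
        the rest and appending \<open>arev d\<close>, which is \<open>b\<close>, restores
        \<open>p\<close>.\<close>
      have "set (reversed_path ?p' d) = set p"
      proof -
        have "map (arev \<circ> arev) q = q" for q by (simp add: map_idI)
        then have "reversed_path ?p' d = butlast p @ [b]"
          unfolding reversed_path_def d by (simp add: rev_map)
        then show ?thesis using psplit by simp
      qed
      then have "update (update f e) d = f"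
        unfolding U'(1) unfolding U1 using R(3,4) pf by auto
      moreover have "undo_arc (update f e) d = e"
        unfolding U'(2) by (simp add: reversed_path_def)
      moreover have "c e * prod c f = c d * prod c (update f e)" if "finite D"
      proof -
        have fin: "finite f" using finite_forest[OF f that] .
        have "prod c f = prod c (f - set p) * prod c (set p)"
          using prod.subset_diff[OF pf fin] .
        moreover have "prod c (update f e) = prod c (f - set p) * prod c (set ?p')"
          unfolding U1 by (rule prod.union_disjoint) (use fin R(4) in auto)
        moreover have "prod c (set p) = prod c (set (butlast p)) * c b"
          by (subst psplit, simp) (use bnot in \<open>auto simp: mult.commute\<close>)
        moreover have "prod c (set ?p') = prod c (set (butlast p)) * c e"
        proof -
          have "set ?p' = insert (arev e) (arev ` set (butlast p))" by (auto simp: reversed_path_def)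
          moreover have "arev e \<notin> arev ` set (butlast p)"
            using nt'(1) bl pf by (auto simp: arev_eq_iff)
          moreover have "prod c (arev ` set (butlast p)) = prod c (set (butlast p))"
            by (subst prod.reindex) (use bl pf forestsD(1)[OF f] conductance_arev in \<open>auto intro!: prod.cong simp: inj_on_def arev_eq_iff\<close>)
          ultimately show ?thesis using conductance_arev[OF e(1)] by (simp add: mult.commute)
        qed
        moreover have "c d = c b" using conductance_arev b d by auto
        ultimately show ?thesis by simp
      qed
      ultimately show ?thesis using f'F dt by auto
    next
      case False
      note U = update_exchange[OF f e(2) nt' False]
      have np: "(head G e, ?v) \<notin> (arc_rel f)\<^sup>*"
        using False in_past_iff[OF forestsD(1)[OF f] v] by auto
      have d: "d = out_arc f ?v" using U(2) by (simp add: d_def)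
      have df: "d \<in> f" "tail G d = ?v" using out_arc_forest[OF f e(2)] d by auto
      have da: "d \<in> arcs G" using df forestsD(1)[OF f] by auto
      note X = exchange_exchange[OF f e(2) np d]
      have f'F: "exchange f e \<in> forests D" using exchange_forest[OF f e np] .
      have n1: "d \<notin> exchange f e" using df nt' by (auto simp: exchange_def)
      have n2: "arev d \<notin> exchange f e"
        using forest_arev[OF f df(1)] nt'(2) df(1) by (auto simp: exchange_def)
      have n3: "head G d \<noteq> tail G d" using forest_no_loop[OF f df(1)] .
      have n4: "head G d \<notin> past (exchange f e) (tail G d)"
        using X(2) in_past_iff[OF forestsD(1)[OF f'F]] da by auto
      have "tail G d \<in> D" using df e by simp
      note U' = update_exchange[OF f'F this n1 n2 n3 n4]
      show ?thesis unfolding U(1) U' X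
        using f'F da df prod_exchange[OF f _ e(2) d, of c] by auto
    qed
  qed
  then show "update f e \<in> forests D" "d \<in> arcs G" "tail G d = tail G e"
    "update (update f e) d = f" "undo_arc (update f e) d = e"
    "finite D \<Longrightarrow> c e * prod c f = c d * prod c (update f e)" by auto
qed

text \<open>A cycle uses finitely many arcs, so acyclicity survives arcwise limits.\<close>

lemma trancl_arc_rel_finite:
  assumes "(x, y) \<in> (arc_rel f)\<^sup>+"
  shows "\<exists>B. finite B \<and> B \<subseteq> f \<and> (x, y) \<in> (arc_rel B)\<^sup>+"
  using assms
proof (induction rule: trancl_induct)
  case (base y)
  then obtain e where "e \<in> f" "x = tail G e" "y = head G e" by (auto simp: arc_rel_def)
  then show ?case by (intro exI[of _ "{e}"]) (auto simp: arc_rel_def)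
next
  case (step y z)
  then obtain B e where B: "finite B" "B \<subseteq> f" "(x, y) \<in> (arc_rel B)\<^sup>+"
    and e: "e \<in> f" "y = tail G e" "z = head G e" by (auto simp: arc_rel_def)
  have "(x, y) \<in> (arc_rel (insert e B))\<^sup>+"
    using B(3) by (rule trancl_mono) auto
  moreover have "(y, z) \<in> arc_rel (insert e B)" using e by auto
  ultimately have "(x, z) \<in> (arc_rel (insert e B))\<^sup>+" by (rule trancl_into_trancl)
  then show ?case using B e by (intro exI[of _ "insert e B"]) auto
qed

text \<open>Restricted to the finite set \<open>C\<close>, an acyclic relation has a sink; the arc
  leaving that sink must lead out of \<open>C\<close>.\<close>

lemma acyclic_arc_rel_exit:
  assumes "acyclic (arc_rel f)" "finite C" "C \<noteq> {}" "C \<subseteq> tail G ` f"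
  shows "\<exists>e\<in>f. tail G e \<in> C \<and> head G e \<notin> C"
proof (rule ccontr)
  assume no: "\<not> ?thesis"
  let ?r = "arc_rel f \<inter> C \<times> C"
  have "finite ?r" using assms(2) by auto
  moreover have "acyclic ?r" using assms(1) by (rule acyclic_subset) auto
  ultimately have "wf (?r\<inverse>)" by (rule finite_acyclic_wf_converse)
  moreover obtain x where "x \<in> C" using assms(3) by blast
  ultimately obtain z where z: "z \<in> C" "\<And>y. (y, z) \<in> ?r\<inverse> \<Longrightarrow> y \<notin> C"
    by (rule wfE_min) metis
  from z(1) assms(4) have "z \<in> tail G ` f" by (rule subsetD[rotated])
  then obtain e where e: "e \<in> f" "tail G e = z" by (auto simp only: image_iff)
  then have h: "head G e \<in> C" using no z(1) by blast
  have "(tail G e, head G e) \<in> arc_rel f" using e(1) by (simp add: arc_rel_def)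
  then have "(head G e, z) \<in> ?r\<inverse>" using h z(1) e(2) by simp
  from z(2)[OF this] h show False by simp
qed

lemma awalk_verts_conv_heads: "cas u p w \<Longrightarrow> awalk_verts u p = u # map (head G) p"
  by (induction p arbitrary: u) auto

text \<open>A counting argument: an unoriented cycle has as many edges as vertices. Oriented as in
  \<open>f\<close>, its edges have distinct tails among these vertices, so they use up all arcs of
  \<open>f\<close> leaving them. Then no arc of \<open>f\<close> leads out of this finite set,
  against \<open>acyclic_arc_rel_exit\<close>.\<close>

lemma forests_verts_spanning: "forests (verts G) \<subseteq> spanning_forests"
proof
  fix f assume f: "f \<in> forests (verts G)"
  have no_cycle: False if p: "unoriented_cycle p" "set p \<subseteq> f \<union> arev ` f" for p
  proof -
    from p(1) obtain u where u: "awalk u p u" "distinct (tl (awalk_verts u p))" "p \<noteq> []"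
      and ar: "\<And>e. e \<in> set p \<Longrightarrow> arev e \<notin> set p"
      by (auto simp: unoriented_cycle_def cycle_def)
    then have cas: "cas u p u" and pa: "set p \<subseteq> arcs G" by (auto simp: awalk_def)
    have av: "awalk_verts u p = map (tail G) p @ [u]" using awalk_verts_conv_tails[OF cas] .
    have ah: "awalk_verts u p = u # map (head G) p"
      using awalk_verts_conv_heads[OF cas] .
    let ?C = "head G ` set p"
    have dh: "distinct (map (head G) p)" using u(2) ah by simp
    have C_eq: "?C = tail G ` set p"
    proof -
      obtain b q where bq: "p = q @ [b]" using u(3) by (metis rev_exhaust)
      obtain a r where ar: "p = a # r" using u(3) by (cases p) auto
      have "head G b = u" using cas_butlast[OF cas u(3)] bq by simp
      then have "u \<in> ?C" using bq by auto
      have "tail G a = u" using cas ar by simp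
      then have "u \<in> tail G ` set p" using ar by auto
      have "insert u ?C = insert u (tail G ` set p)"
        using arg_cong[OF trans[OF ah[symmetric] av], of set] by simp
      then show ?thesis using insert_absorb[OF \<open>u \<in> ?C\<close>] insert_absorb[OF \<open>u \<in> tail G ` set p\<close>] by simp
    qed
    \<comment> \<open>\<open>\<phi>\<close> gives every edge of the cycle its orientation in
      \<open>f\<close>. It is injective because an unoriented cycle never contains both an arc and
      its reversal.\<close>
    define \<phi> where "\<phi> a = (if a \<in> f then a else arev a)" for a
    have \<phi>f: "\<phi> a \<in> f" if "a \<in> set p" for a
      using p(2) that by (auto simp: \<phi>_def)
    have \<phi>C: "tail G (\<phi> a) \<in> ?C" "head G (\<phi> a) \<in> ?C" if "a \<in> set p" for a
    proof -
      have "a \<in> arcs G" "head G a \<in> ?C" "tail G a \<in> ?C" using that pa C_eq by blast+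
      then show "tail G (\<phi> a) \<in> ?C" "head G (\<phi> a) \<in> ?C" by (simp_all add: \<phi>_def)
    qed
    have "inj_on \<phi> (set p)"
    proof
      fix a b assume "a \<in> set p" "b \<in> set p" "\<phi> a = \<phi> b"
      then show "a = b" using ar by (auto simp: \<phi>_def arev_eq_iff split: if_splits)
    qed
    then have "inj_on (tail G \<circ> \<phi>) (set p)"
      using forestsD(2)[OF f] \<phi>f by (intro comp_inj_on) (auto intro: inj_on_subset)
    then have "card ((tail G \<circ> \<phi>) ` set p) = card (set p)" by (rule card_image)
    moreover have "card ?C = card (set p)"
      using dh by (intro card_image) (simp add: distinct_map)
    moreover have "(tail G \<circ> \<phi>) ` set p \<subseteq> ?C" using \<phi>C by auto
    ultimately have surj: "(tail G \<circ> \<phi>) ` set p = ?C"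
      by (intro card_subset_eq) auto
    have "?C \<subseteq> tail G ` f" unfolding surj[symmetric] using \<phi>f by auto
    then obtain e where e: "e \<in> f" "tail G e \<in> ?C" "head G e \<notin> ?C"
      using acyclic_arc_rel_exit[OF forestsD(4)[OF f], of ?C] u(3) by auto
    from e(2) obtain a where a: "a \<in> set p" "tail G (\<phi> a) = tail G e"
      unfolding surj[symmetric] by auto
    then have "\<phi> a = e" using forestsD(2)[OF f] \<phi>f e(1) by (auto simp: inj_on_def)
    with \<phi>C(2)[OF a(1)] e(3) show False by simp
  qed
  have "\<exists>!e. e \<in> f \<and> tail G e = v" if "v \<in> verts G" for v
  proof -
    from that have "v \<in> tail G ` f" using forestsD(3)[OF f] by simp
    then obtain e where "e \<in> f" "tail G e = v" by auto
    then show ?thesis using forestsD(2)[OF f] by (auto simp: inj_on_def)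
  qed
  with no_cycle forest_arev[OF f] forestsD(1)[OF f]
  show "f \<in> spanning_forests" unfolding spanning_forests_def mem_Collect_eq by (intro conjI ballI notI) auto
qed

end

locale transient_network = network G arev c
  for G :: "('v, 'e) pre_digraph" (structure) and arev :: "'e \<Rightarrow> 'e" and c :: "'e \<Rightarrow> real" +
  assumes infinite_verts: "infinite (verts G)"
    and countable_verts: "countable (verts G)"
    and transient: transient
begin

section \<open>Jump probabilities\<close>

definition jump :: "'e \<Rightarrow> real" where
  "jump e = c e / vertex_conductance (tail G e)"

definition walk_prob :: "'e list \<Rightarrow> ennreal" where
  "walk_prob w = prod_list (map (\<lambda>e. ennreal (jump e)) w)"

lemma countable_arcs: "countable (arcs G)"
proof -
  have "arcs G \<subseteq> (\<Union>x\<in>verts G. out_arcs G x)" by (auto simp: out_arcs_def)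
  moreover have "countable (\<Union>x\<in>verts G. out_arcs G x)"
    using countable_verts locally_finite by (intro countable_UN) (auto intro: countable_finite)
  ultimately show ?thesis by (rule countable_subset)
qed

lemma out_arcs_nonempty:
  assumes "u \<in> verts G"
  shows "out_arcs G u \<noteq> {}"
proof -
  obtain w where w: "w \<in> verts G" "w \<noteq> u"
    using infinite_verts assms by (metis finite.simps insertCI subsetI finite_subset infinite_imp_nonempty)
  then have "u \<rightarrow>\<^sup>* w" using connected assms unfolding strongly_connected_def by blast
  then obtain p where p: "awalk u p w" by (auto simp: reachable_awalk)
  then show ?thesis using w by (cases p) (auto simp: awalk_simps)
qed

lemma vertex_conductance_pos: "u \<in> verts G \<Longrightarrow> 0 < vertex_conductance u"
  unfolding vertex_conductance_def
  using out_arcs_nonempty locally_finite conductance_pos by (intro sum_pos) auto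

lemma jump_pos: "e \<in> arcs G \<Longrightarrow> 0 < jump e"
  using conductance_pos vertex_conductance_pos by (auto simp: jump_def)

lemma sum_jump:
  assumes "u \<in> verts G"
  shows "(\<Sum>e\<in>out_arcs G u. jump e) = 1"
proof -
  have "(\<Sum>e\<in>out_arcs G u. jump e) = (\<Sum>e\<in>out_arcs G u. c e / vertex_conductance u)"
    by (intro sum.cong) (auto simp: jump_def)
  also have "\<dots> = vertex_conductance u / vertex_conductance u"
    unfolding sum_divide_distrib[symmetric] by (simp add: vertex_conductance_def)
  finally show ?thesis using vertex_conductance_pos[OF assms] by simp
qed

subsection \<open>The law of the random walk\<close>

lemma emeasure_step_law:
  assumes "u \<in> verts G" "A \<subseteq> arcs G"
  shows "emeasure (step_law u) A = (\<Sum>e\<in>out_arcs G u \<inter> A. ennreal (jump e))"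
proof -
  have "emeasure (step_law u) A = (\<integral>\<^sup>+ e. (if tail G e = u then ennreal (c e / vertex_conductance u) else 0) * indicator A e \<partial>count_space (arcs G))"
    unfolding step_law_def point_measure_def using assms(2) by (intro emeasure_density) auto
  also have "\<dots> = (\<Sum>e\<in>out_arcs G u \<inter> A. (if tail G e = u then ennreal (c e / vertex_conductance u) else 0) * indicator A e)"
    by (intro nn_integral_count_space') (use assms locally_finite in \<open>auto simp: indicator_def\<close>)
  also have "\<dots> = (\<Sum>e\<in>out_arcs G u \<inter> A. ennreal (jump e))"
    by (intro sum.cong) (auto simp: jump_def)
  finally show ?thesis .
qed

lemma sets_step_law: "sets (step_law u) = Pow (arcs G)"
  and space_step_law: "space (step_law u) = arcs G"
  by (auto simp: step_law_def point_measure_def)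

lemma prob_space_step_law:
  assumes "u \<in> verts G"
  shows "prob_space (step_law u)"
proof
  have "out_arcs G u \<inter> arcs G = out_arcs G u" by auto
  then have "emeasure (step_law u) (arcs G) = (\<Sum>e\<in>out_arcs G u. ennreal (jump e))"
    using emeasure_step_law[OF assms, of "arcs G"] by simp
  also have "\<dots> = ennreal (\<Sum>e\<in>out_arcs G u. jump e)"
    using jump_pos by (intro sum_ennreal) (auto intro: less_imp_le)
  finally show "emeasure (step_law u) (space (step_law u)) = 1"
    using sum_jump[OF assms] by (simp add: space_step_law)
qed

abbreviation arc_spaces :: "nat \<Rightarrow> 'e measure" where
  "arc_spaces \<equiv> \<lambda>_. count_space (arcs G)"

lemma Ionescu_Tulcea_walk:
  assumes v: "v \<in> verts G"
  shows "Ionescu_Tulcea (step_kernel v) arc_spaces"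
proof (rule Ionescu_Tulcea.intro)
  fix i :: nat
  have mem: "(case i of 0 \<Rightarrow> v | Suc m \<Rightarrow> head G (x m)) \<in> verts G"
    if "x \<in> space (PiM {0..<i} arc_spaces)" for x
    using that v by (cases i) (auto simp: space_PiM PiE_iff)
  show "prob_space (step_kernel v i x)" if "x \<in> space (PiM {0..<i} arc_spaces)" for x
    unfolding step_kernel_def using mem[OF that] by (rule prob_space_step_law)
  have sub: "step_law u \<in> space (subprob_algebra (count_space (arcs G)))" if "u \<in> verts G" for u
    using prob_space_step_law[OF that] sets_step_law
    by (auto simp: space_subprob_algebra prob_space_imp_subprob_space)
  show "step_kernel v i \<in> measurable (PiM {0..<i} arc_spaces) (subprob_algebra (count_space (arcs G)))"
  proof (cases i)
    case 0
    then have "step_kernel v i = (\<lambda>x. step_law v)" by (auto simp: step_kernel_def)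
    then show ?thesis using sub[OF v] by auto
  next
    case (Suc m)
    then have "step_kernel v i = (\<lambda>x. step_law (head G (x m)))" by (auto simp: step_kernel_def)
    moreover have "(\<lambda>x. x m) \<in> measurable (PiM {0..<i} arc_spaces) (count_space (arcs G))"
      using Suc by (intro measurable_component_singleton) auto
    moreover have "(\<lambda>e. step_law (head G e)) \<in> measurable (count_space (arcs G)) (subprob_algebra (count_space (arcs G)))"
      using sub by auto
    ultimately show ?thesis by (auto intro: measurable_compose)
  qed
qed

lemma
  assumes v: "v \<in> verts G"
  shows sets_walk_law: "sets (walk_law v) = sets (PiM UNIV arc_spaces)"
    and space_walk_law: "space (walk_law v) = (UNIV \<rightarrow>\<^sub>E arcs G)"
    and prob_space_walk_law: "prob_space (walk_law v)"
proof -
  interpret IT: Ionescu_Tulcea "step_kernel v" arc_spaces using v by (rule Ionescu_Tulcea_walk)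
  have eq: "walk_law v = IT.PF.lim" by (simp add: walk_law_def)
  show "sets (walk_law v) = sets (PiM UNIV arc_spaces)" unfolding eq by simp
  show "space (walk_law v) = (UNIV \<rightarrow>\<^sub>E arcs G)" unfolding eq by (simp add: space_PiM)
  \<comment> \<open>The whole space is the cylinder over the empty index set, on which the
    projective limit has mass one.\<close>
  have "emeasure IT.PF.lim (IT.PF.emb UNIV {} (space (PiM {} arc_spaces))) = emeasure (IT.CI {}) (space (PiM {} arc_spaces))"
    by (rule IT.lim) auto
  also have "IT.PF.emb UNIV {} (space (PiM {} arc_spaces)) = space IT.PF.lim"
    by (auto simp: prod_emb_def space_PiM)
  also have "emeasure (IT.CI {}) (space (PiM {} arc_spaces)) = 1"
    using prob_space.emeasure_space_1[OF IT.PF.prob_space_P[of "{}"]] by (simp add: IT.CI_def)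
  finally show "prob_space (walk_law v)" unfolding eq by (intro prob_spaceI)
qed

section \<open>Finite walks and their weights\<close>

definition starts_with :: "(nat \<Rightarrow> 'e) \<Rightarrow> 'e list \<Rightarrow> bool" where
  "starts_with \<omega> w \<longleftrightarrow> (\<forall>i<length w. \<omega> i = w ! i)"

definition is_walk :: "'v \<Rightarrow> 'e list \<Rightarrow> bool" where
  "is_walk u w \<longleftrightarrow> (\<exists>z. awalk u w z)"

lemma is_walk_Nil [simp]: "is_walk u [] \<longleftrightarrow> u \<in> verts G"
  by (auto simp: is_walk_def awalk_simps)

lemma is_walk_Cons [simp]:
  "is_walk u (e # w) \<longleftrightarrow> e \<in> out_arcs G u \<and> is_walk (head G e) w"
  by (auto simp: is_walk_def awalk_simps)

lemma is_walkD: "is_walk u w \<Longrightarrow> u \<in> verts G" "is_walk u w \<Longrightarrow> set w \<subseteq> arcs G"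
  by (auto simp: is_walk_def awalk_def)

lemma is_walk_nth:
  assumes "is_walk u w" "i < length w"
  shows "tail G (w ! i) = (case i of 0 \<Rightarrow> u | Suc m \<Rightarrow> head G (w ! m))"
  using assms
proof (induction w arbitrary: u i)
  case (Cons e w)
  then show ?case by (cases i) (auto split: nat.splits)
qed simp

text \<open>Induction along the Ionescu-Tulcea kernels, applied to the singletons of initial
  segments. All later events of a single walk are reduced to these cylinders, so the kernels are
  evaluated only here.\<close>

lemma emeasure_starts_with:
  assumes w: "is_walk v w"
  shows "emeasure (walk_law v) {\<omega> \<in> space (walk_law v). starts_with \<omega> w} = walk_prob w"
proof -
  have v: "v \<in> verts G" using w by (rule is_walkD)
  interpret IT: Ionescu_Tulcea "step_kernel v" arc_spaces using v by (rule Ionescu_Tulcea_walk)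
  have wa: "w ! i \<in> arcs G" if "i < length w" for i
    using is_walkD(2)[OF w] that by auto
  define r where "r n = restrict ((!) w) {0..<n}" for n
  have r_space: "r n \<in> space (PiM {0..<n} arc_spaces)" if "n \<le> length w" for n
    using that wa by (auto simp: r_def space_PiM)
  have r_sets: "{r n} \<in> sets (PiM {0..<n} arc_spaces)" if "n \<le> length w" for n
  proof -
    have "{r n} = PiE {0..<n} (\<lambda>i. {w ! i})"
      by (auto simp: r_def PiE_iff extensional_def fun_eq_iff)
    also have "\<dots> \<in> sets (PiM {0..<n} arc_spaces)"
      using that wa by (intro sets_PiM_I_finite) auto
    finally show ?thesis .
  qed
  have C: "emeasure (IT.C 0 n (\<lambda>_. undefined)) {r n} = (\<Prod>i<n. ennreal (jump (w ! i)))"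
    if "n \<le> length w" for n
    using that
  proof (induction n)
    case 0
    have "r 0 = (\<lambda>_. undefined)" by (auto simp: r_def)
    then show ?case using r_sets[of 0] by simp
  next
    case (Suc n)
    then have n: "n < length w" by simp
    have und: "(\<lambda>_. undefined) \<in> space (PiM {0..<0} arc_spaces)" by (simp add: space_PiM)
    have sC: "sets (IT.C 0 n (\<lambda>_. undefined)) = sets (PiM {0..<n} arc_spaces)"
      using IT.sets_C[OF und, of n] by simp
    have "IT.eP n \<in> measurable (IT.C 0 n (\<lambda>_. undefined)) (subprob_algebra (PiM {0..<Suc n} arc_spaces))"
      unfolding measurable_cong_sets[OF sC refl] by (rule IT.measurable_eP)
    then have "emeasure (IT.C 0 (Suc n) (\<lambda>_. undefined)) {r (Suc n)} =
       (\<integral>\<^sup>+x. emeasure (IT.eP n x) {r (Suc n)} \<partial>IT.C 0 n (\<lambda>_. undefined))"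
      using prob_space.not_empty[OF IT.prob_space_C[OF und, of n]] r_sets[OF Suc.prems]
      by (simp, subst emeasure_bind[where N="PiM {0..<Suc n} arc_spaces"]) auto
    also have "\<dots> = (\<integral>\<^sup>+x. ennreal (jump (w ! n)) * indicator {r n} x \<partial>IT.C 0 n (\<lambda>_. undefined))"
    proof (rule nn_integral_cong)
      fix x assume "x \<in> space (IT.C 0 n (\<lambda>_. undefined))"
      then have x: "x \<in> space (PiM {0..<n} arc_spaces)" using IT.space_C[OF und, of n] by simp
      have "emeasure (IT.eP n x) {r (Suc n)} = emeasure (step_kernel v n x) ((\<lambda>a. x(n := a)) -` {r (Suc n)} \<inter> arcs G)"
        using IT.emeasure_eP[OF x r_sets[OF Suc.prems]] by simp
      \<comment> \<open>An extension of \<open>x\<close> by one step equals \<open>r (Suc n)\<close>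
        only if \<open>x = r n\<close>, which reduces the integral to the mass of the singleton
        \<open>{r n}\<close>.\<close>
      also have "(\<lambda>a. x(n := a)) -` {r (Suc n)} \<inter> arcs G = (if x = r n then {w ! n} else {})"
      proof -
        have "x(n := a) = r (Suc n) \<longleftrightarrow> a = w ! n \<and> x = r n" for a
        proof
          assume eq: "x(n := a) = r (Suc n)"
          have "a = w ! n" using fun_cong[OF eq, of n] by (simp add: r_def)
          moreover have "x i = r n i" for i
            using fun_cong[OF eq, of i] x by (cases "i = n") (auto simp: r_def space_PiM PiE_iff extensional_def split: if_splits)
          ultimately show "a = w ! n \<and> x = r n" by auto
        next
          assume "a = w ! n \<and> x = r n"
          then show "x(n := a) = r (Suc n)" by (auto simp: r_def fun_eq_iff)
        qed
        then show ?thesis using wa[OF n] by auto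
      qed
      also have "emeasure (step_kernel v n x) (if x = r n then {w ! n} else {}) = ennreal (jump (w ! n)) * indicator {r n} x"
      proof (cases "x = r n")
        case True
        define u where "u = (case n of 0 \<Rightarrow> v | Suc m \<Rightarrow> head G (w ! m))"
        have "step_kernel v n x = step_law u"
          using True n by (auto simp: step_kernel_def u_def r_def split: nat.splits)
        moreover have "u = tail G (w ! n)" unfolding u_def using is_walk_nth[OF w n] by simp
        moreover have "out_arcs G (tail G (w ! n)) \<inter> {w ! n} = {w ! n}" using wa[OF n] by auto
        ultimately show ?thesis using True emeasure_step_law[of u "{w ! n}"] wa[OF n] by auto
      qed auto
      finally show "emeasure (IT.eP n x) {r (Suc n)} = ennreal (jump (w ! n)) * indicator {r n} x" .
    qed
    also have "\<dots> = ennreal (jump (w ! n)) * emeasure (IT.C 0 n (\<lambda>_. undefined)) {r n}"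
      using r_sets[of n] n IT.sets_C[OF und, of n] by (intro nn_integral_cmult_indicator) auto
    also have "\<dots> = (\<Prod>i<Suc n. ennreal (jump (w ! i)))"
      using Suc n by (simp add: mult.commute)
    finally show ?case .
  qed
  have "emeasure IT.PF.lim (IT.PF.emb UNIV {0..<length w} {r (length w)}) = emeasure (IT.CI {0..<length w}) {r (length w)}"
    by (rule IT.lim) (auto intro: r_sets)
  also have "\<dots> = emeasure (IT.C 0 (length w) (\<lambda>_. undefined)) (IT.PF.emb {0..<length w} {0..<length w} {r (length w)})"
    by (rule IT.emeasure_CI) (auto intro: r_sets)
  also have "IT.PF.emb {0..<length w} {0..<length w} {r (length w)} = {r (length w)}"
    using r_sets[of "length w"] by (intro prod_emb_id) (use sets.sets_into_space in \<open>fastforce simp: space_PiM\<close>)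
  also have "emeasure (IT.C 0 (length w) (\<lambda>_. undefined)) {r (length w)} = walk_prob w"
    unfolding C[OF order.refl] by (simp add: walk_prob_def prod.list_conv_set_nth lessThan_atLeast0)
  also have "IT.PF.emb UNIV {0..<length w} {r (length w)} = {\<omega> \<in> space (walk_law v). starts_with \<omega> w}"
    unfolding space_walk_law[OF v]
    by (auto simp: prod_emb_def starts_with_def r_def fun_eq_iff restrict_def split: if_splits)
  finally show ?thesis by (simp add: walk_law_def)
qed

text \<open>This is not a probability measure: the walks of each length from one vertex already have
  mass one. On a prefix-free set of walks it coincides with the law of the walk
  (\<open>emeasure_prefix_free\<close>), and it is multiplicative under concatenation.\<close>

definition words :: "'e list measure" where
  "words = density (count_space UNIV) walk_prob"

lemma sets_words [simp, measurable_cong]: "sets words = UNIV"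
  and space_words [simp]: "space words = UNIV"
  by (auto simp: words_def)

lemma walk_prob_simps [simp]:
  "walk_prob [] = 1"
  "walk_prob (e # w) = ennreal (jump e) * walk_prob w"
  "walk_prob (w @ w') = walk_prob w * walk_prob w'"
  by (auto simp: walk_prob_def)

lemma emeasure_words: "emeasure words A = (\<integral>\<^sup>+w. walk_prob w \<partial>count_space A)"
  unfolding words_def by (subst emeasure_density) (auto simp: nn_integral_count_space_indicator mult.commute)

lemma emeasure_words_Cons: "emeasure words ((#) e ` A) = ennreal (jump e) * emeasure words A"
proof -
  have "emeasure words ((#) e ` A) = (\<integral>\<^sup>+w. walk_prob (e # w) \<partial>count_space A)"
    unfolding emeasure_words
    by (rule nn_integral_bij_count_space[symmetric]) (auto simp: bij_betw_def)
  also have "\<dots> = ennreal (jump e) * emeasure words A"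
    unfolding emeasure_words by (simp add: nn_integral_cmult)
  finally show ?thesis .
qed

text \<open>The Markov property at time one, for words.\<close>

lemma emeasure_words_step:
  assumes "u \<in> verts G"
  shows "emeasure words (\<Union>e\<in>out_arcs G u. (#) e ` A e) = (\<Sum>e\<in>out_arcs G u. ennreal (jump e) * emeasure words (A e))"
proof -
  have "(\<Sum>e\<in>out_arcs G u. emeasure words ((#) e ` A e)) = emeasure words (\<Union>e\<in>out_arcs G u. (#) e ` A e)"
    by (rule sum_emeasure) (use locally_finite[OF assms] in \<open>auto simp: disjoint_family_on_def\<close>)
  then show ?thesis by (simp add: emeasure_words_Cons)
qed

lemma emeasure_words_pairs:
  "(\<integral>\<^sup>+(a, b). walk_prob (a @ b) \<partial>count_space (A \<times> B)) = emeasure words A * emeasure words B"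
proof -
  have "(\<integral>\<^sup>+(a, b). walk_prob (a @ b) \<partial>count_space (A \<times> B)) =
    (\<integral>\<^sup>+ x. walk_prob (fst x) * indicator A (fst x) * (walk_prob (snd x) * indicator B (snd x)) \<partial>count_space UNIV)"
    by (subst nn_integral_count_space_indicator)
       (auto intro!: nn_integral_cong simp: indicator_def split: prod.splits)
  also have "\<dots> = (\<integral>\<^sup>+ a. \<integral>\<^sup>+ b. walk_prob a * indicator A a * (walk_prob b * indicator B b) \<partial>count_space UNIV \<partial>count_space UNIV)"
    by (subst nn_integral_fst_count_space[symmetric]) simp
  also have "\<dots> = (\<integral>\<^sup>+ a. walk_prob a * indicator A a * emeasure words B \<partial>count_space UNIV)"
    by (simp add: nn_integral_cmult emeasure_words nn_integral_count_space_indicator)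
  also have "\<dots> = emeasure words A * emeasure words B"
    by (simp add: nn_integral_multc emeasure_words nn_integral_count_space_indicator)
  finally show ?thesis .
qed

text \<open>This stands for the strong Markov property: \<open>A\<close> collects the pasts at a
  stopping time, \<open>B\<close> the futures, and injectivity says that the word determines where
  it is to be cut.\<close>

lemma emeasure_words_append:
  assumes "inj_on (\<lambda>(a, b). a @ b) (A \<times> B)"
  shows "emeasure words ((\<lambda>(a, b). a @ b) ` (A \<times> B)) = emeasure words A * emeasure words B"
proof -
  have "emeasure words ((\<lambda>(a, b). a @ b) ` (A \<times> B)) = (\<integral>\<^sup>+x. walk_prob ((\<lambda>(a, b). a @ b) x) \<partial>count_space (A \<times> B))"
    unfolding emeasure_words
    by (rule nn_integral_bij_count_space[symmetric]) (use assms in \<open>auto simp: bij_betw_def\<close>)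
  also have "\<dots> = emeasure words A * emeasure words B"
    unfolding emeasure_words_pairs[symmetric] by (intro nn_integral_cong) auto
  finally show ?thesis .
qed

text \<open>Without a unique cut an upper bound remains: \<open>S\<close> keeps one decomposition
  for each word.\<close>

lemma emeasure_words_append_le:
  "emeasure words ((\<lambda>(a, b). a @ b) ` (A \<times> B)) \<le> emeasure words A * emeasure words B"
proof -
  obtain S where S: "S \<subseteq> A \<times> B" "inj_on (\<lambda>(a, b). a @ b) S"
    "(\<lambda>(a, b). a @ b) ` (A \<times> B) = (\<lambda>(a, b). a @ b) ` S"
    by (rule subset_image_inj[THEN iffD1, OF order.refl, THEN exE]) (elim conjE)
  have "emeasure words ((\<lambda>(a, b). a @ b) ` (A \<times> B)) = (\<integral>\<^sup>+x. walk_prob ((\<lambda>(a, b). a @ b) x) \<partial>count_space S)"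
    unfolding S(3) emeasure_words
    by (rule nn_integral_bij_count_space[symmetric]) (use S(2) in \<open>auto simp: bij_betw_def\<close>)
  also have "\<dots> \<le> (\<integral>\<^sup>+x. walk_prob ((\<lambda>(a, b). a @ b) x) \<partial>count_space (A \<times> B))"
  proof -
    have "(\<integral>\<^sup>+x. h x \<partial>count_space S) \<le> (\<integral>\<^sup>+x. h x \<partial>count_space (A \<times> B))" for h :: "'e list \<times> 'e list \<Rightarrow> ennreal"
      using S(1) by (subst (1 2) nn_integral_count_space_indicator)
        (auto intro!: nn_integral_mono simp: indicator_def)
    then show ?thesis .
  qed
  also have "\<dots> = emeasure words A * emeasure words B"
    unfolding emeasure_words_pairs[symmetric] by (intro nn_integral_cong) auto
  finally show ?thesis .
qed

subsection \<open>Events determined by an initial segment of the walk\<close>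

text \<open>The words read up to a stopping time form such a set. The cylinders over its elements
  are disjoint, so probabilities become sums over words.\<close>

definition prefix_free :: "'e list set \<Rightarrow> bool" where
  "prefix_free A \<longleftrightarrow> (\<forall>w x. w \<in> A \<longrightarrow> w @ x \<in> A \<longrightarrow> x = [])"

lemma starts_with_append: "starts_with \<omega> (w @ x) \<Longrightarrow> starts_with \<omega> w"
  by (auto simp: starts_with_def nth_append)

lemma starts_with_map: "starts_with \<omega> (map \<omega> [0..<n])"
  by (simp add: starts_with_def)

lemma starts_with_linear:
  assumes "starts_with \<omega> w" "starts_with \<omega> w'"
  shows "(\<exists>x. w' = w @ x) \<or> (\<exists>x. w = w' @ x)"
proof -
  have "\<exists>x. w' = w @ x" if "starts_with \<omega> w" "starts_with \<omega> w'" "length w \<le> length w'" for w w'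
  proof -
    have "take (length w) w' = w" using that by (intro nth_equalityI) (auto simp: starts_with_def)
    then show ?thesis by (metis append_take_drop_id)
  qed
  from this[of w w'] this[of w' w] show ?thesis
    using assms nat_le_linear[of "length w" "length w'"] by auto
qed

lemma countable_walks: "countable {w. is_walk v w}"
proof (rule countable_subset)
  show "{w. is_walk v w} \<subseteq> lists (arcs G)" using is_walkD(2) by blast
  show "countable (lists (arcs G))" using countable_arcs by (rule countable_lists)
qed

lemma starts_with_sets:
  assumes "v \<in> verts G"
  shows "{\<omega> \<in> space (walk_law v). starts_with \<omega> w} \<in> sets (walk_law v)"
proof -
  have "{\<omega> \<in> space (walk_law v). \<omega> i = w ! i} \<in> sets (walk_law v)" for i
  proof -
    have "(\<lambda>\<omega>. \<omega> i) \<in> measurable (walk_law v) (count_space (arcs G))"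
      unfolding measurable_cong_sets[OF sets_walk_law[OF assms] refl]
      by (rule measurable_component_singleton) simp
    then have "(\<lambda>\<omega>. \<omega> i) -` ({w ! i} \<inter> arcs G) \<inter> space (walk_law v) \<in> sets (walk_law v)"
      by (rule measurable_sets) auto
    also have "(\<lambda>\<omega>. \<omega> i) -` ({w ! i} \<inter> arcs G) \<inter> space (walk_law v) = {\<omega> \<in> space (walk_law v). \<omega> i = w ! i}"
      unfolding space_walk_law[OF assms] by (rule set_eqI) (simp add: PiE_iff, blast)
    finally show ?thesis .
  qed
  then have "{\<omega> \<in> space (walk_law v). \<forall>i\<in>{..<length w}. \<omega> i = w ! i} \<in> sets (walk_law v)"
    by (rule sets.sets_Collect_finite_All) simp
  then show ?thesis unfolding starts_with_def by (simp only: Ball_def lessThan_iff)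
qed

lemma sets_starts_with_some:
  assumes "v \<in> verts G" "A \<subseteq> {w. is_walk v w}"
  shows "{\<omega> \<in> space (walk_law v). \<exists>w\<in>A. starts_with \<omega> w} \<in> sets (walk_law v)"
  using assms starts_with_sets countable_subset[OF assms(2) countable_walks]
  by (intro sets.sets_Collect_countable_Ex') auto

lemma emeasure_prefix_free:
  assumes v: "v \<in> verts G" and A: "A \<subseteq> {w. is_walk v w}" "prefix_free A"
  shows "emeasure (walk_law v) {\<omega> \<in> space (walk_law v). \<exists>w\<in>A. starts_with \<omega> w} = emeasure words A"
proof -
  have "{\<omega> \<in> space (walk_law v). \<exists>w\<in>A. starts_with \<omega> w} = (\<Union>w\<in>A. {\<omega> \<in> space (walk_law v). starts_with \<omega> w})"
    by auto
  also have "emeasure (walk_law v) \<dots> = (\<integral>\<^sup>+w. emeasure (walk_law v) {\<omega> \<in> space (walk_law v). starts_with \<omega> w} \<partial>count_space A)"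
  proof (rule emeasure_UN_countable)
    show "countable A" using A(1) countable_walks by (rule countable_subset)
    show "disjoint_family_on (\<lambda>w. {\<omega> \<in> space (walk_law v). starts_with \<omega> w}) A"
      unfolding disjoint_family_on_def
    proof (intro ballI impI)
      fix w w' assume ww: "w \<in> A" "w' \<in> A" "w \<noteq> w'"
      have False if "starts_with \<omega> w" "starts_with \<omega> w'" for \<omega>
        using starts_with_linear[OF that] ww A(2) by (auto simp: prefix_free_def)
      then show "{\<omega> \<in> space (walk_law v). starts_with \<omega> w} \<inter> {\<omega> \<in> space (walk_law v). starts_with \<omega> w'} = {}"
        by auto
    qed
  qed (use starts_with_sets[OF v] in auto)
  also have "\<dots> = emeasure words A"
    unfolding emeasure_words using A(1) by (intro nn_integral_cong emeasure_starts_with) auto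
  finally show ?thesis .
qed

text \<open>The words of \<open>A\<close> without a proper prefix in \<open>A\<close> form a
  prefix-free set that defines the same event.\<close>

lemma emeasure_starts_with_some_le:
  assumes v: "v \<in> verts G" and A: "A \<subseteq> {w. is_walk v w}"
  shows "emeasure (walk_law v) {\<omega> \<in> space (walk_law v). \<exists>w\<in>A. starts_with \<omega> w} \<le> emeasure words A"
proof -
  let ?B = "{w\<in>A. \<forall>y x. w = y @ x \<longrightarrow> y \<in> A \<longrightarrow> x = []}"
  have "\<exists>y\<in>?B. starts_with \<omega> y" if "w \<in> A" "starts_with \<omega> w" for \<omega> w
    using that
  proof (induction w rule: length_induct)
    case (1 w)
    show ?case
    proof (cases "w \<in> ?B")
      case False
      then obtain y x where "w = y @ x" "y \<in> A" "x \<noteq> []" using 1 by auto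
      then have "length y < length w" "starts_with \<omega> y"
        using 1(3) starts_with_append[of \<omega> y x] by auto
      with 1(1)[rule_format, of y] \<open>y \<in> A\<close> show ?thesis by blast
    qed (use 1 in blast)
  qed
  then have "{\<omega> \<in> space (walk_law v). \<exists>w\<in>A. starts_with \<omega> w} = {\<omega> \<in> space (walk_law v). \<exists>w\<in>?B. starts_with \<omega> w}"
    by blast
  also have "emeasure (walk_law v) \<dots> = emeasure words ?B"
    using A by (intro emeasure_prefix_free v) (auto simp: prefix_free_def)
  also have "\<dots> \<le> emeasure words A" by (intro emeasure_mono) auto
  finally show ?thesis .
qed

lemma emeasure_words_prefix_free_le_1:
  assumes "v \<in> verts G" "A \<subseteq> {w. is_walk v w}" "prefix_free A"
  shows "emeasure words A \<le> 1"
  unfolding emeasure_prefix_free[OF assms, symmetric]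
  using prob_space_walk_law[OF assms(1)] by (rule prob_space.emeasure_le_1)

section \<open>Exits, returns and transience\<close>

definition trajectory :: "'v \<Rightarrow> (nat \<Rightarrow> 'e) \<Rightarrow> bool" where
  "trajectory v \<omega> \<longleftrightarrow> range \<omega> \<subseteq> arcs G \<and> tail G (\<omega> 0) = v \<and> (\<forall>n. head G (\<omega> n) = tail G (\<omega> (Suc n)))"

lemma emeasure_words_length:
  "v \<in> verts G \<Longrightarrow> emeasure words {w. is_walk v w \<and> length w = n} = 1"
proof (induction n arbitrary: v)
  case 0
  have "{w. is_walk v w \<and> length w = 0} = {[]}" using 0 by auto
  then show ?case by (simp add: emeasure_words nn_integral_count_space_finite)
next
  case (Suc n)
  have "{w. is_walk v w \<and> length w = Suc n} = (\<Union>e\<in>out_arcs G v. (#) e ` {w. is_walk (head G e) w \<and> length w = n})"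
    by (auto simp: length_Suc_conv)
  then have "emeasure words {w. is_walk v w \<and> length w = Suc n} = (\<Sum>e\<in>out_arcs G v. ennreal (jump e))"
    using Suc by (simp add: emeasure_words_step)
  also have "\<dots> = ennreal (\<Sum>e\<in>out_arcs G v. jump e)"
    using jump_pos by (intro sum_ennreal) (auto intro: less_imp_le)
  finally show ?case using sum_jump[OF Suc.prems] by simp
qed

text \<open>The sample space consists of all sequences of arcs. That consecutive arcs fit together
  is only almost sure, and holds because the walks of each length have total weight one.\<close>

lemma AE_trajectory:
  assumes v: "v \<in> verts G"
  shows "AE \<omega> in walk_law v. trajectory v \<omega>"
proof -
  interpret prob_space "walk_law v" using v by (rule prob_space_walk_law)
  have "AE \<omega> in walk_law v. \<exists>w\<in>{w. is_walk v w \<and> length w = n}. starts_with \<omega> w" for n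
  proof -
    have "emeasure (walk_law v) {\<omega> \<in> space (walk_law v). \<exists>w\<in>{w. is_walk v w \<and> length w = n}. starts_with \<omega> w} = 1"
      using emeasure_words_length[OF v, of n]
      by (subst emeasure_prefix_free[OF v]) (auto simp: prefix_free_def)
    then have "AE \<omega> in walk_law v. \<omega> \<in> {\<omega> \<in> space (walk_law v). \<exists>w\<in>{w. is_walk v w \<and> length w = n}. starts_with \<omega> w}"
      by (intro AE_prob_1) (simp add: measure_def)
    then show ?thesis by (rule eventually_mono) blast
  qed
  then have "AE \<omega> in walk_law v. \<forall>n. \<exists>w\<in>{w. is_walk v w \<and> length w = n}. starts_with \<omega> w"
    unfolding AE_all_countable by blast
  then show ?thesis
  proof (rule AE_mp, intro AE_I2 impI)
    fix \<omega> assume "\<omega> \<in> space (walk_law v)" and *: "\<forall>n. \<exists>w\<in>{w. is_walk v w \<and> length w = n}. starts_with \<omega> w"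
    have "tail G (\<omega> n) = (case n of 0 \<Rightarrow> v | Suc m \<Rightarrow> head G (\<omega> m)) \<and> \<omega> n \<in> arcs G" for n
    proof -
      from *[rule_format, of "Suc n"] obtain w where w: "is_walk v w" "length w = Suc n" "starts_with \<omega> w" by auto
      then show ?thesis using is_walk_nth[OF w(1), of n] is_walkD(2)[OF w(1)]
        by (auto simp: starts_with_def split: nat.splits)
    qed
    then show "trajectory v \<omega>" unfolding trajectory_def
      by (auto split: nat.splits)
  qed
qed

text \<open>A walk in \<open>D\<close> stopped at its first exit \<open>z\<close>; it is empty if it
  starts outside. Removing a vertex \<open>u\<close> from \<open>D\<close> turns the first passage
  at \<open>u\<close> into an exit, so returns and escapes are instances of the same notion.\<close>

fun exit_walk :: "'v set \<Rightarrow> 'v \<Rightarrow> 'e list \<Rightarrow> 'v \<Rightarrow> bool" where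
  "exit_walk D y [] z \<longleftrightarrow> y = z \<and> z \<in> verts G \<and> z \<notin> D"
| "exit_walk D y (e # w) z \<longleftrightarrow> y \<in> D \<and> e \<in> out_arcs G y \<and> exit_walk D (head G e) w z"

lemma exit_walk_awalk: "exit_walk D y w z \<Longrightarrow> awalk y w z"
  by (induction w arbitrary: y) (auto simp: awalk_simps)

lemma exit_walk_is_walk: "exit_walk D y w z \<Longrightarrow> is_walk y w"
  using exit_walk_awalk unfolding is_walk_def by blast

lemma exit_walk_end: "exit_walk D y w z \<Longrightarrow> z \<in> verts G \<and> z \<notin> D"
  by (induction w arbitrary: y) auto

lemma exit_walk_tails: "exit_walk D y w z \<Longrightarrow> tail G ` set w \<subseteq> D"
  by (induction w arbitrary: y) auto

lemma exit_walk_prefix: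
  "exit_walk D y w z \<Longrightarrow> exit_walk D y (w @ x) z' \<Longrightarrow> x = [] \<and> z = z'"
  by (induction w arbitrary: y) (cases x; auto)+

lemma exit_walk_append:
  "exit_walk (D - {y}) x l y \<Longrightarrow> exit_walk D y w z \<Longrightarrow> exit_walk D x (l @ w) z"
  by (induction l arbitrary: x) auto

lemma exit_walk_mono:
  "exit_walk D y w z \<Longrightarrow> z \<notin> D' \<Longrightarrow> D \<subseteq> D' \<Longrightarrow> exit_walk D' y w z"
  by (induction w arbitrary: y) auto

lemma exit_walk_trajectory:
  assumes "trajectory v \<omega>" "m \<le> n" "\<And>i. m \<le> i \<Longrightarrow> i < n \<Longrightarrow> tail G (\<omega> i) \<in> D" "tail G (\<omega> n) \<notin> D"
  shows "exit_walk D (tail G (\<omega> m)) (map \<omega> [m..<n]) (tail G (\<omega> n))"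
  using assms(2,3)
proof (induction rule: inc_induct)
  case base
  have "\<omega> n \<in> arcs G" using assms(1) by (auto simp: trajectory_def)
  then show ?case using assms(4) by simp
next
  case (step m)
  have "\<omega> m \<in> arcs G" using assms(1) by (auto simp: trajectory_def)
  moreover have "head G (\<omega> m) = tail G (\<omega> (Suc m))" using assms(1) by (auto simp: trajectory_def)
  ultimately show ?case using step by (simp add: upt_conv_Cons)
qed

text \<open>Exiting \<open>D - {u}\<close> exactly at \<open>u\<close> means being back at
  \<open>u\<close> before leaving \<open>D\<close>. For \<open>D = UNIV\<close> these are all first
  returns.\<close>

definition first_returns :: "'v set \<Rightarrow> 'v \<Rightarrow> 'e list set" where
  "first_returns D u = (\<Union>e\<in>out_arcs G u. (#) e ` {w. exit_walk (D - {u}) (head G e) w u})"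

lemma first_returns_is_walk: "first_returns D u \<subseteq> {w. is_walk u w}"
  unfolding first_returns_def using exit_walk_is_walk by auto

lemma prefix_free_first_returns: "prefix_free (first_returns D u)"
  unfolding prefix_free_def first_returns_def using exit_walk_prefix by auto

lemma first_returns_awalk: "w \<in> first_returns D u \<Longrightarrow> awalk u w u \<and> w \<noteq> []"
  unfolding first_returns_def using exit_walk_awalk by (auto simp: awalk_simps)

lemma trajectory_starts_with_awalk:
  assumes "trajectory u \<omega>" "awalk u w z" "starts_with \<omega> w"
  shows "tail G (\<omega> (length w)) = z"
proof (cases "w = []")
  case True
  then show ?thesis using assms by (simp add: trajectory_def awalk_simps)
next
  case False
  then have "head G (last w) = z" using assms(2) cas_butlast unfolding awalk_def by blast
  moreover have "last w = \<omega> (length w - 1)"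
    using False assms(3) by (simp add: starts_with_def last_conv_nth)
  moreover have "head G (\<omega> (length w - 1)) = tail G (\<omega> (Suc (length w - 1)))"
    using assms(1) by (auto simp: trajectory_def)
  ultimately show ?thesis using False by simp
qed

lemma measurable_at: "v \<in> verts G \<Longrightarrow> (\<lambda>\<omega>. \<omega> n) \<in> measurable (walk_law v) (count_space (arcs G))"
  unfolding measurable_cong_sets[OF sets_walk_law refl]
  by (rule measurable_component_singleton) simp

text \<open>Transience enters through this bound: a trajectory starting with one of these words does
  return to \<open>u\<close>.\<close>

lemma first_returns_less_1:
  assumes u: "u \<in> verts G"
  shows "emeasure words (first_returns UNIV u) < 1"
proof -
  interpret prob_space "walk_law u" using u by (rule prob_space_walk_law)
  let ?E = "{\<omega> \<in> space (walk_law u). \<exists>n. tail G (\<omega> (Suc n)) = u}"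
  have meas: "?E \<in> sets (walk_law u)"
  proof (rule sets.sets_Collect_countable_Ex)
    fix n
    have "(\<lambda>\<omega>. \<omega> (Suc n)) -` {e \<in> arcs G. tail G e = u} \<inter> space (walk_law u) \<in> sets (walk_law u)"
      using measurable_at[OF u] by (rule measurable_sets) auto
    also have "(\<lambda>\<omega>. \<omega> (Suc n)) -` {e \<in> arcs G. tail G e = u} \<inter> space (walk_law u) = {\<omega> \<in> space (walk_law u). tail G (\<omega> (Suc n)) = u}"
      unfolding space_walk_law[OF u] by (rule set_eqI) (simp add: PiE_iff, blast)
    finally show "{\<omega> \<in> space (walk_law u). tail G (\<omega> (Suc n)) = u} \<in> sets (walk_law u)" .
  qed
  have "emeasure words (first_returns UNIV u) = emeasure (walk_law u) {\<omega> \<in> space (walk_law u). \<exists>w\<in>first_returns UNIV u. starts_with \<omega> w}"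
    by (rule emeasure_prefix_free[symmetric, OF u first_returns_is_walk prefix_free_first_returns])
  also have "\<dots> \<le> emeasure (walk_law u) ?E"
  proof (rule emeasure_mono_AE[OF _ meas])
    show "AE \<omega> in walk_law u. \<omega> \<in> {\<omega> \<in> space (walk_law u). \<exists>w\<in>first_returns UNIV u. starts_with \<omega> w} \<longrightarrow> \<omega> \<in> ?E"
      using AE_trajectory[OF u]
    proof (rule eventually_mono, intro impI)
      fix \<omega> assume *: "trajectory u \<omega>" "\<omega> \<in> {\<omega> \<in> space (walk_law u). \<exists>w\<in>first_returns UNIV u. starts_with \<omega> w}"
      then obtain w where w: "w \<in> first_returns UNIV u" "starts_with \<omega> w" by auto
      have "tail G (\<omega> (length w)) = u" "w \<noteq> []"
        using trajectory_starts_with_awalk[OF *(1) _ w(2)] first_returns_awalk[OF w(1)] by auto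
      then have "tail G (\<omega> (Suc (length w - 1))) = u" by simp
      then show "\<omega> \<in> ?E" using *(2) by blast
    qed
  qed
  also have "\<dots> < 1"
  proof -
    have "measure (walk_law u) ?E < 1" using transient u by (simp add: transient_def)
    then show ?thesis by (simp add: emeasure_eq_measure ennreal_less_one_iff)
  qed
  finally show ?thesis .
qed

fun visit_words :: "'v \<Rightarrow> 'v \<Rightarrow> nat \<Rightarrow> 'e list set" where
  "visit_words x u 0 = {w. exit_walk (UNIV - {u}) x w u}"
| "visit_words x u (Suc k) = (\<lambda>(a, b). a @ b) ` (visit_words x u k \<times> first_returns UNIV u)"

lemma visit_words_awalk: "w \<in> visit_words x u k \<Longrightarrow> awalk x w u"
proof (induction k arbitrary: w)
  case 0
  then show ?case using exit_walk_awalk by auto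
next
  case (Suc k)
  then obtain a b where w: "w = a @ b" "a \<in> visit_words x u k" "b \<in> first_returns UNIV u" by auto
  then show ?case unfolding w(1) using Suc.IH first_returns_awalk by (blast intro: awalk_appendI)
qed

text \<open>Each further visit costs a factor of at most the return probability; for a geometric
  bound the inequality for concatenations suffices.\<close>

lemma emeasure_visit_words:
  assumes "x \<in> verts G"
  shows "emeasure words (visit_words x u k) \<le> emeasure words (first_returns UNIV u) ^ k"
proof (induction k)
  case 0
  have "emeasure words (visit_words x u 0) \<le> 1"
  proof (rule emeasure_words_prefix_free_le_1[OF assms])
    show "visit_words x u 0 \<subseteq> {w. is_walk x w}" using exit_walk_is_walk by auto
    show "prefix_free (visit_words x u 0)" unfolding prefix_free_def using exit_walk_prefix by auto
  qed
  then show ?case by simp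
next
  case (Suc k)
  have "emeasure words (visit_words x u (Suc k)) \<le> emeasure words (visit_words x u k) * emeasure words (first_returns UNIV u)"
    by (simp add: emeasure_words_append_le)
  also have "\<dots> \<le> emeasure words (first_returns UNIV u) ^ k * emeasure words (first_returns UNIV u)"
    by (intro mult_right_mono Suc) auto
  finally show ?case by (simp add: mult.commute)
qed

lemma trajectory_visit_words:
  assumes t: "trajectory x \<omega>" and inf: "infinite {n. tail G (\<omega> n) = u}"
  shows "\<exists>n. map \<omega> [0..<n] \<in> visit_words x u k \<and> tail G (\<omega> n) = u"
proof (induction k)
  case 0
  define n where "n = (LEAST n. tail G (\<omega> n) = u)"
  from inf obtain n0 where "tail G (\<omega> n0) = u" using infinite_imp_nonempty by blast
  then have n: "tail G (\<omega> n) = u" unfolding n_def by (rule LeastI)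
  have "tail G (\<omega> i) \<noteq> u" if "i < n" for i using that not_less_Least unfolding n_def by blast
  then have "exit_walk (UNIV - {u}) (tail G (\<omega> 0)) (map \<omega> [0..<n]) (tail G (\<omega> n))"
    using n by (intro exit_walk_trajectory[OF t]) auto
  then show ?case using n t by (auto simp: trajectory_def)
next
  case (Suc k)
  then obtain n where n: "map \<omega> [0..<n] \<in> visit_words x u k" "tail G (\<omega> n) = u" by auto
  define P where "P m \<longleftrightarrow> n < m \<and> tail G (\<omega> m) = u" for m
  have "\<exists>m. P m"
    using inf unfolding P_def infinite_nat_iff_unbounded by blast
  then have m: "P (LEAST m. P m)" by (rule LeastI_ex)
  define m where "m = (LEAST m. P m)"
  have mP: "n < m" "tail G (\<omega> m) = u" using m by (auto simp: m_def P_def)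
  have min: "tail G (\<omega> i) \<noteq> u" if "n < i" "i < m" for i
    using not_less_Least[of i P] that unfolding m_def P_def by blast
  have "exit_walk (UNIV - {u}) (tail G (\<omega> (Suc n))) (map \<omega> [Suc n..<m]) (tail G (\<omega> m))"
    using mP min by (intro exit_walk_trajectory[OF t]) auto
  moreover have "\<omega> n \<in> out_arcs G u" "head G (\<omega> n) = tail G (\<omega> (Suc n))" using t n(2) by (auto simp: trajectory_def)
  ultimately have "map \<omega> [n..<m] \<in> first_returns UNIV u"
    unfolding first_returns_def using mP(1) by (intro UN_I[of "\<omega> n"]) (auto simp: upt_conv_Cons mP(2))
  moreover have "map \<omega> [0..<m] = map \<omega> [0..<n] @ map \<omega> [n..<m]"
    using mP(1) by (metis less_imp_le_nat map_append upt_add_eq_append le_add_diff_inverse zero_le)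
  ultimately have "map \<omega> [0..<m] \<in> visit_words x u (Suc k)" using n(1) by auto
  then show ?case using mP(2) by blast
qed

definition transient_trajectory :: "'v \<Rightarrow> (nat \<Rightarrow> 'e) \<Rightarrow> bool" where
  "transient_trajectory x \<omega> \<longleftrightarrow> trajectory x \<omega> \<and> (\<forall>u\<in>verts G. finite {n. tail G (\<omega> n) = u})"

text \<open>Infinitely many visits imply \<open>k\<close> returns for every \<open>k\<close>, an
  event of probability at most \<open>r ^ k\<close> with \<open>r < 1\<close>.\<close>

lemma AE_finite_visits:
  assumes x: "x \<in> verts G" and u: "u \<in> verts G"
  shows "AE \<omega> in walk_law x. finite {n. tail G (\<omega> n) = u}"
proof -
  interpret prob_space "walk_law x" using x by (rule prob_space_walk_law)
  define r where "r = emeasure words (first_returns UNIV u)"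
  define E where "E k = {\<omega> \<in> space (walk_law x). \<exists>w\<in>visit_words x u k. starts_with \<omega> w}" for k
  have sub: "visit_words x u k \<subseteq> {w. is_walk x w}" for k
    using visit_words_awalk unfolding is_walk_def by blast
  have E: "E k \<in> sets (walk_law x)" for k
    unfolding E_def by (rule sets_starts_with_some[OF x sub])
  have le: "emeasure (walk_law x) (\<Inter>k. E k) \<le> r ^ k" for k
  proof -
    have "emeasure (walk_law x) (\<Inter>k. E k) \<le> emeasure (walk_law x) (E k)"
      using E by (intro emeasure_mono) auto
    also have "\<dots> \<le> r ^ k"
      unfolding E_def r_def using emeasure_starts_with_some_le[OF x sub] emeasure_visit_words[OF x] order_trans by blast
    finally show ?thesis .
  qed
  have "r < 1" unfolding r_def using first_returns_less_1[OF u] .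
  then obtain r' where r': "r = ennreal r'" "0 \<le> r'" "r' < 1"
    by (cases r) (auto simp: ennreal_less_one_iff)
  have "(\<lambda>k. ennreal (r' ^ k)) \<longlonglongrightarrow> ennreal 0"
    using r' by (intro tendsto_ennrealI LIMSEQ_realpow_zero)
  then have "(\<lambda>k. r ^ k) \<longlonglongrightarrow> 0" using r' by (simp add: ennreal_power)
  then have "emeasure (walk_law x) (\<Inter>k. E k) \<le> 0"
    by (rule LIMSEQ_le_const) (use le in auto)
  then have null: "(\<Inter>k. E k) \<in> null_sets (walk_law x)" using E by auto
  show ?thesis
    using AE_not_in[OF null] AE_trajectory[OF x] AE_space
  proof eventually_elim
    case (elim \<omega>)
    show ?case
    proof (rule ccontr)
      assume "infinite {n. tail G (\<omega> n) = u}"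
      then have "\<omega> \<in> E k" for k
        using trajectory_visit_words[OF elim(2), of u k] elim(3) starts_with_map
        unfolding E_def by blast
      with elim(1) show False by blast
    qed
  qed
qed

lemma AE_transient_trajectory:
  assumes x: "x \<in> verts G"
  shows "AE \<omega> in walk_law x. transient_trajectory x \<omega>"
proof -
  have "AE \<omega> in walk_law x. \<forall>u\<in>verts G. finite {n. tail G (\<omega> n) = u}"
    using AE_finite_visits[OF x] countable_verts by (simp add: AE_ball_countable)
  then show ?thesis using AE_trajectory[OF x] by eventually_elim (simp add: transient_trajectory_def)
qed

lemma transient_trajectory_exit:
  assumes "transient_trajectory x \<omega>" "finite D"
  shows "\<exists>n. tail G (\<omega> n) \<notin> D"
proof (rule ccontr)
  assume no: "\<not> ?thesis"
  have "tail G (\<omega> n) \<in> verts G" for n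
    using assms(1) unfolding transient_trajectory_def trajectory_def by (auto simp: image_subset_iff)
  with no have "(UNIV :: nat set) \<subseteq> (\<Union>u\<in>D \<inter> verts G. {n. tail G (\<omega> n) = u})" by auto
  moreover have "finite (\<Union>u\<in>D \<inter> verts G. {n. tail G (\<omega> n) = u})"
    using assms unfolding transient_trajectory_def by auto
  ultimately show False using finite_subset infinite_UNIV_nat by blast
qed

text \<open>A walk that visits each vertex finitely often must leave a finite set.\<close>

lemma emeasure_exit_walks:
  assumes y: "y \<in> verts G" and D: "finite D"
  shows "emeasure words {w. \<exists>z. exit_walk D y w z} = 1"
proof -
  interpret prob_space "walk_law y" using y by (rule prob_space_walk_law)
  let ?A = "{w. \<exists>z. exit_walk D y w z}"
  have A: "?A \<subseteq> {w. is_walk y w}" using exit_walk_is_walk by blast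
  have "emeasure words ?A = emeasure (walk_law y) {\<omega> \<in> space (walk_law y). \<exists>w\<in>?A. starts_with \<omega> w}"
    by (rule emeasure_prefix_free[symmetric, OF y A]) (use exit_walk_prefix in \<open>auto simp: prefix_free_def\<close>)
  also have "\<dots> = 1"
  proof (rule emeasure_eq_1_AE[OF sets_starts_with_some[OF y A]])
    show "AE \<omega> in walk_law y. \<omega> \<in> {\<omega> \<in> space (walk_law y). \<exists>w\<in>?A. starts_with \<omega> w}"
      using AE_transient_trajectory[OF y] AE_space
    proof eventually_elim
      case (elim \<omega>)
      define n where "n = (LEAST n. tail G (\<omega> n) \<notin> D)"
      have n: "tail G (\<omega> n) \<notin> D"
        unfolding n_def using transient_trajectory_exit[OF elim(1) D] by (rule LeastI_ex)
      have "tail G (\<omega> i) \<in> D" if "i < n" for i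
        using not_less_Least[of i "\<lambda>n. tail G (\<omega> n) \<notin> D"] that unfolding n_def by blast
      moreover have t: "trajectory y \<omega>" using elim(1) by (simp add: transient_trajectory_def)
      ultimately have "exit_walk D (tail G (\<omega> 0)) (map \<omega> [0..<n]) (tail G (\<omega> n))"
        using n by (intro exit_walk_trajectory[OF t]) auto
      then show ?case using elim(2) starts_with_map[of \<omega> n] t by (auto simp: trajectory_def)
    qed
  qed
  finally show ?thesis .
qed

section \<open>Partition sums, superharmonicity and escape probabilities\<close>

definition forest_weight :: "'e set \<Rightarrow> ennreal" where
  "forest_weight f = (\<Prod>e\<in>f. ennreal (jump e))"

definition partition_sum :: "'v set \<Rightarrow> ennreal" where
  "partition_sum D = (\<Sum>f\<in>forests D. forest_weight f)"

definition reaches :: "'e set \<Rightarrow> 'v \<Rightarrow> 'v set \<Rightarrow> bool" where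
  "reaches f z A \<longleftrightarrow> (\<exists>b\<in>A. (z, b) \<in> (arc_rel f)\<^sup>*)"

text \<open>For \<open>A\<close> disjoint from \<open>D\<close>, division by
  \<open>partition_sum D\<close> gives the probability that the wired forest has the root of
  \<open>z\<close> in \<open>A\<close>.\<close>

definition reach_sum :: "'v set \<Rightarrow> 'v \<Rightarrow> 'v set \<Rightarrow> ennreal" where
  "reach_sum D z A = (\<Sum>f\<in>{f\<in>forests D. reaches f z A}. forest_weight f)"

lemma sum_ennreal_jump: "u \<in> verts G \<Longrightarrow> (\<Sum>e\<in>out_arcs G u. ennreal (jump e)) = 1"
  using jump_pos sum_jump[of u] by (subst sum_ennreal) (auto intro: less_imp_le)

text \<open>
  Exchanging the arc that leaves \<open>z\<close> preserves the product of the weights of the chosen arc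
  and of the forest, and turns a root of \<open>head G e\<close> into a root of \<open>z\<close>.
\<close>
lemma reach_sum_superharmonic:
  assumes D: "finite D" and z: "z \<in> D" "z \<in> verts G" and A: "A \<inter> D = {}"
  shows "(\<Sum>e\<in>out_arcs G z. ennreal (jump e) * reach_sum D (head G e) A) \<le> reach_sum D z A"
proof -
  define P where "P = (SIGMA e:out_arcs G z. {f\<in>forests D. reaches f (head G e) A})"
  define Q where "Q = out_arcs G z \<times> {f\<in>forests D. reaches f z A}"
  define h where "h x = ennreal (jump (fst x)) * forest_weight (snd x)" for x
  \<comment> \<open>If \<open>head G e\<close> leads to \<open>z\<close>, an exchange would create a
    cycle; but then both vertices already have the same root, and the pair can be kept.\<close>
  define \<phi> where "\<phi> x = (if (head G (fst x), z) \<in> (arc_rel (snd x))\<^sup>* then x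
    else (out_arc (snd x) z, exchange (snd x) (fst x)))" for x
  have fin: "finite P" "finite Q"
    unfolding P_def Q_def using finite_forests[OF D] locally_finite[OF z(2)] by auto
  have \<phi>: "\<phi> (\<phi> (e, f)) = (e, f) \<and> h (\<phi> (e, f)) = h (e, f) \<and> (reaches f (head G e) A \<longrightarrow> \<phi> (e, f) \<in> Q)"
    if e: "e \<in> out_arcs G z" and f: "f \<in> forests D" for e f
  proof (cases "(head G e, z) \<in> (arc_rel f)\<^sup>*")
    case True
    have "reaches f z A" if "reaches f (head G e) A"
    proof -
      from that obtain b where b: "b \<in> A" "(head G e, b) \<in> (arc_rel f)\<^sup>*" by (auto simp: reaches_def)
      have "(z, b) \<in> (arc_rel f)\<^sup>* \<or> (b, z) \<in> (arc_rel f)\<^sup>*"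
        using single_valued_confluent[OF single_valued_arc_rel[OF forestsD(2)[OF f]] True b(2)] .
      moreover have "b \<notin> D" using b(1) A by auto
      ultimately have "(z, b) \<in> (arc_rel f)\<^sup>*" using forest_terminal[OF f] z(1) by metis
      then show ?thesis using b by (auto simp: reaches_def)
    qed
    then show ?thesis using True e f by (auto simp: \<phi>_def Q_def)
  next
    case False
    let ?d = "out_arc f z"
    have te: "tail G e = z" "e \<in> arcs G" using e by auto
    have df: "?d \<in> f" "tail G ?d = z" using out_arc_forest[OF f z(1)] by auto
    note X = exchange_exchange[OF f, of e ?d, unfolded te(1), OF z(1) False refl]
    have X1: "\<phi> (\<phi> (e, f)) = (e, f)" using False X df by (simp add: \<phi>_def)
    have X2: "h (\<phi> (e, f)) = h (e, f)"
      using False prod_exchange[OF f D, of e ?d "\<lambda>e. ennreal (jump e)", unfolded te(1), OF z(1) refl]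
      by (simp add: \<phi>_def h_def forest_weight_def)
    have X3: "exchange f e \<in> forests D" using exchange_forest[OF f te(2)] te(1) z(1) False by auto
    have "reaches (exchange f e) z A" if "reaches f (head G e) A"
    proof -
      from that obtain b where b: "b \<in> A" "(head G e, b) \<in> (arc_rel f)\<^sup>*" by (auto simp: reaches_def)
      have "(head G e, b) \<in> (arc_rel (exchange f e))\<^sup>*"
        using rtrancl_arc_rel_avoid[OF b(2) False] rtrancl_mono[OF arc_rel_mono[of "{a\<in>f. tail G a \<noteq> z}" "exchange f e"]] te
        by (auto simp: exchange_def)
      moreover have "(z, head G e) \<in> arc_rel (exchange f e)" using te by (simp add: exchange_def)
      ultimately have "(z, b) \<in> (arc_rel (exchange f e))\<^sup>*" by (rule converse_rtrancl_into_rtrancl[rotated])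
      then show ?thesis using b by (auto simp: reaches_def)
    qed
    then show ?thesis using False X1 X2 X3 df forestsD(1)[OF f] by (auto simp: \<phi>_def Q_def)
  qed
  have "(\<Sum>e\<in>out_arcs G z. ennreal (jump e) * reach_sum D (head G e) A) = (\<Sum>x\<in>P. h x)"
    unfolding P_def reach_sum_def sum_distrib_left h_def
    using locally_finite[OF z(2)] finite_forests[OF D] by (subst sum.Sigma) (auto simp: split_beta)
  also have "\<dots> = (\<Sum>x\<in>\<phi> ` P. h x)"
  proof (subst sum.reindex)
    show "inj_on \<phi> P" by (rule inj_on_inverseI[of _ \<phi>]) (use \<phi> in \<open>auto simp: P_def\<close>)
    show "sum h P = sum (h \<circ> \<phi>) P" by (rule sum.cong) (use \<phi> in \<open>auto simp: P_def\<close>)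
  qed
  also have "\<dots> \<le> (\<Sum>x\<in>Q. h x)"
    by (rule sum_mono2[OF fin(2)]) (use \<phi> in \<open>auto simp: P_def\<close>)
  also have "\<dots> = (\<Sum>e\<in>out_arcs G z. ennreal (jump e)) * reach_sum D z A"
    unfolding Q_def reach_sum_def sum_product h_def by (simp add: sum.cartesian_product split_beta)
  also have "\<dots> = reach_sum D z A" using sum_ennreal_jump[OF z(2)] by simp
  finally show ?thesis .
qed

text \<open>The probability of exiting into \<open>A\<close> is the least nonnegative function that
  is superharmonic on \<open>D\<close> with boundary value one on \<open>A\<close>. Minimality is
  proved by induction on the number of steps: \<open>X n\<close> contains the exits in fewer than
  \<open>n\<close> steps, so \<open>X 0\<close> is empty and the start is trivial.\<close>

lemma exit_probability_le_reach_sum: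
  assumes D: "finite D" and z: "z \<in> verts G" and A: "A \<inter> D = {}"
  shows "emeasure words {w. \<exists>b\<in>A. exit_walk D z w b} * partition_sum D \<le> reach_sum D z A"
proof -
  define X where "X n z = {w. length w < n \<and> (\<exists>b\<in>A. exit_walk D z w b)}" for n :: nat and z
  have le: "emeasure words (X n z) * partition_sum D \<le> reach_sum D z A" if "z \<in> verts G" for n z
    using that
  proof (induction n arbitrary: z)
    case 0
    then show ?case by (simp add: X_def)
  next
    case (Suc n)
    show ?case
    proof (cases "z \<in> D")
      case False
      show ?thesis
      proof (cases "z \<in> A")
        case True
        have "exit_walk D z w b \<Longrightarrow> w = []" for w b using False by (cases w) auto
        then have "X (Suc n) z \<subseteq> {[]}" by (auto simp: X_def)
        then have "emeasure words (X (Suc n) z) \<le> emeasure words {[]}" by (intro emeasure_mono) auto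
        also have "\<dots> = 1" by (simp add: emeasure_words nn_integral_count_space_finite)
        finally have "emeasure words (X (Suc n) z) * partition_sum D \<le> 1 * partition_sum D"
          by (rule mult_right_mono) simp
        also have "\<dots> = reach_sum D z A"
          using True by (auto simp: partition_sum_def reach_sum_def reaches_def intro!: sum.cong)
        finally show ?thesis .
      next
        case nA: False
        have "X (Suc n) z = {}"
        proof -
          have "\<not> exit_walk D z w b" if "b \<in> A" for w b using False nA that by (cases w) auto
          then show ?thesis by (auto simp: X_def)
        qed
        then show ?thesis by simp
      qed
    next
      case True
      have "X (Suc n) z = (\<Union>e\<in>out_arcs G z. (#) e ` X n (head G e))"
      proof -
        have "w \<in> X (Suc n) z \<longleftrightarrow> w \<in> (\<Union>e\<in>out_arcs G z. (#) e ` X n (head G e))" for w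
          using A True by (cases w) (auto simp: X_def image_iff)
        then show ?thesis by blast
      qed
      then have "emeasure words (X (Suc n) z) * partition_sum D =
          (\<Sum>e\<in>out_arcs G z. ennreal (jump e) * (emeasure words (X n (head G e)) * partition_sum D))"
        using Suc.prems by (simp add: emeasure_words_step sum_distrib_right mult.assoc)
      also have "\<dots> \<le> (\<Sum>e\<in>out_arcs G z. ennreal (jump e) * reach_sum D (head G e) A)"
        by (intro sum_mono mult_left_mono Suc.IH) auto
      also have "\<dots> \<le> reach_sum D z A"
        by (rule reach_sum_superharmonic[OF D True Suc.prems A])
      finally show ?thesis .
    qed
  qed
  have "{w. \<exists>b\<in>A. exit_walk D z w b} = (\<Union>n. X n z)" by (auto simp: X_def)
  also have "emeasure words (\<Union>n. X n z) = (SUP n. emeasure words (X n z))"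
    by (rule SUP_emeasure_incseq[symmetric]) (auto simp: X_def incseq_def)
  finally show ?thesis
    using le[OF z] by (simp add: SUP_mult_right_ennreal SUP_le_iff)
qed

definition escape_walks :: "'v set \<Rightarrow> 'v \<Rightarrow> 'e list set" where
  "escape_walks D y = (\<Union>e\<in>out_arcs G y. (#) e ` {w. \<exists>b\<in>-D. exit_walk (D - {y}) (head G e) w b})"

text \<open>By the exit bound, the left side is at most the weight of all pairs of an arc
  \<open>e\<close> out of \<open>y\<close> and a forest on \<open>D - {y}\<close> in which
  \<open>head G e\<close> has its root outside \<open>D\<close>. Since the root of
  \<open>head G e\<close> is then not \<open>y\<close>, inserting \<open>e\<close> gives a forest on
  \<open>D\<close>; and \<open>e\<close> can be recovered as the arc leaving \<open>y\<close>, so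
  distinct pairs give distinct forests.\<close>

lemma escape_le:
  assumes D: "finite D" and y: "y \<in> D" "y \<in> verts G"
  shows "emeasure words (escape_walks D y) * partition_sum (D - {y}) \<le> partition_sum D"
proof -
  define P where "P = (SIGMA e:out_arcs G y. {f\<in>forests (D - {y}). reaches f (head G e) (-D)})"
  have ins: "insert e f \<in> forests D" "e \<notin> f" if "(e, f) \<in> P" for e f
  proof -
    from that have e: "e \<in> arcs G" "tail G e = y" and f: "f \<in> forests (D - {y})" and r: "reaches f (head G e) (-D)"
      by (auto simp: P_def)
    have "(head G e, y) \<notin> (arc_rel f)\<^sup>*"
    proof
      assume 1: "(head G e, y) \<in> (arc_rel f)\<^sup>*"
      from r obtain b where b: "b \<notin> D" "(head G e, b) \<in> (arc_rel f)\<^sup>*" by (auto simp: reaches_def)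
      have "(y, b) \<in> (arc_rel f)\<^sup>* \<or> (b, y) \<in> (arc_rel f)\<^sup>*"
        using single_valued_confluent[OF single_valued_arc_rel[OF forestsD(2)[OF f]] 1 b(2)] .
      then have "y = b" using forest_terminal[OF f, of b y] forest_terminal[OF f, of y b] b(1) by auto
      then show False using b y by simp
    qed
    then show "insert e f \<in> forests D" "e \<notin> f" using insert_forest[OF f y(1) e] by auto
  qed
  have inj: "inj_on (\<lambda>(e, f). insert e f) P"
  proof (rule inj_onI, clarify)
    fix e f e' f' assume P: "(e, f) \<in> P" "(e', f') \<in> P" and eq: "insert e f = insert e' f'"
    have t: "tail G e = y" "tail G e' = y" using P by (auto simp: P_def)
    have "inj_on (tail G) (insert e f)" using forestsD(2)[OF ins(1)[OF P(1)]] .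
    moreover have "e' \<in> insert e f" using eq by auto
    ultimately have "e = e'" using t by (auto simp: inj_on_def)
    then show "e = e' \<and> f = f'" using eq ins(2)[OF P(1)] ins(2)[OF P(2)] by (auto dest: insert_ident)
  qed
  have "emeasure words (escape_walks D y) * partition_sum (D - {y}) =
    (\<Sum>e\<in>out_arcs G y. ennreal (jump e) * (emeasure words {w. \<exists>b\<in>-D. exit_walk (D - {y}) (head G e) w b} * partition_sum (D - {y})))"
    unfolding escape_walks_def using y by (simp add: emeasure_words_step sum_distrib_right mult.assoc)
  also have "\<dots> \<le> (\<Sum>e\<in>out_arcs G y. ennreal (jump e) * reach_sum (D - {y}) (head G e) (-D))"
    by (intro sum_mono mult_left_mono exit_probability_le_reach_sum) (use D in auto)
  also have "\<dots> = (\<Sum>(e, f)\<in>P. ennreal (jump e) * forest_weight f)"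
    unfolding P_def reach_sum_def sum_distrib_left
    using locally_finite[OF y(2)] finite_forests[of "D - {y}"] D by (subst sum.Sigma) auto
  also have "\<dots> = (\<Sum>x\<in>P. forest_weight ((\<lambda>(e, f). insert e f) x))"
  proof (rule sum.cong, simp, clarify)
    fix e f assume P: "(e, f) \<in> P"
    then have "finite f" using finite_forest[of f "D - {y}"] D by (auto simp: P_def)
    then show "ennreal (jump e) * forest_weight f = forest_weight (insert e f)"
      using ins(2)[OF P] by (simp add: forest_weight_def)
  qed
  also have "\<dots> = sum forest_weight ((\<lambda>(e, f). insert e f) ` P)"
    by (subst sum.reindex[OF inj]) simp
  also have "\<dots> \<le> partition_sum D"
    unfolding partition_sum_def by (rule sum_mono2[OF finite_forests[OF D]]) (use ins in auto)
  finally show ?thesis .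
qed

lemma first_returns_plus_escape:
  assumes D: "finite D" and y: "y \<in> D" "y \<in> verts G"
  shows "emeasure words (first_returns D y) + emeasure words (escape_walks D y) = 1"
proof -
  let ?A = "\<lambda>e. {w. \<exists>b. exit_walk (D - {y}) (head G e) w b}"
  have "first_returns D y \<union> escape_walks D y = (\<Union>e\<in>out_arcs G y. (#) e ` ?A e)"
    unfolding first_returns_def escape_walks_def using exit_walk_end by fastforce
  moreover have "emeasure words (\<Union>e\<in>out_arcs G y. (#) e ` ?A e) = 1"
    using D y emeasure_exit_walks sum_ennreal_jump by (simp add: emeasure_words_step)
  moreover have "first_returns D y \<inter> escape_walks D y = {}"
  proof -
    have False if "exit_walk (D - {y}) x w y" "exit_walk (D - {y}) x w b" "b \<notin> D" for x w b
      using exit_walk_prefix[OF that(1), of "[]" b] that y by auto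
    then show ?thesis unfolding first_returns_def escape_walks_def by auto
  qed
  ultimately show ?thesis by (simp add: plus_emeasure)
qed

text \<open>As the walk exits \<open>D\<close>, some arc leads out of \<open>D\<close>. Its tail
  serves as a root for the remaining vertices and is then attached by this arc.\<close>

lemma forests_nonempty:
  assumes "finite D" "D \<subseteq> verts G"
  shows "forests D \<noteq> {}"
  using assms
proof (induction "card D" arbitrary: D)
  case 0
  then have "D = {}" by simp
  then have "{} \<in> forests D" by (simp add: forests_def arc_rel_def acyclic_def)
  then show ?case by auto
next
  case (Suc n)
  then obtain y where y: "y \<in> D" by (metis card_gt_0_iff ex_in_conv zero_less_Suc)
  have "\<exists>w z. exit_walk D y w z"
  proof (rule ccontr)
    assume "\<not> ?thesis"
    then have "{w. \<exists>z. exit_walk D y w z} = {}" by auto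
    moreover have "emeasure words {w. \<exists>z. exit_walk D y w z} = 1"
      using Suc y by (intro emeasure_exit_walks) auto
    ultimately show False by simp
  qed
  then obtain w z where w: "exit_walk D y w z" by auto
  have "\<exists>a\<in>arcs G. tail G a \<in> D \<and> head G a \<notin> D"
    using w y by (induction w arbitrary: y) auto
  then obtain a where a: "a \<in> arcs G" "tail G a \<in> D" "head G a \<notin> D" by auto
  have "card (D - {tail G a}) = n" using Suc a by simp
  then obtain f where f: "f \<in> forests (D - {tail G a})"
    using Suc.hyps(1)[of "D - {tail G a}"] Suc.prems by fastforce
  have "(head G a, tail G a) \<notin> (arc_rel f)\<^sup>*"
    using forest_terminal[OF f, of "head G a" "tail G a"] a by auto
  from insert_forest(1)[OF f a(2) a(1) refl this] show ?case by auto
qed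

lemma forest_weight_pos_finite:
  assumes "f \<subseteq> arcs G"
  shows "forest_weight f \<noteq> 0" "forest_weight f \<noteq> \<infinity>"
proof -
  have "forest_weight f = ennreal (\<Prod>e\<in>f. jump e)"
    unfolding forest_weight_def using assms jump_pos by (intro prod_ennreal) (auto intro: less_imp_le)
  moreover have "(\<Prod>e\<in>f. jump e) > 0" using assms jump_pos by (intro prod_pos) auto
  ultimately show "forest_weight f \<noteq> 0" "forest_weight f \<noteq> \<infinity>" by auto
qed

lemma partition_sum_pos_finite:
  assumes "finite D" "D \<subseteq> verts G"
  shows "partition_sum D \<noteq> 0" "partition_sum D \<noteq> \<infinity>"
proof -
  obtain f where f: "f \<in> forests D" using forests_nonempty[OF assms] by auto
  then have "forest_weight f \<noteq> 0" using forest_weight_pos_finite forestsD(1) by blast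
  then show "partition_sum D \<noteq> 0"
    unfolding partition_sum_def using f finite_forests[OF assms(1)] by auto
  show "partition_sum D \<noteq> \<infinity>"
    unfolding partition_sum_def using forest_weight_pos_finite(2)[OF forestsD(1)]
    by (auto simp: finite_forests[OF assms(1)])
qed

subsection \<open>Loop erasure\<close>

lemma loop_erase_snoc:
  "loop_erase (w @ [e]) = takeWhile (\<lambda>a. tail G a \<noteq> head G e) (loop_erase w @ [e])"
  by (simp add: loop_erase_def)

lemma loop_erase_Nil [simp]: "loop_erase [] = []"
  by (simp add: loop_erase_def)

lemma cas_takeWhile:
  "cas u p z \<Longrightarrow> cas u (takeWhile (\<lambda>a. tail G a \<noteq> x) p) (if x \<in> tail G ` set p then x else z)"
  by (induction p arbitrary: u) auto

lemma set_loop_erase: "set (loop_erase w) \<subseteq> set w"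
proof (induction w rule: rev_induct)
  case (snoc e w)
  have "set (loop_erase (w @ [e])) \<subseteq> set (loop_erase w @ [e])"
    unfolding loop_erase_snoc using set_takeWhileD by fast
  then show ?case using snoc by auto
qed simp

lemma loop_erase_cas:
  "cas u w z \<Longrightarrow> cas u (loop_erase w) z \<and> distinct (map (tail G) (loop_erase w)) \<and> z \<notin> tail G ` set (loop_erase w)"
proof (induction w arbitrary: z rule: rev_induct)
  case (snoc e w)
  then have w: "cas u w (tail G e)" and z: "z = head G e" by auto
  note IH = snoc.IH[OF w]
  let ?q = "loop_erase w @ [e]" and ?P = "\<lambda>a. tail G a \<noteq> head G e"
  have q: "cas u ?q (head G e)" using IH by (auto simp del: cas_append_iff intro!: cas_appendI)
  have "cas u (takeWhile ?P ?q) (head G e)" using cas_takeWhile[OF q, of "head G e"] by (simp split: if_splits)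
  moreover have "distinct (map (tail G) ?q)" using IH by auto
  then have "distinct (map (tail G) (takeWhile ?P ?q))"
    by (metis distinct_map distinct_takeWhile inj_on_subset set_takeWhileD subsetI)
  moreover have "head G e \<notin> tail G ` set (takeWhile ?P ?q)" by (auto dest: set_takeWhileD)
  ultimately show ?case unfolding loop_erase_snoc z by blast
qed simp

text \<open>The erasure of a closed walk is empty: otherwise its start would be a tail of the erased
  path, which never contains the tail equal to its endpoint.\<close>

lemma loop_erase_append_loop:
  assumes "cas y l y"
  shows "loop_erase (l @ w) = loop_erase w"
proof -
  have "loop_erase l = []"
    using loop_erase_cas[OF assms] by (cases "loop_erase l") auto
  then show ?thesis by (simp add: loop_erase_def)
qed

text \<open>An arc whose tail is never revisited stays for good, and the loops of the remainder are
  erased as if it were absent.\<close>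

lemma loop_erase_Cons:
  assumes "head G e \<noteq> tail G e" "tail G e \<notin> head G ` set w"
  shows "loop_erase (e # w) = e # loop_erase w"
proof -
  let ?step = "\<lambda>p e. takeWhile (\<lambda>a. tail G a \<noteq> head G e) (p @ [e])"
  have "foldl ?step (e # p) w = e # foldl ?step p w" for p
    using assms(2)
  proof (induction w arbitrary: p)
    case (Cons a w)
    then have "?step (e # p) a = e # ?step p a" by auto
    then have "foldl ?step (e # p) (a # w) = foldl ?step (e # ?step p a) w" by simp
    also have "\<dots> = e # foldl ?step (?step p a) w" using Cons by (intro Cons.IH) auto
    finally show ?case by simp
  qed simp
  from this[of "[]"] show ?thesis using assms(1) by (simp add: loop_erase_def)
qed

lemma exit_walk_heads:
  "exit_walk D y w z \<Longrightarrow> head G ` set w \<subseteq> insert z D \<and> (w \<noteq> [] \<longrightarrow> y \<in> D)"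
proof (induction w arbitrary: y)
  case (Cons e w)
  then show ?case by (cases w) auto
qed simp

lemma exit_walk_restrict:
  "exit_walk D y w z \<Longrightarrow> x \<notin> tail G ` set w \<Longrightarrow> exit_walk (D - {x}) y w z"
  by (induction w arbitrary: y) auto

subsection \<open>The law of the loop-erased walk\<close>

text \<open>Induction on the loop-free path. Words with erasure \<open>e # \<gamma>\<close> include
  those that make a first return to \<open>y\<close> and continue in \<open>S\<close>
  (\<open>?A\<close>), and those that cross \<open>e\<close> at once and never come back
  (\<open>?B\<close>). So the weight of \<open>S\<close> times one minus the return probability is
  at least \<open>jump e\<close> times the weight of \<open>S'\<close>. One minus the return
  probability is the escape probability, at most
  \<open>partition_sum D / partition_sum (D - {y})\<close>, and the quotients telescope along the
  path. Both estimates go in the same direction, as required.\<close>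

lemma loop_erased_walk_law:
  assumes "finite D" "D \<subseteq> verts G" "exit_walk D y \<gamma> z" "distinct (map (tail G) \<gamma>)"
  shows "walk_prob \<gamma> * partition_sum (D - tail G ` set \<gamma>)
    \<le> emeasure words {w. (\<exists>b. exit_walk D y w b) \<and> loop_erase w = \<gamma>} * partition_sum D"
  using assms
proof (induction \<gamma> arbitrary: D y)
  case Nil
  have "1 = emeasure words {[]}" by (simp add: emeasure_words nn_integral_count_space_finite)
  also have "\<dots> \<le> emeasure words {w. (\<exists>b. exit_walk D y w b) \<and> loop_erase w = []}"
    using Nil by (intro emeasure_mono) (auto intro: exI[of _ z])
  finally have "1 * partition_sum D \<le> emeasure words {w. (\<exists>b. exit_walk D y w b) \<and> loop_erase w = []} * partition_sum D"
    by (rule mult_right_mono) simp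
  then show ?case by simp
next
  case (Cons e \<gamma>)
  have y: "y \<in> D" "tail G e = y" "e \<in> arcs G" and ex: "exit_walk D (head G e) \<gamma> z"
    and y\<gamma>: "y \<notin> tail G ` set \<gamma>"
    using Cons.prems by auto
  have yv: "y \<in> verts G" using y Cons.prems(2) by auto
  have zD: "z \<notin> D" using exit_walk_end[OF ex] by simp
  have ex': "exit_walk (D - {y}) (head G e) \<gamma> z" using exit_walk_restrict[OF ex y\<gamma>] .
  define S where "S = {w. (\<exists>b. exit_walk D y w b) \<and> loop_erase w = e # \<gamma>}"
  define S' where "S' = {w. (\<exists>b. exit_walk (D - {y}) (head G e) w b) \<and> loop_erase w = \<gamma>}"
  let ?R = "first_returns D y" and ?E = "escape_walks D y"
  let ?A = "(\<lambda>(a, b). a @ b) ` (?R \<times> S)" and ?B = "(#) e ` S'"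
  have R: "l \<noteq> [] \<and> cas y l y \<and> (\<exists>a l'. l = a # l' \<and> a \<in> out_arcs G y \<and> exit_walk (D - {y}) (head G a) l' y)" if "l \<in> ?R" for l
    using that first_returns_awalk[OF that] unfolding first_returns_def awalk_def by auto
  \<comment> \<open>A walk ends where its loop-erasure ends. So words of \<open>S'\<close> exit at
    \<open>z\<close>, outside \<open>D\<close>, and not at \<open>y\<close>; hence they never touch
    \<open>y\<close>.\<close>
  have S'z: "exit_walk (D - {y}) (head G e) w z" "y \<notin> tail G ` set w" "y \<notin> head G ` set w" "head G e \<noteq> y" if "w \<in> S'" for w
  proof -
    from that obtain b where b: "exit_walk (D - {y}) (head G e) w b" "loop_erase w = \<gamma>" by (auto simp: S'_def)
    have "cas (head G e) \<gamma> b" using exit_walk_awalk[OF b(1)] loop_erase_cas[of "head G e" w b] b(2) by (auto simp: awalk_def)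
    moreover have "cas (head G e) \<gamma> z" using exit_walk_awalk[OF ex] by (auto simp: awalk_def)
    ultimately have "b = z" using cas_ends by blast
    then show 1: "exit_walk (D - {y}) (head G e) w z" using b by simp
    show "y \<notin> tail G ` set w" using exit_walk_tails[OF 1] by auto
    show "y \<notin> head G ` set w" using exit_walk_heads[OF 1] zD y by auto
    show "head G e \<noteq> y" using 1 zD y by (cases w) auto
  qed
  have "?A \<subseteq> S"
  proof clarify
    fix l w assume l: "l \<in> ?R" and w: "w \<in> S"
    from w obtain b where b: "exit_walk D y w b" by (auto simp: S_def)
    have "exit_walk D y (l @ w) b" using R[OF l] y exit_walk_append[OF _ b] by auto
    moreover have "loop_erase (l @ w) = e # \<gamma>"
      using loop_erase_append_loop[of y l w] R[OF l] w by (auto simp: S_def)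
    ultimately show "l @ w \<in> S" by (auto simp: S_def)
  qed
  moreover have "?B \<subseteq> S"
  proof clarify
    fix w assume w: "w \<in> S'"
    have "exit_walk D (head G e) w z" using exit_walk_mono[OF S'z(1)[OF w] zD] by auto
    moreover have "loop_erase (e # w) = e # \<gamma>"
      using loop_erase_Cons[of e w] S'z[OF w] y w by (auto simp: S'_def)
    ultimately show "e # w \<in> S" using y by (auto simp: S_def)
  qed
  \<comment> \<open>A word of \<open>?A\<close> leaves \<open>y\<close> a second time after its
    first arc, a word of \<open>?B\<close> does not.\<close>
  moreover have disj: "?A \<inter> ?B = {}"
  proof -
    have False if l: "l \<in> ?R" and w: "w \<in> S" and w': "w' \<in> S'" and eq: "l @ w = e # w'" for l w w'
    proof -
      obtain a w2 where aw: "w = a # w2" using w y(1) unfolding S_def by (cases w) auto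
      then have "tail G a = y" using w by (auto simp: S_def)
      obtain a' l' where "l = a' # l'" using R[OF l] by auto
      then have "a \<in> set w'" using eq aw by auto
      then show False using S'z(2)[OF w'] \<open>tail G a = y\<close> by auto
    qed
    then show ?thesis by auto
  qed
  moreover have "inj_on (\<lambda>(a, b). a @ b) (?R \<times> S)"
  proof (rule inj_onI, clarify)
    fix l w l2 w2 assume "l \<in> ?R" "l2 \<in> ?R" "l @ w = l2 @ w2"
    then show "l = l2 \<and> w = w2"
      using prefix_free_first_returns[of D y] unfolding prefix_free_def append_eq_append_conv2 by auto
  qed
  ultimately have sub: "?A \<union> ?B \<subseteq> S" and disj: "?A \<inter> ?B = {}" and inj: "inj_on (\<lambda>(a, b). a @ b) (?R \<times> S)"
    by blast+
  have "emeasure words ?R * emeasure words S + ennreal (jump e) * emeasure words S' = emeasure words (?A \<union> ?B)"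
    unfolding emeasure_words_append[OF inj, symmetric] emeasure_words_Cons[symmetric]
    by (rule plus_emeasure) (use disj in auto)
  also have "\<dots> \<le> emeasure words S" using sub by (intro emeasure_mono) auto
  \<comment> \<open>Writing one as return plus escape probability avoids a subtraction in
    \<open>ennreal\<close>. The common summand is cancelled afterwards, which is why it has to be
    finite.\<close>
  also have "emeasure words S = emeasure words ?R * emeasure words S + emeasure words S * emeasure words ?E"
    using first_returns_plus_escape[OF Cons.prems(1) y(1) yv] by (metis distrib_left mult.commute mult.right_neutral)
  finally have "emeasure words ?R * emeasure words S + ennreal (jump e) * emeasure words S' \<le>
    emeasure words ?R * emeasure words S + emeasure words S * emeasure words ?E" .
  moreover have "emeasure words ?R * emeasure words S \<noteq> \<infinity>"
  proof -
    have "emeasure words S \<le> 1"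
    proof (rule emeasure_words_prefix_free_le_1[OF yv])
      show "S \<subseteq> {w. is_walk y w}" unfolding S_def using exit_walk_is_walk by auto
      show "prefix_free S" unfolding S_def prefix_free_def using exit_walk_prefix by blast
    qed
    moreover have "emeasure words ?R \<le> 1"
      by (rule emeasure_words_prefix_free_le_1[OF yv first_returns_is_walk prefix_free_first_returns])
    ultimately have "emeasure words ?R * emeasure words S \<le> 1 * 1" by (intro mult_mono) auto
    then show ?thesis by (auto simp: top_unique)
  qed
  ultimately have key: "ennreal (jump e) * emeasure words S' \<le> emeasure words S * emeasure words ?E"
    by (simp add: ennreal_add_left_cancel_le)
  have "walk_prob (e # \<gamma>) * partition_sum (D - tail G ` set (e # \<gamma>))
      = ennreal (jump e) * (walk_prob \<gamma> * partition_sum (D - {y} - tail G ` set \<gamma>))"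
    using y by (simp add: mult.assoc Diff_insert2[symmetric] set_diff_eq)
  also have "\<dots> \<le> ennreal (jump e) * (emeasure words S' * partition_sum (D - {y}))"
    unfolding S'_def using Cons.prems by (intro mult_left_mono Cons.IH ex') auto
  also have "\<dots> = (ennreal (jump e) * emeasure words S') * partition_sum (D - {y})"
    by (simp add: mult.assoc)
  also have "\<dots> \<le> (emeasure words S * emeasure words ?E) * partition_sum (D - {y})"
    by (intro mult_right_mono key) simp
  also have "\<dots> = emeasure words S * (emeasure words ?E * partition_sum (D - {y}))"
    by (simp add: mult.assoc)
  also have "\<dots> \<le> emeasure words S * partition_sum D"
    by (intro mult_left_mono escape_le[OF Cons.prems(1) y(1) yv]) simp
  finally show ?case unfolding S_def .
qed

subsection \<open>Wilson's algorithm with a wired boundary\<close>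

text \<open>The walks also stop on \<open>S\<close>, which contributes no arcs itself.
  \<open>S = {}\<close> is the algorithm rooted at infinity, and \<open>S = -D\<close> the one for
  the forest on \<open>D\<close> with wired complement. Both read the same walks \<open>X\<close>,
  which is the coupling used for the limit.\<close>

primrec wilson_from :: "'v set \<Rightarrow> (nat \<Rightarrow> nat \<Rightarrow> 'e) \<Rightarrow> nat \<Rightarrow> 'e set" where
  "wilson_from S X 0 = {}"
| "wilson_from S X (Suc i) = wilson_from S X i \<union>
     loop_erasure_stopped (S \<union> tail G ` wilson_from S X i \<union> head G ` wilson_from S X i) (X i)"

lemma wilson_eq: "wilson X i = wilson_from {} X i"
  by (induction i) auto

text \<open>The recursion adds the last walk. Splitting off the first one instead, whose branch
  becomes part of the wired set, is the form suited to induction over shrinking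
  \<open>D\<close>.\<close>

lemma wilson_from_Suc_front:
  defines "\<gamma> S X \<equiv> loop_erasure_stopped S (X 0)"
  shows "wilson_from S X (Suc n) = \<gamma> S X \<union> wilson_from (S \<union> tail G ` \<gamma> S X \<union> head G ` \<gamma> S X) (\<lambda>i. X (Suc i)) n"
proof (induction n)
  case (Suc n)
  let ?W = "wilson_from (S \<union> tail G ` \<gamma> S X \<union> head G ` \<gamma> S X) (\<lambda>i. X (Suc i)) n"
  have "S \<union> tail G ` (\<gamma> S X \<union> ?W) \<union> head G ` (\<gamma> S X \<union> ?W) = S \<union> tail G ` \<gamma> S X \<union> head G ` \<gamma> S X \<union> tail G ` ?W \<union> head G ` ?W"
    by auto
  then show ?case unfolding wilson_from.simps(2)[of _ _ "Suc n"] Suc by (simp add: Un_assoc)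
qed (simp add: \<gamma>_def)

lemma loop_erasure_stopped_exit_walk:
  assumes "trajectory x \<omega>" "starts_with \<omega> w" "exit_walk D x w z"
  shows "loop_erasure_stopped (-D) \<omega> = set (loop_erase w)"
proof -
  have end_: "tail G (\<omega> (length w)) \<in> -D"
    using trajectory_starts_with_awalk[OF assms(1) exit_walk_awalk[OF assms(3)] assms(2)] exit_walk_end[OF assms(3)]
    by simp
  moreover have "tail G (\<omega> i) \<notin> -D" if "i < length w" for i
    using exit_walk_tails[OF assms(3)] assms(2) that by (auto simp: starts_with_def)
  ultimately have "(LEAST n. tail G (\<omega> n) \<in> -D) = length w"
    by (intro Least_equality) (auto simp: not_less[symmetric])
  moreover have "map \<omega> [0..<length w] = w"
    using assms(2) by (intro nth_equalityI) (auto simp: starts_with_def)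
  ultimately show ?thesis unfolding loop_erasure_stopped_def using end_ by auto
qed

lemma awalk_exit_walk:
  "awalk y w z \<Longrightarrow> tail G ` set w \<subseteq> D \<Longrightarrow> z \<notin> D \<Longrightarrow> exit_walk D y w z"
  by (induction w arbitrary: y) (auto simp: awalk_simps)

lemma forest_exit_path:
  assumes f: "f \<in> forests D" and D: "finite D" "D \<subseteq> verts G" and x: "x \<in> verts G"
  shows "\<exists>\<gamma> z. exit_walk D x \<gamma> z \<and> set \<gamma> \<subseteq> f \<and> distinct (map (tail G) \<gamma>)"
proof -
  have "\<exists>b\<in>verts G - D. (x, b) \<in> (arc_rel f)\<^sup>*"
  proof (cases "x \<in> D")
    case True
    let ?C = "{y\<in>D. (x, y) \<in> (arc_rel f)\<^sup>*}"
    obtain e where e: "e \<in> f" "tail G e \<in> ?C" "head G e \<notin> ?C"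
      using acyclic_arc_rel_exit[OF forestsD(4)[OF f], of ?C] True D(1) forestsD(3)[OF f] by auto
    have "(tail G e, head G e) \<in> arc_rel f" using e(1) by (simp add: arc_rel_def)
    then have "(x, head G e) \<in> (arc_rel f)\<^sup>*" using e(2) by auto
    moreover have "head G e \<in> verts G" using e(1) forestsD(1)[OF f] by auto
    ultimately show ?thesis using e(3) by auto
  qed (use x in auto)
  then obtain b \<gamma> where b: "b \<in> verts G" "b \<notin> D" and \<gamma>: "directed_path f x \<gamma> b"
    using rtrancl_directed_path[OF _ forestsD(1)[OF f]] by blast
  then have "awalk x \<gamma> b" "distinct (awalk_verts x \<gamma>)" "set \<gamma> \<subseteq> f" "cas x \<gamma> b"
    by (auto simp: directed_path_def apath_def awalk_def)
  moreover from this have "exit_walk D x \<gamma> b"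
    using b(2) forestsD(3)[OF f] by (intro awalk_exit_walk) auto
  ultimately show ?thesis by (auto simp: awalk_verts_conv_tails)
qed

lemma forest_remove_path:
  assumes f: "f \<in> forests D" and D: "finite D" and \<gamma>: "set \<gamma> \<subseteq> f" "distinct (map (tail G) \<gamma>)"
  shows "f - set \<gamma> \<in> forests (D - tail G ` set \<gamma>)"
    "forest_weight f = walk_prob \<gamma> * forest_weight (f - set \<gamma>)"
proof -
  have "tail G ` (f - set \<gamma>) = D - tail G ` set \<gamma>"
    using inj_on_image_set_diff[OF forestsD(2)[OF f], of f "set \<gamma>"] \<gamma>(1) forestsD(3)[OF f] by auto
  moreover have "acyclic (arc_rel (f - set \<gamma>))"
    using forestsD(4)[OF f] by (rule acyclic_subset) (auto intro!: arc_rel_mono)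
  ultimately show "f - set \<gamma> \<in> forests (D - tail G ` set \<gamma>)"
    using forestsD(1,2)[OF f] by (auto simp: forests_def intro: inj_on_diff)
  have "walk_prob \<gamma> = (\<Prod>e\<in>set \<gamma>. ennreal (jump e))"
    unfolding walk_prob_def using \<gamma>(2) by (simp add: distinct_map prod.distinct_set_conv_list)
  then show "forest_weight f = walk_prob \<gamma> * forest_weight (f - set \<gamma>)"
    unfolding forest_weight_def using prod.subset_diff[OF \<gamma>(1) finite_forest[OF f D]] by (simp add: mult.commute)
qed

text \<open>If the first walk has as its loop-erasure the path of \<open>f\<close> from
  \<open>en 0\<close>, the rest of the algorithm has to produce the rest of \<open>f\<close> with
  this path wired. Partition sums of successive steps telescope. The event is given as a product of
  events of the single walks, so that independence applies.\<close>

lemma wilson_from_lower_bound: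
  assumes "finite D" "D \<subseteq> verts G" "range en \<subseteq> verts G" "D \<subseteq> en ` {..<N}" "f \<in> forests D"
  shows "\<exists>A. (\<forall>i. A i \<in> sets (walk_law (en i))) \<and> (\<forall>X. (\<forall>i<N. X i \<in> A i) \<longrightarrow> wilson_from (-D) X N = f) \<and>
    forest_weight f \<le> (\<Prod>i<N. emeasure (walk_law (en i)) (A i)) * partition_sum D"
  using assms
proof (induction N arbitrary: D en f)
  case 0
  then have D: "D = {}" by simp
  have "forests {} = {{}}" using forests_nonempty[of "{}"] by (auto simp: forests_def)
  then show ?case using 0(5) D
    by (intro exI[of _ "\<lambda>_. {}"]) (auto simp: forest_weight_def partition_sum_def)
next
  case (Suc N)
  define x where "x = en 0"
  have x: "x \<in> verts G" using Suc.prems(3) by (auto simp: x_def)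
  obtain \<gamma> z where \<gamma>: "exit_walk D x \<gamma> z" "set \<gamma> \<subseteq> f" "distinct (map (tail G) \<gamma>)"
    using forest_exit_path[OF Suc.prems(5,1,2) x] by blast
  let ?D = "D - tail G ` set \<gamma>"
  note F = forest_remove_path[OF Suc.prems(5,1) \<gamma>(2,3)]
  have xD: "x \<notin> ?D" using \<gamma>(1) by (cases \<gamma>) auto
  have "?D \<subseteq> (\<lambda>i. en (Suc i)) ` {..<N}"
  proof
    fix y assume y: "y \<in> ?D"
    then obtain i where i: "y = en i" "i < Suc N" using Suc.prems(4) by auto
    with xD y have "i \<noteq> 0" by (auto simp: x_def)
    then show "y \<in> (\<lambda>i. en (Suc i)) ` {..<N}" using i by (cases i) auto
  qed
  moreover have "finite ?D" "?D \<subseteq> verts G" "range (\<lambda>i. en (Suc i)) \<subseteq> verts G"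
    using Suc.prems(1-3) by auto
  ultimately obtain A where A: "\<forall>i. A i \<in> sets (walk_law (en (Suc i)))"
    "\<forall>X. (\<forall>i<N. X i \<in> A i) \<longrightarrow> wilson_from (- ?D) X N = f - set \<gamma>"
    "forest_weight (f - set \<gamma>) \<le> (\<Prod>i<N. emeasure (walk_law (en (Suc i))) (A i)) * partition_sum ?D"
    using Suc.IH[of ?D "\<lambda>i. en (Suc i)", OF _ _ _ _ F(1)] by blast
  let ?W = "{w. (\<exists>b. exit_walk D x w b) \<and> loop_erase w = \<gamma>}"
  let ?B = "{\<omega> \<in> space (walk_law x). \<exists>w\<in>?W. starts_with \<omega> w}"
  have W: "?W \<subseteq> {w. is_walk x w}" using exit_walk_is_walk by blast
  \<comment> \<open>Taking away the null set of sequences that are not trajectories makes the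
    conclusion hold for every \<open>X\<close> in the product event.\<close>
  obtain N0 where N0: "{\<omega> \<in> space (walk_law x). \<not> trajectory x \<omega>} \<subseteq> N0" "N0 \<in> null_sets (walk_law x)"
    using AE_trajectory[OF x] unfolding eventually_ae_filter by blast
  define A' where "A' i = (case i of 0 \<Rightarrow> ?B - N0 | Suc i \<Rightarrow> A i)" for i
  have "\<forall>i. A' i \<in> sets (walk_law (en i))"
    using A(1) sets_starts_with_some[OF x W] N0(2) by (auto simp: A'_def x_def split: nat.splits)
  moreover have "wilson_from (- D) X (Suc N) = f" if X: "\<forall>i<Suc N. X i \<in> A' i" for X
  proof -
    have "X 0 \<in> ?B - N0" using X by (auto simp: A'_def)
    then obtain w b where w: "exit_walk D x w b" "loop_erase w = \<gamma>" "starts_with (X 0) w" "trajectory x (X 0)"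
      using N0(1) by blast
    have g: "loop_erasure_stopped (-D) (X 0) = set \<gamma>"
      using loop_erasure_stopped_exit_walk[OF w(4,3,1)] w(2) by simp
    have "\<forall>i<N. X (Suc i) \<in> A i" using X by (auto simp: A'_def)
    from A(2)[rule_format, OF this[rule_format]] have "wilson_from (- ?D) (\<lambda>i. X (Suc i)) N = f - set \<gamma>" .
    \<comment> \<open>Each head on the branch is the next tail, except for the final
      \<open>z\<close>, which is already outside \<open>D\<close>.\<close>
    moreover have "- D \<union> tail G ` set \<gamma> \<union> head G ` set \<gamma> = - ?D"
    proof -
      have c: "cas x \<gamma> z" using exit_walk_awalk[OF \<gamma>(1)] by (simp add: awalk_def)
      have "set (x # map (head G) \<gamma>) = set (map (tail G) \<gamma> @ [z])"
        using awalk_verts_conv_heads[OF c] awalk_verts_conv_tails[OF c] by simp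
      then have "head G ` set \<gamma> \<subseteq> insert z (tail G ` set \<gamma>)" by auto
      then show ?thesis using exit_walk_end[OF \<gamma>(1)] by auto
    qed
    ultimately show ?thesis
      unfolding wilson_from_Suc_front g using \<gamma>(2) by auto
  qed
  moreover have "forest_weight f \<le> (\<Prod>i<Suc N. emeasure (walk_law (en i)) (A' i)) * partition_sum D"
  proof -
    let ?P = "\<Prod>i<N. emeasure (walk_law (en (Suc i))) (A i)"
    have B: "emeasure (walk_law x) (A' 0) = emeasure words ?W"
    proof -
      have "emeasure (walk_law x) (A' 0) = emeasure (walk_law x) ?B"
        using sets_starts_with_some[OF x W] N0(2) by (simp add: A'_def emeasure_Diff_null_set)
      also have "\<dots> = emeasure words ?W"
        by (rule emeasure_prefix_free[OF x W]) (use exit_walk_prefix in \<open>auto simp: prefix_free_def\<close>)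
      finally show ?thesis .
    qed
    have "forest_weight f \<le> walk_prob \<gamma> * (?P * partition_sum ?D)"
      unfolding F(2) by (intro mult_left_mono A(3)) simp
    also have "\<dots> = ?P * (walk_prob \<gamma> * partition_sum ?D)" by (simp add: ac_simps)
    also have "\<dots> \<le> ?P * (emeasure words ?W * partition_sum D)"
      by (intro mult_left_mono loop_erased_walk_law[OF Suc.prems(1,2) \<gamma>(1,3)]) simp
    also have "\<dots> = (\<Prod>i<Suc N. emeasure (walk_law (en i)) (A' i)) * partition_sum D"
      unfolding prod.lessThan_Suc_shift using B by (simp add: ac_simps A'_def x_def)
    finally show ?thesis .
  qed
  ultimately show ?case by blast
qed

subsection \<open>Measurability of Wilson's algorithm\<close>

lemma pred_countable_Bex:
  "countable I \<Longrightarrow> (\<And>i. i \<in> I \<Longrightarrow> Measurable.pred M (P i)) \<Longrightarrow> Measurable.pred M (\<lambda>x. \<exists>i\<in>I. P i x)"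
  unfolding pred_def by (rule sets.sets_Collect_countable_Ex')

lemma pred_countable_Ball:
  "countable I \<Longrightarrow> (\<And>i. i \<in> I \<Longrightarrow> Measurable.pred M (P i)) \<Longrightarrow> Measurable.pred M (\<lambda>x. \<forall>i\<in>I. P i x)"
  unfolding pred_def by (rule sets.sets_Collect_countable_All')

definition walks_law :: "(nat \<Rightarrow> 'v) \<Rightarrow> (nat \<Rightarrow> nat \<Rightarrow> 'e) measure" where
  "walks_law en = (\<Pi>\<^sub>M i\<in>UNIV. walk_law (en i))"

text \<open>The least hitting time and the limit are expressed by quantifiers over natural numbers,
  a form whose measurability can be read off.\<close>

lemma mem_loop_erasure_stopped:
  "e \<in> loop_erasure_stopped T \<omega> \<longleftrightarrow>
    (\<exists>n. tail G (\<omega> n) \<in> T \<and> (\<forall>m<n. tail G (\<omega> m) \<notin> T) \<and> e \<in> set (loop_erase (map \<omega> [0..<n]))) \<or>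
    (\<forall>n. tail G (\<omega> n) \<notin> T) \<and> (\<exists>N. \<forall>n\<ge>N. e \<in> set (loop_erase (map \<omega> [0..<n])))"
proof (cases "\<exists>n. tail G (\<omega> n) \<in> T")
  case True
  define n where "n = (LEAST n. tail G (\<omega> n) \<in> T)"
  have n: "tail G (\<omega> n) \<in> T" unfolding n_def using True by (rule LeastI_ex)
  have less: "tail G (\<omega> m) \<notin> T" if "m < n" for m using not_less_Least that unfolding n_def by blast
  have "m = n" if "tail G (\<omega> m) \<in> T" "\<forall>i<m. tail G (\<omega> i) \<notin> T" for m
    using n less that by (metis linorder_neqE_nat)
  then have 1: "(\<exists>m. tail G (\<omega> m) \<in> T \<and> (\<forall>i<m. tail G (\<omega> i) \<notin> T) \<and> e \<in> set (loop_erase (map \<omega> [0..<m])))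
      \<longleftrightarrow> e \<in> set (loop_erase (map \<omega> [0..<n]))"
    using n less by metis
  have 2: "loop_erasure_stopped T \<omega> = set (loop_erase (map \<omega> [0..<n]))"
    unfolding loop_erasure_stopped_def n_def using True by simp
  show ?thesis unfolding 1 2 using True by blast
next
  case False
  then show ?thesis
    by (auto simp: loop_erasure_stopped_def loop_erasure_infinite_def eventually_sequentially)
qed

context
  fixes en :: "nat \<Rightarrow> 'v"
  assumes en: "range en \<subseteq> verts G"
begin

lemma en_verts: "en i \<in> verts G"
  using en by auto

lemma product_prob_space_walks: "product_prob_space (\<lambda>i. walk_law (en i))"
  by (intro product_prob_spaceI prob_space_walk_law en_verts)

lemma prob_space_walks_law: "prob_space (walks_law en)"
  unfolding walks_law_def by (intro prob_space_PiM prob_space_walk_law en_verts)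

lemma space_walks_law: "X \<in> space (walks_law en) \<Longrightarrow> X i n \<in> arcs G"
  by (auto simp: walks_law_def space_PiM PiE_iff space_walk_law[OF en_verts])

lemma measurable_walk: "(\<lambda>X. X i) \<in> measurable (walks_law en) (walk_law (en i))"
  unfolding walks_law_def by (rule measurable_component_singleton) simp

lemma pred_walk_step: "Measurable.pred (walks_law en) (\<lambda>X. Q (X i n))"
proof -
  have m: "(\<lambda>X. X i n) \<in> measurable (walks_law en) (count_space (arcs G))"
    using measurable_compose[OF measurable_walk measurable_at[OF en_verts]] .
  have "Q \<in> measurable (count_space (arcs G)) (count_space UNIV)" by simp
  from measurable_compose[OF m this] show ?thesis .
qed

lemma pred_loop_erase: "Measurable.pred (walks_law en) (\<lambda>X. e \<in> set (loop_erase (map (X i) [0..<n])))"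
proof -
  let ?L = "{w\<in>lists (arcs G). length w = n \<and> e \<in> set (loop_erase w)}"
  have "Measurable.pred (walks_law en) (\<lambda>X. starts_with (X i) w)" for w
    unfolding starts_with_def
    by (intro pred_intros_countable pred_intros_logic pred_walk_step)
  then have "Measurable.pred (walks_law en) (\<lambda>X. \<exists>w\<in>?L. starts_with (X i) w)"
  proof (rule pred_countable_Bex[rotated])
    show "countable ?L"
      by (rule countable_subset[OF _ countable_lists[OF countable_arcs]]) blast
  qed
  moreover have "(\<exists>w\<in>?L. starts_with (X i) w) \<longleftrightarrow> e \<in> set (loop_erase (map (X i) [0..<n]))"
    if "X \<in> space (walks_law en)" for X
  proof
    assume "\<exists>w\<in>?L. starts_with (X i) w"
    then obtain w where w: "length w = n" "e \<in> set (loop_erase w)" "starts_with (X i) w" by auto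
    moreover have "map (X i) [0..<n] = w" using w by (intro nth_equalityI) (auto simp: starts_with_def)
    ultimately show "e \<in> set (loop_erase (map (X i) [0..<n]))" by simp
  next
    assume "e \<in> set (loop_erase (map (X i) [0..<n]))"
    moreover have "set (map (X i) [0..<n]) \<subseteq> arcs G" using space_walks_law[OF that] by auto
    ultimately have "map (X i) [0..<n] \<in> ?L" by (simp add: in_lists_conv_set subset_iff)
    then show "\<exists>w\<in>?L. starts_with (X i) w" using starts_with_map by blast
  qed
  ultimately show ?thesis by (simp cong: measurable_cong)
qed

lemma loop_erasure_stopped_arcs:
  assumes "X \<in> space (walks_law en)"
  shows "loop_erasure_stopped T (X i) \<subseteq> arcs G"
proof
  fix e assume "e \<in> loop_erasure_stopped T (X i)"
  then obtain n where "e \<in> set (loop_erase (map (X i) [0..<n]))"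
    unfolding mem_loop_erasure_stopped by blast
  then have "e \<in> set (map (X i) [0..<n])" using set_loop_erase by blast
  then show "e \<in> arcs G" using space_walks_law[OF assms] by auto
qed

lemma wilson_from_arcs:
  "X \<in> space (walks_law en) \<Longrightarrow> wilson_from S X i \<subseteq> arcs G"
  using loop_erasure_stopped_arcs by (induction i) auto

lemma pred_wilson_from: "Measurable.pred (walks_law en) (\<lambda>X. e \<in> wilson_from S X i)"
proof (induction i arbitrary: e)
  case (Suc i)
  let ?W = "\<lambda>X. wilson_from S X i"
  let ?T = "\<lambda>X. S \<union> tail G ` ?W X \<union> head G ` ?W X"
  have T: "Measurable.pred (walks_law en) (\<lambda>X. tail G (X i n) \<in> ?T X)" for n
  proof -
    have "Measurable.pred (walks_law en) (\<lambda>X. tail G (X i n) \<in> S \<or>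
      (\<exists>a\<in>arcs G. a \<in> ?W X \<and> (tail G (X i n) = tail G a \<or> tail G (X i n) = head G a)))"
      by (intro pred_intros_logic pred_countable_Bex countable_arcs Suc.IH pred_walk_step)
    moreover have "(tail G (X i n) \<in> S \<or>
      (\<exists>a\<in>arcs G. a \<in> ?W X \<and> (tail G (X i n) = tail G a \<or> tail G (X i n) = head G a))) \<longleftrightarrow> tail G (X i n) \<in> ?T X"
      if "X \<in> space (walks_law en)" for X
      using wilson_from_arcs[OF that, of S i] by blast
    ultimately show ?thesis by (simp cong: measurable_cong)
  qed
  define h where "h n X \<longleftrightarrow> tail G (X i n) \<in> ?T X" for n X
  have h: "Measurable.pred (walks_law en) (h n)" for n
    using T[of n] by (simp add: h_def[abs_def])
  have "Measurable.pred (walks_law en) (\<lambda>X. e \<in> loop_erasure_stopped (?T X) (X i))"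
    unfolding mem_loop_erasure_stopped h_def[symmetric]
    by (intro pred_intros_logic pred_intros_countable pred_loop_erase h) simp_all
  with Suc.IH show ?case by simp
qed simp

lemma pred_wilson_from_eq:
  assumes "f \<subseteq> arcs G"
  shows "Measurable.pred (walks_law en) (\<lambda>X. wilson_from S X i = f)"
proof -
  have "Measurable.pred (walks_law en) (\<lambda>X. \<forall>e\<in>arcs G. e \<in> wilson_from S X i \<longleftrightarrow> e \<in> f)"
    by (intro pred_countable_Ball countable_arcs pred_intros_logic pred_wilson_from) simp_all
  moreover have "(\<forall>e\<in>arcs G. e \<in> wilson_from S X i \<longleftrightarrow> e \<in> f) \<longleftrightarrow> wilson_from S X i = f"
    if "X \<in> space (walks_law en)" for X
    using wilson_from_arcs[OF that, of S i] assms by blast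
  ultimately show ?thesis by (simp cong: measurable_cong)
qed

theorem wilson_from_law:
  assumes D: "finite D" "D \<subseteq> verts G" "D \<subseteq> en ` {..<N}" and f: "f \<in> forests D"
  shows "emeasure (walks_law en) {X \<in> space (walks_law en). wilson_from (-D) X N = f} * partition_sum D = forest_weight f"
proof -
  interpret P: product_prob_space "\<lambda>i. walk_law (en i)" UNIV by (rule product_prob_space_walks)
  let ?E = "\<lambda>f. {X \<in> space (walks_law en). wilson_from (-D) X N = f}"
  let ?p = "\<lambda>f. emeasure (walks_law en) (?E f)"
  have E: "?E f \<in> sets (walks_law en)" if "f \<in> forests D" for f
    using pred_wilson_from_eq[OF forestsD(1)[OF that]] by (simp add: pred_def)
  have ge: "forest_weight f \<le> ?p f * partition_sum D" if f: "f \<in> forests D" for f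
  proof -
    obtain A where A: "\<And>i. A i \<in> sets (walk_law (en i))" "\<And>X. (\<forall>i<N. X i \<in> A i) \<Longrightarrow> wilson_from (-D) X N = f"
      "forest_weight f \<le> (\<Prod>i<N. emeasure (walk_law (en i)) (A i)) * partition_sum D"
      using wilson_from_lower_bound[OF D(1,2) en D(3) f] by auto
    have "(\<Prod>i<N. emeasure (walk_law (en i)) (A i)) = emeasure (walks_law en) (P.emb UNIV {..<N} (PiE {..<N} A))"
      unfolding walks_law_def using A(1) by (intro P.emeasure_PiM_emb[symmetric]) auto
    also have "\<dots> \<le> ?p f"
    proof (rule emeasure_mono[OF _ E[OF f]])
      show "P.emb UNIV {..<N} (PiE {..<N} A) \<subseteq> ?E f"
      proof
        fix X assume X: "X \<in> P.emb UNIV {..<N} (PiE {..<N} A)"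
        then have "\<forall>i<N. X i \<in> A i" by (auto simp: prod_emb_def)
        from A(2)[OF this] have "wilson_from (- D) X N = f" .
        moreover have "X \<in> space (walks_law en)"
          using X by (simp add: prod_emb_def walks_law_def space_PiM)
        ultimately show "X \<in> ?E f" by blast
      qed
    qed
    finally have "(\<Prod>i<N. emeasure (walk_law (en i)) (A i)) * partition_sum D \<le> ?p f * partition_sum D"
      by (rule mult_right_mono) simp
    with A(3) show ?thesis by (rule order_trans)
  qed
  have "(\<Sum>f\<in>forests D. ?p f) = emeasure (walks_law en) (\<Union>f\<in>forests D. ?E f)"
    using E by (intro sum_emeasure) (auto simp: disjoint_family_on_def finite_forests[OF D(1)])
  also have "\<dots> \<le> 1"
    using prob_space_walks_law by (rule prob_space.emeasure_le_1)
  finally have le1: "(\<Sum>f\<in>forests D. ?p f) \<le> 1" .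
  \<comment> \<open>With the weights \<open>?R\<close> of all other forests bounded from below, no
    room is left for \<open>f\<close> to exceed its share. \<open>?R\<close> must be finite to be
    cancelled.\<close>
  let ?R = "\<Sum>g\<in>forests D - {f}. forest_weight g"
  have "?p f * partition_sum D + ?R \<le> ?p f * partition_sum D + (\<Sum>g\<in>forests D - {f}. ?p g * partition_sum D)"
    using ge by (intro add_left_mono sum_mono) auto
  also have "\<dots> = (\<Sum>g\<in>forests D. ?p g) * partition_sum D"
    unfolding sum_distrib_right using finite_forests[OF D(1)] f by (subst (2) sum.remove[of _ f]) auto
  also have "\<dots> \<le> 1 * partition_sum D" using le1 by (rule mult_right_mono) simp
  also have "\<dots> = forest_weight f + ?R"
    unfolding partition_sum_def using finite_forests[OF D(1)] f by (subst sum.remove[of _ f]) auto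
  finally have "?p f * partition_sum D + ?R \<le> forest_weight f + ?R" .
  moreover have "?R \<noteq> \<infinity>"
    using forest_weight_pos_finite(2)[OF forestsD(1)] by (auto simp: finite_forests[OF D(1)])
  ultimately have "?p f * partition_sum D \<le> forest_weight f"
    by (simp add: add.commute[of _ ?R] ennreal_add_left_cancel_le)
  then show ?thesis using ge[OF f] by (rule order.antisym)
qed

end

subsection \<open>Convergence of the wired forests\<close>

lemma loop_erase_Suc:
  "loop_erase (map \<omega> [0..<Suc n]) = takeWhile (\<lambda>a. tail G a \<noteq> head G (\<omega> n)) (loop_erase (map \<omega> [0..<n]) @ [\<omega> n])"
  by (simp add: loop_erase_snoc)

lemma set_loop_erase_Suc: "set (loop_erase (map \<omega> [0..<Suc n])) \<subseteq> insert (\<omega> n) (set (loop_erase (map \<omega> [0..<n])))"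
proof
  fix e assume "e \<in> set (loop_erase (map \<omega> [0..<Suc n]))"
  then have "e \<in> set (loop_erase (map \<omega> [0..<n]) @ [\<omega> n])"
    unfolding loop_erase_Suc by (rule set_takeWhileD[THEN conjunct1])
  then show "e \<in> insert (\<omega> n) (set (loop_erase (map \<omega> [0..<n])))" by auto
qed

lemma transient_trajectory_finite_arc:
  assumes "transient_trajectory x \<omega>"
  shows "\<exists>M. \<forall>n\<ge>M. \<omega> n \<noteq> e"
proof (cases "e \<in> arcs G")
  case True
  then have "finite {n. tail G (\<omega> n) = tail G e}" using assms by (auto simp: transient_trajectory_def)
  then have "finite {n. \<omega> n = e}" by (rule finite_subset[rotated]) auto
  then obtain M where "\<forall>n\<in>{n. \<omega> n = e}. n < M" using finite_nat_set_iff_bounded by blast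
  then show ?thesis by (intro exI[of _ M]) auto
next
  case False
  moreover have "\<omega> n \<in> arcs G" for n using assms by (auto simp: transient_trajectory_def trajectory_def)
  ultimately show ?thesis by metis
qed

lemma transient_trajectory_finite_visits:
  assumes "transient_trajectory x \<omega>" "u \<in> verts G"
  shows "\<exists>M. \<forall>n\<ge>M. tail G (\<omega> n) \<noteq> u"
proof -
  have "finite {n. tail G (\<omega> n) = u}" using assms by (auto simp: transient_trajectory_def)
  then obtain M where "\<forall>n\<in>{n. tail G (\<omega> n) = u}. n < M" using finite_nat_set_iff_bounded by blast
  then show ?thesis by (intro exI[of _ M]) auto
qed

text \<open>Once the walk has crossed \<open>e\<close> for the last time, \<open>e\<close> can only be erased, and this for good.\<close>
lemma loop_erase_eventually_const:
  assumes "transient_trajectory x \<omega>"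
  shows "\<exists>M. \<forall>n\<ge>M. e \<in> set (loop_erase (map \<omega> [0..<n])) \<longleftrightarrow> e \<in> loop_erasure_infinite \<omega>"
proof -
  obtain M where M: "\<And>n. n \<ge> M \<Longrightarrow> \<omega> n \<noteq> e" using transient_trajectory_finite_arc[OF assms] by blast
  let ?P = "\<lambda>n. e \<in> set (loop_erase (map \<omega> [0..<n]))"
  have step: "?P n" if "?P (Suc n)" "n \<ge> M" for n
    using that set_loop_erase_Suc[of \<omega> n] M[of n] by auto
  have down: "?P n" if "?P m" "n \<le> m" "M \<le> n" for n m
    using that(2,1,3)
  proof (induction rule: dec_induct)
    case (step m)
    have "?P m" using \<open>\<And>n. ?P (Suc n) \<Longrightarrow> n \<ge> M \<Longrightarrow> ?P n\<close>[of m] step by simp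
    then show ?case using step by simp
  qed
  show ?thesis
  proof (cases "\<exists>m\<ge>M. \<not> ?P m")
    case True
    then obtain m where m: "m \<ge> M" "\<not> ?P m" by auto
    have never: "\<not> ?P n" if "n \<ge> m" for n using down[of n m] m that by auto
    moreover have "e \<notin> loop_erasure_infinite \<omega>"
    proof
      assume "e \<in> loop_erasure_infinite \<omega>"
      then obtain N where "\<And>n. n \<ge> N \<Longrightarrow> ?P n"
        unfolding loop_erasure_infinite_def eventually_sequentially by auto
      with never[of "max m N"] show False by simp
    qed
    ultimately show ?thesis by blast
  next
    case False
    then have "e \<in> loop_erasure_infinite \<omega>"
      unfolding loop_erasure_infinite_def eventually_sequentially by auto
    with False show ?thesis by blast
  qed
qed

text \<open>Only finitely many positions matter. If the walk hits \<open>T'\<close>, the hitting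
  times are eventually equal. If not, the hitting time of \<open>T k\<close> is eventually either
  infinite or later than the time after which the presence of \<open>e\<close> no longer
  changes.\<close>

lemma loop_erasure_stopped_converges:
  assumes \<omega>: "transient_trajectory x \<omega>"
    and T: "\<And>u. u \<in> verts G \<Longrightarrow> \<forall>\<^sub>F k in sequentially. u \<in> T k \<longleftrightarrow> u \<in> T'"
  shows "\<forall>\<^sub>F k in sequentially. e \<in> loop_erasure_stopped (T k) \<omega> \<longleftrightarrow> e \<in> loop_erasure_stopped T' \<omega>"
proof -
  have v: "tail G (\<omega> n) \<in> verts G" for n
    using \<omega> by (auto simp: transient_trajectory_def trajectory_def image_subset_iff)
  have ev: "\<forall>\<^sub>F k in sequentially. \<forall>n\<in>{..m}. tail G (\<omega> n) \<in> T k \<longleftrightarrow> tail G (\<omega> n) \<in> T'" for m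
    using T v by (intro eventually_ball_finite) auto
  show ?thesis
  proof (cases "\<exists>n. tail G (\<omega> n) \<in> T'")
    case True
    define n where "n = (LEAST n. tail G (\<omega> n) \<in> T')"
    have n: "tail G (\<omega> n) \<in> T'" unfolding n_def using True by (rule LeastI_ex)
    have less: "tail G (\<omega> m) \<notin> T'" if "m < n" for m using not_less_Least that unfolding n_def by blast
    show ?thesis using ev[of n]
    proof (rule eventually_mono)
      fix k assume k: "\<forall>n\<in>{..n}. tail G (\<omega> n) \<in> T k \<longleftrightarrow> tail G (\<omega> n) \<in> T'"
      then have nk: "tail G (\<omega> n) \<in> T k" using n by simp
      moreover have "(LEAST n. tail G (\<omega> n) \<in> T k) = n"
        using k nk less by (intro Least_equality) (auto simp: not_less[symmetric])
      ultimately show "e \<in> loop_erasure_stopped (T k) \<omega> \<longleftrightarrow> e \<in> loop_erasure_stopped T' \<omega>"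
        unfolding loop_erasure_stopped_def n_def[symmetric] using True by auto
    qed
  next
    case False
    then have T': "loop_erasure_stopped T' \<omega> = loop_erasure_infinite \<omega>" by (simp add: loop_erasure_stopped_def)
    obtain M where M: "\<And>n. n \<ge> M \<Longrightarrow> e \<in> set (loop_erase (map \<omega> [0..<n])) \<longleftrightarrow> e \<in> loop_erasure_infinite \<omega>"
      using loop_erase_eventually_const[OF \<omega>] by blast
    show ?thesis using ev[of M]
    proof (rule eventually_mono)
      fix k assume k: "\<forall>n\<in>{..M}. tail G (\<omega> n) \<in> T k \<longleftrightarrow> tail G (\<omega> n) \<in> T'"
      show "e \<in> loop_erasure_stopped (T k) \<omega> \<longleftrightarrow> e \<in> loop_erasure_stopped T' \<omega>"
      proof (cases "\<exists>n. tail G (\<omega> n) \<in> T k")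
        case True
        define n where "n = (LEAST n. tail G (\<omega> n) \<in> T k)"
        have "tail G (\<omega> n) \<in> T k" unfolding n_def using True by (rule LeastI_ex)
        with k False have "\<not> n \<le> M" by auto
        then have "n \<ge> M" by simp
        then show ?thesis
          unfolding T' using True M[of n] by (simp add: loop_erasure_stopped_def n_def)
      next
        case nk: False
        then show ?thesis unfolding T' by (simp add: loop_erasure_stopped_def)
      qed
    qed
  qed
qed

lemma loop_erasure_stopped_crossed:
  assumes "e \<in> loop_erasure_stopped T \<omega>"
  shows "e \<in> range \<omega>" "tail G e \<notin> T"
proof -
  from assms obtain n where n: "e \<in> set (loop_erase (map \<omega> [0..<n]))" "\<And>m. m < n \<Longrightarrow> tail G (\<omega> m) \<notin> T"
    unfolding mem_loop_erasure_stopped by blast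
  then have "e \<in> set (map \<omega> [0..<n])" using set_loop_erase by blast
  then show "e \<in> range \<omega>" "tail G e \<notin> T" using n(2) by auto
qed

lemma trajectory_cas: "trajectory x \<omega> \<Longrightarrow> cas x (map \<omega> [0..<n]) (tail G (\<omega> n))"
proof (induction n)
  case (Suc n)
  then show ?case by (auto simp: trajectory_def simp del: cas_append_iff intro!: cas_appendI)
qed (simp add: trajectory_def)

lemma loop_erase_hd:
  assumes "trajectory x \<omega>" "tail G (\<omega> n) \<noteq> x"
  shows "loop_erase (map \<omega> [0..<n]) \<noteq> []" "tail G (hd (loop_erase (map \<omega> [0..<n]))) = x"
proof -
  have c: "cas x (loop_erase (map \<omega> [0..<n])) (tail G (\<omega> n))"
    using loop_erase_cas[OF trajectory_cas[OF assms(1)]] by blast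
  then show "loop_erase (map \<omega> [0..<n]) \<noteq> []" using assms(2) by auto
  then show "tail G (hd (loop_erase (map \<omega> [0..<n]))) = x" using c by (cases "loop_erase (map \<omega> [0..<n])") auto
qed

text \<open>Erasure removes a final segment, so everything before \<open>a\<close> stays as long as
  \<open>a\<close> does. That \<open>\<omega> n\<close> differs from \<open>a\<close> rules out that
  \<open>a\<close> is erased and crossed again.\<close>

lemma loop_erase_frozen_prefix:
  assumes "loop_erase (map \<omega> [0..<m]) = q @ a # r"
    and "\<And>n. n \<ge> m \<Longrightarrow> a \<in> set (loop_erase (map \<omega> [0..<n]))"
    and "\<And>n. n \<ge> m \<Longrightarrow> \<omega> n \<noteq> a"
    and "m \<le> n" and "a \<notin> set q"
  shows "\<exists>r. loop_erase (map \<omega> [0..<n]) = q @ a # r"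
  using assms(4)
proof (induction rule: dec_induct)
  case base
  then show ?case using assms(1) by auto
next
  case (step n)
  then obtain r where r: "loop_erase (map \<omega> [0..<n]) = q @ a # r" by auto
  let ?P = "\<lambda>b. tail G b \<noteq> head G (\<omega> n)"
  have a: "a \<in> set (takeWhile ?P (q @ a # r @ [\<omega> n]))"
    using assms(2)[of "Suc n"] step unfolding loop_erase_Suc r by simp
  have "\<forall>b\<in>set (q @ [a]). ?P b"
  proof (rule ccontr)
    assume "\<not> ?thesis"
    then obtain b where b: "b \<in> set (q @ [a])" "\<not> ?P b" by blast
    show False
    proof (cases "\<forall>b\<in>set q. ?P b")
      case True
      with b have "\<not> ?P a" by auto
      then show False using True a by (auto dest: set_takeWhileD)
    next
      case False
      then obtain b where "b \<in> set q" "\<not> ?P b" by auto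
      then have "takeWhile ?P (q @ a # r @ [\<omega> n]) = takeWhile ?P q" by (intro takeWhile_append1) auto
      then show False using a assms(5) by (auto dest: set_takeWhileD)
    qed
  qed
  then have "takeWhile ?P (q @ a # r @ [\<omega> n]) = q @ a # takeWhile ?P (r @ [\<omega> n])"
    by (subst takeWhile_append2) auto
  then show ?case unfolding loop_erase_Suc r by auto
qed

text \<open>For a walk that is never stopped: after its last visit to \<open>x\<close>, the first
  arc of the erased path is permanent, since only a return to \<open>x\<close> could remove
  it.\<close>

lemma loop_erasure_stopped_start:
  assumes \<omega>: "transient_trajectory x \<omega>" and x: "x \<in> verts G" "x \<notin> T"
  shows "x \<in> tail G ` loop_erasure_stopped T \<omega>"
proof -
  have t: "trajectory x \<omega>" using \<omega> by (simp add: transient_trajectory_def)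
  show ?thesis
  proof (cases "\<exists>n. tail G (\<omega> n) \<in> T")
    case True
    define n where "n = (LEAST n. tail G (\<omega> n) \<in> T)"
    have n: "tail G (\<omega> n) \<in> T" unfolding n_def using True by (rule LeastI_ex)
    then have "tail G (\<omega> n) \<noteq> x" using x by auto
    from loop_erase_hd[OF t this] have "x \<in> tail G ` set (loop_erase (map \<omega> [0..<n]))"
      by (metis hd_in_set imageI)
    then show ?thesis using True by (simp add: loop_erasure_stopped_def n_def)
  next
    case False
    obtain M where M: "\<And>n. n \<ge> M \<Longrightarrow> tail G (\<omega> n) \<noteq> x"
      using transient_trajectory_finite_visits[OF \<omega> x(1)] by blast
    let ?L = "\<lambda>n. loop_erase (map \<omega> [0..<n])"
    have "hd (?L n) = hd (?L M)" if "n \<ge> M" for n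
      using that
    proof (induction rule: dec_induct)
      case (step n)
      have ne: "?L n \<noteq> []" "?L (Suc n) \<noteq> []"
        using loop_erase_hd(1)[OF t M[of n]] loop_erase_hd(1)[OF t M[of "Suc n"]] step.hyps by (simp_all del: upt_Suc)
      have "hd (?L (Suc n)) = hd (?L n @ [\<omega> n])"
        using ne(2) unfolding loop_erase_Suc by (cases "?L n @ [\<omega> n]") (auto split: if_splits)
      then show ?case using ne(1) step by simp
    qed simp
    moreover have "?L n \<noteq> []" if "n \<ge> M" for n using loop_erase_hd(1)[OF t M[OF that]] .
    ultimately have "hd (?L M) \<in> set (?L n)" if "n \<ge> M" for n
      using that by (metis hd_in_set)
    then have "hd (?L M) \<in> loop_erasure_stopped T \<omega>"
      using False by (auto simp: loop_erasure_stopped_def loop_erasure_infinite_def eventually_sequentially)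
    moreover have "tail G (hd (?L M)) = x" using loop_erase_hd(2)[OF t M] by simp
    ultimately show ?thesis by (metis imageI)
  qed
qed

definition transient_walks :: "(nat \<Rightarrow> 'v) \<Rightarrow> (nat \<Rightarrow> nat \<Rightarrow> 'e) \<Rightarrow> bool" where
  "transient_walks en X \<longleftrightarrow> (\<forall>i. transient_trajectory (en i) (X i))"

lemma wilson_from_subset_arcs:
  assumes "transient_walks en X"
  shows "wilson_from S X i \<subseteq> arcs G"
proof (induction i)
  case (Suc i)
  have "range (X i) \<subseteq> arcs G"
    using assms by (simp add: transient_walks_def transient_trajectory_def trajectory_def)
  then show ?case using Suc loop_erasure_stopped_crossed(1) by (auto simp: subset_iff)
qed simp

lemma wilson_from_mono: "i \<le> k \<Longrightarrow> wilson_from S X i \<subseteq> wilson_from S X k"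
  by (induction rule: dec_induct) auto

text \<open>Later walks stop on hitting the forest, so they never add an arc leaving a vertex
  already included.\<close>

lemma wilson_from_locked:
  assumes "e \<in> wilson_from S X k" "i \<le> k"
    "tail G e \<in> S \<union> tail G ` wilson_from S X i \<union> head G ` wilson_from S X i"
  shows "e \<in> wilson_from S X i"
  using assms(2,1)
proof (induction rule: dec_induct)
  case (step k)
  have "tail G e \<in> S \<union> tail G ` wilson_from S X k \<union> head G ` wilson_from S X k"
    using assms(3) wilson_from_mono[OF step.hyps(1), of S X] by auto
  then have "e \<notin> loop_erasure_stopped (S \<union> tail G ` wilson_from S X k \<union> head G ` wilson_from S X k) (X k)"
    using loop_erasure_stopped_crossed(2) by blast
  then show ?case using step by simp
qed

text \<open>The \<open>i\<close>-th walk puts \<open>en i\<close> into the forest, unless it is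
  there already or wired, and this decides the arcs leaving it. The number \<open>Suc i\<close> of
  walks is the same for all \<open>S\<close>.\<close>

lemma wilson_from_settled:
  assumes "transient_walks en X" "en i \<in> verts G" "tail G e = en i" "Suc i \<le> k"
  shows "e \<in> wilson_from S X k \<longleftrightarrow> e \<in> wilson_from S X (Suc i)"
proof -
  have "transient_trajectory (en i) (X i)" using assms(1) by (simp add: transient_walks_def)
  note start = loop_erasure_stopped_start[OF this assms(2)]
  have "en i \<in> S \<union> tail G ` wilson_from S X (Suc i) \<union> head G ` wilson_from S X (Suc i)"
    using start[of "S \<union> tail G ` wilson_from S X i \<union> head G ` wilson_from S X i"]
    unfolding wilson_from.simps image_Un by blast
  then show ?thesis
    using wilson_from_locked[of e S X k "Suc i"] wilson_from_mono[OF assms(4), of S X] assms(3,4) by auto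
qed

text \<open>Whether a vertex belongs to the stopping set depends on the finitely many arcs at it, by
  local finiteness. So arcwise convergence of the partial forests carries over to the stopping sets
  of the next walk.\<close>

lemma wilson_from_converges:
  assumes X: "transient_walks en X"
    and D: "\<And>u. u \<in> verts G \<Longrightarrow> \<forall>\<^sub>F k in sequentially. u \<in> D k"
  shows "\<forall>\<^sub>F k in sequentially. e \<in> wilson_from (- D k) X i \<longleftrightarrow> e \<in> wilson X i"
  unfolding wilson_eq
proof (induction i arbitrary: e)
  case (Suc i)
  let ?W = "\<lambda>S. wilson_from S X i"
  let ?T = "\<lambda>S. S \<union> tail G ` ?W S \<union> head G ` ?W S"
  have "\<forall>\<^sub>F k in sequentially. u \<in> ?T (- D k) \<longleftrightarrow> u \<in> ?T {}" if u: "u \<in> verts G" for u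
  proof -
    have T: "u \<in> ?T S \<longleftrightarrow> u \<in> S \<or> (\<exists>a\<in>out_arcs G u. a \<in> ?W S) \<or> (\<exists>a\<in>in_arcs G u. a \<in> ?W S)" for S
    proof -
      have "a \<in> arcs G" if "a \<in> ?W S" for a using wilson_from_subset_arcs[OF X] that by blast
      then have "u \<in> tail G ` ?W S \<longleftrightarrow> (\<exists>a\<in>out_arcs G u. a \<in> ?W S)"
        "u \<in> head G ` ?W S \<longleftrightarrow> (\<exists>a\<in>in_arcs G u. a \<in> ?W S)"
        unfolding image_iff Bex_def in_out_arcs_conv in_in_arcs_conv by metis+
      then show ?thesis by simp
    qed
    have fin: "finite (out_arcs G u)" "finite (in_arcs G u)"
      using locally_finite[OF u] by (auto simp: in_arcs_eq)
    have "\<forall>\<^sub>F k in sequentially. \<forall>a\<in>out_arcs G u. a \<in> ?W (- D k) \<longleftrightarrow> a \<in> ?W {}"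
      "\<forall>\<^sub>F k in sequentially. \<forall>a\<in>in_arcs G u. a \<in> ?W (- D k) \<longleftrightarrow> a \<in> ?W {}"
      using Suc.IH fin by (auto intro!: eventually_ball_finite)
    with D[OF u] show ?thesis unfolding T by eventually_elim auto
  qed
  moreover have "transient_trajectory (en i) (X i)" using X by (simp add: transient_walks_def)
  ultimately have "\<forall>\<^sub>F k in sequentially. e \<in> loop_erasure_stopped (?T (- D k)) (X i) \<longleftrightarrow> e \<in> loop_erasure_stopped (?T {}) (X i)"
    by (intro loop_erasure_stopped_converges[where T = "\<lambda>k. ?T (- D k)"])
  with Suc.IH[of e] show ?case by eventually_elim simp
qed simp

text \<open>The number of walks and the exhaustion tend to infinity together. They do not interfere,
  because the arcs leaving \<open>en i\<close> are decided after \<open>Suc i\<close> walks,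
  uniformly in \<open>k\<close>.\<close>

lemma wilson_forest_converges:
  assumes X: "transient_walks en X" and en: "range en = verts G"
    and D: "\<And>u. u \<in> verts G \<Longrightarrow> \<forall>\<^sub>F k in sequentially. u \<in> D k"
    and N: "filterlim N at_top sequentially" and e: "e \<in> arcs G"
  shows "\<forall>\<^sub>F k in sequentially. e \<in> wilson_from (- D k) X (N k) \<longleftrightarrow> e \<in> wilson_forest X"
proof -
  have "tail G e \<in> range en" using e en by auto
  then obtain i where i: "tail G e = en i" by auto
  have v: "en i \<in> verts G" using en by auto
  have conv: "\<forall>\<^sub>F k in sequentially. e \<in> wilson_from (- D k) X (Suc i) \<longleftrightarrow> e \<in> wilson X (Suc i)"
    using wilson_from_converges[OF X D] .
  have eq: "e \<in> wilson_forest X \<longleftrightarrow> e \<in> wilson X (Suc i)"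
  proof
    assume "e \<in> wilson_forest X"
    then obtain k where "e \<in> wilson X k" by (auto simp: wilson_forest_def)
    then have "e \<in> wilson_from {} X (max k (Suc i))"
      using wilson_from_mono[of k "max k (Suc i)" "{}" X] by (auto simp: wilson_eq)
    then show "e \<in> wilson X (Suc i)"
      using wilson_from_settled[OF X v i, of "max k (Suc i)" "{}"] by (auto simp: wilson_eq)
  next
    assume "e \<in> wilson X (Suc i)"
    then show "e \<in> wilson_forest X" unfolding wilson_forest_def by blast
  qed
  have "\<forall>\<^sub>F k in sequentially. Suc i \<le> N k" using N by (simp add: filterlim_at_top)
  then show ?thesis using conv
  proof eventually_elim
    case (elim k)
    show ?case using wilson_from_settled[OF X v i elim(1), of "- D k"] elim(2) eq by blast
  qed
qed

text \<open>A violation would be visible on finitely many arcs: two arcs with a common tail, the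
  arcs leaving one vertex, or a cycle. On these the limit agrees with some approximation.\<close>

lemma limit_of_forests:
  assumes F: "F \<subseteq> arcs G" and lim: "\<And>e. e \<in> arcs G \<Longrightarrow> \<forall>\<^sub>F k in sequentially. e \<in> f k \<longleftrightarrow> e \<in> F"
    and f: "\<And>k. f k \<in> forests (D k)" and D: "\<And>u. u \<in> verts G \<Longrightarrow> \<forall>\<^sub>F k in sequentially. u \<in> D k"
  shows "F \<in> forests (verts G)"
proof -
  have ev: "\<forall>\<^sub>F k in sequentially. \<forall>e\<in>B. e \<in> f k \<longleftrightarrow> e \<in> F" if "finite B" "B \<subseteq> arcs G" for B
    using that(1) by (rule eventually_ball_finite) (use that(2) in \<open>blast intro: lim\<close>)
  have "inj_on (tail G) F"
  proof (rule inj_onI)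
    fix e e' assume e: "e \<in> F" "e' \<in> F" "tail G e = tail G e'"
    have "\<forall>\<^sub>F k in sequentially. \<forall>a\<in>{e, e'}. a \<in> f k \<longleftrightarrow> a \<in> F"
      using e F by (intro ev) blast+
    from eventually_happens'[OF sequentially_bot this] obtain k where "e \<in> f k" "e' \<in> f k" using e by blast
    then show "e = e'" using inj_onD[OF forestsD(2)[OF f[of k]] e(3)] by blast
  qed
  moreover have "tail G ` F = verts G"
  proof
    show "tail G ` F \<subseteq> verts G"
    proof (rule image_subsetI)
      fix a assume "a \<in> F"
      then have "a \<in> arcs G" using F by blast
      then show "tail G a \<in> verts G" by simp
    qed
    show "verts G \<subseteq> tail G ` F"
    proof
      fix u assume u: "u \<in> verts G"
      have "\<forall>\<^sub>F k in sequentially. \<forall>a\<in>out_arcs G u. a \<in> f k \<longleftrightarrow> a \<in> F"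
        using locally_finite[OF u] by (intro ev) auto
      with D[OF u] have "\<forall>\<^sub>F k in sequentially. u \<in> D k \<and> (\<forall>a\<in>out_arcs G u. a \<in> f k \<longleftrightarrow> a \<in> F)"
        by eventually_elim simp
      from eventually_happens'[OF sequentially_bot this]
      obtain k where k: "u \<in> D k" "\<forall>a\<in>out_arcs G u. a \<in> f k \<longleftrightarrow> a \<in> F" by blast
      then have "u \<in> tail G ` f k" using forestsD(3)[OF f[of k]] by simp
      then obtain a where a: "a \<in> f k" "u = tail G a" by (rule imageE)
      then have "a \<in> arcs G" using forestsD(1)[OF f[of k]] by blast
      then have "a \<in> F" using k(2) a by simp
      then show "u \<in> tail G ` F" using a(2) by (rule rev_image_eqI)
    qed
  qed
  moreover have "acyclic (arc_rel F)"
    unfolding acyclic_def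
  proof (intro allI notI)
    fix x assume "(x, x) \<in> (arc_rel F)\<^sup>+"
    from trancl_arc_rel_finite[OF this]
    obtain B where B: "finite B" "B \<subseteq> F" "(x, x) \<in> (arc_rel B)\<^sup>+" by (elim exE conjE)
    have "\<forall>\<^sub>F k in sequentially. \<forall>a\<in>B. a \<in> f k \<longleftrightarrow> a \<in> F"
      using B F by (intro ev) blast+
    from eventually_happens'[OF sequentially_bot this] obtain k where "\<forall>a\<in>B. a \<in> f k" using B by blast
    then have "arc_rel B \<subseteq> arc_rel (f k)" by (intro arc_rel_mono) auto
    with B(3) have "(x, x) \<in> (arc_rel (f k))\<^sup>+" by (rule trancl_mono)
    then show False using forestsD(4)[OF f[of k]] by (auto simp: acyclic_def)
  qed
  ultimately show ?thesis using F by (simp add: forests_def)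
qed

text \<open>The part of the erased path before a permanent arc is permanent too, so the infinite
  erasure is a path from \<open>x\<close> through all its arcs.\<close>

lemma loop_erasure_infinite_reaches:
  assumes \<omega>: "transient_trajectory x \<omega>" and a: "a \<in> loop_erasure_infinite \<omega>"
  shows "(x, head G a) \<in> (arc_rel (loop_erasure_infinite \<omega>))\<^sup>*"
proof -
  let ?L = "\<lambda>n. loop_erase (map \<omega> [0..<n])"
  obtain M1 where M1: "\<And>n. n \<ge> M1 \<Longrightarrow> a \<in> set (?L n)"
    using a unfolding loop_erasure_infinite_def eventually_sequentially by blast
  obtain M2 where M2: "\<And>n. n \<ge> M2 \<Longrightarrow> \<omega> n \<noteq> a"
    using transient_trajectory_finite_arc[OF \<omega>] by blast
  define M where "M = max M1 M2"
  have "a \<in> set (?L M)" using M1 by (simp add: M_def)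
  then obtain q r where qr: "?L M = q @ a # r" "a \<notin> set q" by (meson split_list_first)
  have frozen: "\<exists>r. ?L n = q @ a # r" if "n \<ge> M" for n
    by (rule loop_erase_frozen_prefix[OF qr(1) _ _ that qr(2)]) (use M1 M2 in \<open>auto simp: M_def\<close>)
  have "b \<in> loop_erasure_infinite \<omega>" if b: "b \<in> set (q @ [a])" for b
  proof -
    have "b \<in> set (?L n)" if "n \<ge> M" for n using frozen[OF that] b by auto
    then show ?thesis unfolding loop_erasure_infinite_def eventually_sequentially by blast
  qed
  then have sub: "set (q @ [a]) \<subseteq> loop_erasure_infinite \<omega>" by blast
  have "cas x (?L M) (tail G (\<omega> M))"
    using loop_erase_cas[OF trajectory_cas[of x \<omega> M]] \<omega> by (simp add: transient_trajectory_def)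
  then have "cas x (q @ [a]) (head G a)" unfolding qr by simp
  then show ?thesis using sub by (rule cas_rtrancl)
qed

section \<open>Exchange for wired forests and convergence of the update\<close>

definition wired_prob :: "'v set \<Rightarrow> ('e set \<Rightarrow> bool) \<Rightarrow> ennreal" where
  "wired_prob D Q = (\<Sum>f\<in>{f\<in>forests D. Q f}. forest_weight f / partition_sum D)"

text \<open>\<open>\<lambda>f. update f e\<close> is a bijection between the two events, with
  inverse \<open>\<lambda>f. update f d\<close>. The product of \<open>vertex_conductance\<close>
  over \<open>D\<close> is common to all forests, which turns the identity for conductances into one
  for \<open>forest_weight\<close>.\<close>

lemma wired_prob_exchange:
  assumes D: "finite D" "D \<subseteq> verts G" and v: "v \<in> D" and e: "e \<in> out_arcs G v" and d: "d \<in> out_arcs G v"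
  shows "ennreal (c e) * wired_prob D (\<lambda>f. Q (update f e) \<and> undo_arc f e = d) =
    ennreal (c d) * wired_prob D (\<lambda>f. Q f \<and> undo_arc f d = e)"
proof -
  have V: "forest_weight f = ennreal (prod c f / (\<Prod>x\<in>D. vertex_conductance x))" if f: "f \<in> forests D" for f
  proof -
    have "forest_weight f = ennreal (\<Prod>e\<in>f. jump e)"
      unfolding forest_weight_def using forestsD(1)[OF f] jump_pos by (intro prod_ennreal) (auto intro: less_imp_le)
    also have "(\<Prod>e\<in>f. jump e) = prod c f / (\<Prod>e\<in>f. vertex_conductance (tail G e))"
      by (simp add: jump_def prod_dividef)
    also have "(\<Prod>e\<in>f. vertex_conductance (tail G e)) = (\<Prod>x\<in>tail G ` f. vertex_conductance x)"
      by (simp add: prod.reindex[OF forestsD(2)[OF f]])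
    finally show ?thesis by (simp add: forestsD(3)[OF f])
  qed
  have nn: "0 \<le> (\<Prod>x\<in>D. vertex_conductance x)"
    using D vertex_conductance_pos by (intro prod_nonneg) (auto intro: less_imp_le)
  have w: "ennreal (c e) * forest_weight f = ennreal (c (undo_arc f e)) * forest_weight (update f e)"
    if f: "f \<in> forests D" and e: "e \<in> out_arcs G v" for f e
  proof -
    have e': "e \<in> arcs G" "tail G e \<in> D" using e v by auto
    note U = update_involution[OF f e']
    have "c e * prod c f = c (undo_arc f e) * prod c (update f e)" using U(6) D(1) by simp
    then have eq: "c e * (prod c f / (\<Prod>x\<in>D. vertex_conductance x)) =
      c (undo_arc f e) * (prod c (update f e) / (\<Prod>x\<in>D. vertex_conductance x))" by simp
    show ?thesis unfolding V[OF f] V[OF U(1)]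
      by (simp only: ennreal_mult'[OF less_imp_le[OF conductance_pos[OF e'(1)]], symmetric]
        ennreal_mult'[OF less_imp_le[OF conductance_pos[OF U(2)]], symmetric] eq)
  qed
  have "ennreal (c e) * wired_prob D (\<lambda>f. Q (update f e) \<and> undo_arc f e = d) =
    (\<Sum>f\<in>{f\<in>forests D. Q (update f e) \<and> undo_arc f e = d}. ennreal (c e) * forest_weight f / partition_sum D)"
    unfolding wired_prob_def sum_distrib_left by (simp add: ennreal_times_divide)
  also have "\<dots> = (\<Sum>f\<in>{f\<in>forests D. Q f \<and> undo_arc f d = e}. ennreal (c d) * forest_weight f / partition_sum D)"
  proof (rule sum.reindex_bij_witness[of _ "\<lambda>f. update f d" "\<lambda>f. update f e"])
    have ea: "e \<in> arcs G" "tail G e \<in> D" "d \<in> arcs G" "tail G d \<in> D" using e d v by auto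
    show "update (update f e) d = f" "update f e \<in> {f\<in>forests D. Q f \<and> undo_arc f d = e}"
      "ennreal (c d) * forest_weight (update f e) / partition_sum D = ennreal (c e) * forest_weight f / partition_sum D"
      if "f \<in> {f\<in>forests D. Q (update f e) \<and> undo_arc f e = d}" for f
      using that update_involution[OF _ ea(1,2), of f] w[of f e] e by auto
    show "update (update f d) e = f" "update f d \<in> {f\<in>forests D. Q (update f e) \<and> undo_arc f e = d}"
      if "f \<in> {f\<in>forests D. Q f \<and> undo_arc f d = e}" for f
      using that update_involution[OF _ ea(3,4), of f] by auto
  qed
  also have "\<dots> = ennreal (c d) * wired_prob D (\<lambda>f. Q f \<and> undo_arc f d = e)"
    unfolding wired_prob_def sum_distrib_left by (simp add: ennreal_times_divide)
  finally show ?thesis .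
qed

text \<open>The trivial case and the existence of a path are decided by finitely many arcs of the
  limit, so they pass to the approximations. The remaining case requires the absence of a path,
  which is not a local condition; there the choice of \<open>en 0\<close> is used.\<close>

lemma update_converges:
  assumes X: "transient_walks en X" and en: "range en = verts G" "en 0 = head G e" and e: "e \<in> arcs G"
    and D: "\<And>u. u \<in> verts G \<Longrightarrow> \<forall>\<^sub>F k in sequentially. u \<in> D k"
    and N: "filterlim N at_top sequentially"
    and f: "\<And>k. wilson_from (- D k) X (N k) \<in> forests (D k)"
    and B: "finite B" "B \<subseteq> arcs G"
  shows "\<forall>\<^sub>F k in sequentially. (B \<subseteq> update (wilson_from (- D k) X (N k)) e \<and> undo_arc (wilson_from (- D k) X (N k)) e = d)
    \<longleftrightarrow> (B \<subseteq> update (wilson_forest X) e \<and> undo_arc (wilson_forest X) e = d)"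
proof -
  define f where "f k = wilson_from (- D k) X (N k)" for k
  define F where "F = wilson_forest X"
  have fF: "f k \<in> forests (D k)" for k using assms(7) by (simp add: f_def)
  have lim: "\<forall>\<^sub>F k in sequentially. a \<in> f k \<longleftrightarrow> a \<in> F" if "a \<in> arcs G" for a
    unfolding f_def F_def by (rule wilson_forest_converges[OF X en(1) D N that])
  have lims: "\<forall>\<^sub>F k in sequentially. \<forall>a\<in>C. a \<in> f k \<longleftrightarrow> a \<in> F" if "finite C" "C \<subseteq> arcs G" for C
    using that(1) by (rule eventually_ball_finite) (use that(2) in \<open>blast intro: lim\<close>)
  have Fa: "F \<subseteq> arcs G"
    using wilson_from_subset_arcs[OF X] by (auto simp: F_def wilson_forest_def wilson_eq)
  have FF: "F \<in> forests (verts G)" by (rule limit_of_forests[OF Fa lim fF D])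
  let ?v = "tail G e"
  have v: "?v \<in> verts G" using e by simp
  have "\<forall>\<^sub>F k in sequentially. (B \<subseteq> update (f k) e \<and> undo_arc (f k) e = d) \<longleftrightarrow> (B \<subseteq> update F e \<and> undo_arc F e = d)"
  proof (cases "e \<in> F \<or> arev e \<in> F \<or> head G e = tail G e")
    case True
    have "\<forall>\<^sub>F k in sequentially. \<forall>a\<in>insert e (insert (arev e) B). a \<in> f k \<longleftrightarrow> a \<in> F"
      using B e by (intro lims) auto
    then show ?thesis
    proof eventually_elim
      case (elim k)
      have "e \<in> f k \<or> arev e \<in> f k \<or> head G e = tail G e" using True elim by simp
      with elim show ?case using update_trivial[of e "f k"] update_trivial[OF True] by (simp add: subset_iff)
    qed
  next
    case nt: False
    then have nt': "e \<notin> F" "arev e \<notin> F" "head G e \<noteq> tail G e" by auto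
    show ?thesis
    proof (cases "head G e \<in> past F ?v")
      case True
      then obtain p where p: "directed_path F (head G e) p ?v" by (auto simp: past_def)
      have pa: "set p \<subseteq> arcs G" "set p \<subseteq> F" using p Fa by (auto simp: directed_path_def)
      have "\<forall>\<^sub>F k in sequentially. \<forall>a\<in>insert e (insert (arev e) (B \<union> set p)). a \<in> f k \<longleftrightarrow> a \<in> F"
        using B e pa by (intro lims) auto
      then show ?thesis
      proof eventually_elim
        case (elim k)
        have "set p \<subseteq> f k" using elim pa by blast
        then have p': "directed_path (f k) (head G e) p ?v" using p by (simp add: directed_path_def)
        have "e \<notin> f k" "arev e \<notin> f k" using elim nt' by auto
        note U = update_path[OF forestsD(2)[OF fF] this nt'(3) p']
        note U' = update_path[OF forestsD(2)[OF FF] nt' p]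
        show ?case unfolding U U' using elim by (auto simp: subset_iff)
      qed
    next
      case np: False
      \<comment> \<open>All vertices on the first branch of the limit are reached from
        \<open>head G e\<close>, so no arc of that branch points into \<open>?v\<close>. There are
        finitely many arcs into \<open>?v\<close>, and eventually none of them is on the first
        branch of the approximation either.\<close>
      have "\<forall>\<^sub>F k in sequentially. head G e \<notin> past (f k) ?v"
      proof -
        have t: "transient_trajectory (head G e) (X 0)" using X en(2) by (metis transient_walks_def)
        have W1: "wilson X (Suc 0) = loop_erasure_infinite (X 0)" by (simp add: loop_erasure_stopped_def)
        have not: "a \<notin> loop_erasure_infinite (X 0)" if a: "a \<in> in_arcs G ?v" for a
        proof
          assume "a \<in> loop_erasure_infinite (X 0)"
          from loop_erasure_infinite_reaches[OF t this] have "(head G e, ?v) \<in> (arc_rel (loop_erasure_infinite (X 0)))\<^sup>*"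
            using a by simp
          moreover have "loop_erasure_infinite (X 0) \<subseteq> F"
            unfolding W1[symmetric] F_def wilson_forest_def by blast
          ultimately have "(head G e, ?v) \<in> (arc_rel F)\<^sup>*" using rtrancl_mono[OF arc_rel_mono] by blast
          then show False using np in_past_iff[OF Fa v] by simp
        qed
        have "finite (in_arcs G ?v)" using locally_finite[OF v] by (simp add: in_arcs_eq)
        then have "\<forall>\<^sub>F k in sequentially. \<forall>a\<in>in_arcs G ?v. a \<in> wilson_from (- D k) X (Suc 0) \<longleftrightarrow> a \<in> wilson X (Suc 0)"
          by (rule eventually_ball_finite) (blast intro: wilson_from_converges[OF X D])
        moreover have "\<forall>\<^sub>F k in sequentially. Suc 0 \<le> N k" using N by (simp add: filterlim_at_top)
        ultimately show ?thesis
        proof eventually_elim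
          case (elim k)
          let ?W = "wilson_from (- D k) X (Suc 0)"
          \<comment> \<open>In the approximation, whatever is reached from \<open>head G e\<close>
            lies on its first branch, as later walks add no arcs leaving this branch.\<close>
          have "y = head G e \<or> y \<in> head G ` ?W" if "(head G e, y) \<in> (arc_rel (f k))\<^sup>*" for y
            using that
          proof (induction rule: rtrancl_induct)
            case (step y z)
            then obtain a where a: "a \<in> f k" "y = tail G a" "z = head G a" by (auto simp: arc_rel_def)
            have "a \<in> ?W"
            proof (cases "y = head G e")
              case True
              then show ?thesis
                using wilson_from_settled[OF X, of 0 a "N k" "- D k"] a en elim(2) e by (simp add: f_def)
            next
              case False
              with step.IH have "y \<in> head G ` ?W" by blast
              then have "tail G a \<in> - D k \<union> tail G ` ?W \<union> head G ` ?W" unfolding a(2) by blast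
              then show ?thesis using wilson_from_locked[of a "- D k" X "N k" "Suc 0"] a(1) elim(2) by (simp only: f_def)
            qed
            then show ?case using a by blast
          qed simp
          then have "(head G e, ?v) \<notin> (arc_rel (f k))\<^sup>*"
          proof -
            have "?v \<notin> head G ` ?W"
            proof
              assume "?v \<in> head G ` ?W"
              then obtain a where a: "a \<in> ?W" "?v = head G a" by (rule imageE)
              then have "a \<in> in_arcs G ?v" using wilson_from_subset_arcs[OF X, of "- D k" "Suc 0"] by auto
              with elim(1) a(1) not W1 show False by blast
            qed
            then show ?thesis using \<open>\<And>y. (head G e, y) \<in> (arc_rel (f k))\<^sup>* \<Longrightarrow> y = head G e \<or> y \<in> head G ` ?W\<close>[of ?v] nt'(3) by metis
          qed
          then show ?case using in_past_iff[OF forestsD(1)[OF fF] v] by simp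
        qed
      qed
      moreover have "\<forall>\<^sub>F k in sequentially. \<forall>a\<in>insert e (insert (arev e) (B \<union> out_arcs G ?v)). a \<in> f k \<longleftrightarrow> a \<in> F"
        using B e locally_finite[OF v] by (intro lims) auto
      moreover note D[OF v]
      ultimately show ?thesis
      proof eventually_elim
        case (elim k)
        have "e \<notin> f k" "arev e \<notin> f k" using elim(2) nt' by auto
        note U = update_exchange[OF fF elim(3) this nt'(3) elim(1)]
        note U' = update_exchange[OF FF v nt' np]
        let ?d = "out_arc F ?v"
        have d: "?d \<in> F" "tail G ?d = ?v" using out_arc_forest[OF FF v] by auto
        then have "?d \<in> f k" using elim(2) Fa by (auto simp: subset_iff)
        then have "out_arc (f k) ?v = ?d" using out_arc_eq[OF forestsD(2)[OF fF]] d by blast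
        moreover have "B \<subseteq> exchange (f k) e \<longleftrightarrow> B \<subseteq> exchange F e"
          using elim(2) by (auto simp: exchange_def subset_iff)
        ultimately show ?case unfolding U U' by simp
      qed
    qed
  qed
  then show ?thesis by (simp only: f_def F_def)
qed

subsection \<open>The law of the forest as a limit of wired forests\<close>

lemma AE_transient_walks:
  assumes "range en \<subseteq> verts G"
  shows "AE X in walks_law en. transient_walks en X"
  unfolding transient_walks_def AE_all_countable walks_law_def
  using assms by (intro allI AE_PiM_component AE_transient_trajectory prob_space_walk_law) auto

lemma pred_wilson_from_Collect:
  assumes "range en \<subseteq> verts G" "finite D"
  shows "Measurable.pred (walks_law en) (\<lambda>X. wilson_from S X N \<in> {f\<in>forests D. Q f})"
proof -
  have "Measurable.pred (walks_law en) (\<lambda>X. \<exists>f\<in>{f\<in>forests D. Q f}. wilson_from S X N = f)"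
    using finite_forests[OF assms(2)] pred_wilson_from_eq[OF assms(1)] forestsD(1)
    by (intro pred_countable_Bex countable_finite) auto
  then show ?thesis by (simp add: Bex_def)
qed

lemma wired_prob_law:
  assumes en: "range en \<subseteq> verts G" and D: "finite D" "D \<subseteq> verts G" "D \<subseteq> en ` {..<N}"
  shows "emeasure (walks_law en) {X \<in> space (walks_law en). wilson_from (-D) X N \<in> {f\<in>forests D. Q f}} = wired_prob D Q"
proof -
  let ?E = "\<lambda>f. {X \<in> space (walks_law en). wilson_from (-D) X N = f}"
  have Z: "partition_sum D \<noteq> 0" "partition_sum D \<noteq> top" using partition_sum_pos_finite[OF D(1,2)] by auto
  have "{X \<in> space (walks_law en). wilson_from (-D) X N \<in> {f\<in>forests D. Q f}} = (\<Union>f\<in>{f\<in>forests D. Q f}. ?E f)"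
    by auto
  also have "emeasure (walks_law en) \<dots> = (\<Sum>f\<in>{f\<in>forests D. Q f}. emeasure (walks_law en) (?E f))"
  proof (rule sum_emeasure[symmetric])
    show "?E ` {f\<in>forests D. Q f} \<subseteq> sets (walks_law en)"
    proof (rule image_subsetI)
      fix f assume "f \<in> {f\<in>forests D. Q f}"
      then have "f \<subseteq> arcs G" using forestsD(1) by blast
      from pred_wilson_from_eq[OF en this] show "?E f \<in> sets (walks_law en)" by (simp add: pred_def)
    qed
  qed (use finite_forests[OF D(1)] in \<open>auto simp: disjoint_family_on_def\<close>)
  also have "\<dots> = wired_prob D Q"
    unfolding wired_prob_def
  proof (rule sum.cong)
    fix f assume "f \<in> {f\<in>forests D. Q f}"
    then have P: "emeasure (walks_law en) (?E f) * partition_sum D = forest_weight f"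
      using wilson_from_law[OF en D] by simp
    show "emeasure (walks_law en) (?E f) = forest_weight f / partition_sum D"
      unfolding P[symmetric] by (rule ennreal_mult_divide_eq[OF Z, symmetric])
  qed simp
  finally show ?thesis .
qed

lemma wired_prob_True:
  assumes "finite D" "D \<subseteq> verts G"
  shows "wired_prob D (\<lambda>_. True) = 1"
proof -
  have "wired_prob D (\<lambda>_. True) = partition_sum D / partition_sum D"
    by (simp add: wired_prob_def partition_sum_def divide_ennreal_def sum_distrib_right)
  then show ?thesis using partition_sum_pos_finite[OF assms] by (simp add: ennreal_divide_self less_top)
qed

lemma AE_wilson_from_forests:
  assumes en: "range en \<subseteq> verts G" and D: "finite D" "D \<subseteq> verts G" "D \<subseteq> en ` {..<N}"
  shows "AE X in walks_law en. wilson_from (-D) X N \<in> forests D"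
proof -
  interpret prob_space "walks_law en" using en by (rule prob_space_walks_law)
  have "prob {X \<in> space (walks_law en). wilson_from (-D) X N \<in> {f\<in>forests D. True}} = 1"
    using wired_prob_law[OF en D, of "\<lambda>_. True"] wired_prob_True[OF D(1,2)] by (simp add: measure_def)
  from AE_prob_1[OF this] show ?thesis by (rule eventually_mono) auto
qed

text \<open>Almost sure eventual agreement of indicators, and dominated convergence. The numbers on
  the left do not involve \<open>en\<close>, which allows limits under different enumerations to be
  compared.\<close>

lemma wired_prob_tendsto:
  assumes en: "range en \<subseteq> verts G"
    and D: "\<And>k. finite (D k)" "\<And>k. D k \<subseteq> verts G" "\<And>k. D k \<subseteq> en ` {..<N k}"
    and Q': "Measurable.pred (walks_law en) Q'"
    and ev: "AE X in walks_law en. (\<forall>k. wilson_from (- D k) X (N k) \<in> forests (D k)) \<longrightarrow>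
      (\<forall>\<^sub>F k in sequentially. Q (wilson_from (- D k) X (N k)) \<longleftrightarrow> Q' X)"
  shows "(\<lambda>k. wired_prob (D k) Q) \<longlonglongrightarrow> emeasure (walks_law en) {X \<in> space (walks_law en). Q' X}"
proof -
  interpret prob_space "walks_law en" using en by (rule prob_space_walks_law)
  let ?A = "\<lambda>k. {X \<in> space (walks_law en). wilson_from (- D k) X (N k) \<in> {f\<in>forests (D k). Q f}}"
  let ?B = "{X \<in> space (walks_law en). Q' X}"
  have A: "?A k \<in> sets (walks_law en)" for k
    using pred_wilson_from_Collect[OF en D(1)] unfolding pred_def .
  have B: "?B \<in> sets (walks_law en)" using Q' by (simp add: pred_def)
  have "(\<lambda>k. integral\<^sup>L (walks_law en) (indicator (?A k) :: _ \<Rightarrow> real)) \<longlonglongrightarrow> integral\<^sup>L (walks_law en) (indicator ?B)"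
  proof (rule integral_dominated_convergence[where w="\<lambda>_. 1"])
    show "AE X in walks_law en. (\<lambda>k. indicator (?A k) X :: real) \<longlonglongrightarrow> indicator ?B X"
    proof -
      have "AE X in walks_law en. \<forall>k. wilson_from (- D k) X (N k) \<in> forests (D k)"
        unfolding AE_all_countable using AE_wilson_from_forests[OF en D(1,2,3)] by blast
      then show ?thesis using ev
      proof eventually_elim
        case (elim X)
        then have "\<forall>\<^sub>F k in sequentially. Q (wilson_from (- D k) X (N k)) \<longleftrightarrow> Q' X" by blast
        then have "\<forall>\<^sub>F k in sequentially. (indicator (?A k) X :: real) = indicator ?B X"
          by (rule eventually_mono) (use elim(1) in \<open>auto simp: indicator_def\<close>)
        then show ?case by (rule tendsto_eventually)
      qed
    qed
  qed (use A B in \<open>auto simp: indicator_def\<close>)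
  then have "(\<lambda>k. prob (?A k)) \<longlonglongrightarrow> prob ?B" using A B by simp
  then have "(\<lambda>k. ennreal (prob (?A k))) \<longlonglongrightarrow> ennreal (prob ?B)" by (rule tendsto_ennrealI)
  then show ?thesis
    unfolding emeasure_eq_measure[symmetric] wired_prob_law[OF en D(1,2,3)] .
qed

lemma finite_cover_initial_segment:
  assumes "finite D" "D \<subseteq> range (en :: nat \<Rightarrow> 'v)"
  shows "\<exists>n. D \<subseteq> en ` {..<n}"
proof -
  obtain C where C: "finite C" "D = en ` C" using finite_subset_image[OF assms] by blast
  then obtain n where "\<forall>i\<in>C. i < n" using finite_nat_set_iff_bounded by blast
  then show ?thesis using C by (intro exI[of _ n]) auto
qed

lemma exhaustion_cover:
  fixes D :: "nat \<Rightarrow> 'v set" and en :: "nat \<Rightarrow> 'v"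
  assumes "range en = verts G" "\<And>k. finite (D k)" "\<And>k. D k \<subseteq> verts G"
  shows "\<exists>N. filterlim N at_top sequentially \<and> (\<forall>k. D k \<subseteq> en ` {..<N k})"
proof -
  have "\<exists>n. D k \<subseteq> en ` {..<n}" for k
    by (rule finite_cover_initial_segment) (use assms in auto)
  then obtain n where n: "\<And>k. D k \<subseteq> en ` {..<n k}" by metis
  \<comment> \<open>The summand \<open>k\<close> forces divergence whatever \<open>n\<close>
    is.\<close>
  have "filterlim (\<lambda>k. k + n k) at_top sequentially"
    by (rule filterlim_at_top_mono[OF filterlim_ident]) simp
  moreover have "D k \<subseteq> en ` {..<k + n k}" for k using n[of k] by fastforce
  ultimately show ?thesis by blast
qed

subsection \<open>The space of configurations\<close>

lemma space_config_space: "space config_space = Pow (arcs G)"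
  by (simp add: config_space_def)

lemma measurable_config_space:
  assumes "f \<in> space M \<rightarrow> Pow (arcs G)" "\<And>e. e \<in> arcs G \<Longrightarrow> Measurable.pred M (\<lambda>x. e \<in> f x)"
  shows "f \<in> measurable M config_space"
  unfolding config_space_def using assms by (intro measurable_vimage_algebra2 measurable_restrict) auto

lemma pred_config_mem: "Measurable.pred config_space (\<lambda>f. e \<in> f)"
proof (cases "e \<in> arcs G")
  case True
  have 1: "(\<lambda>f. \<lambda>e\<in>arcs G. e \<in> f) \<in> measurable config_space (\<Pi>\<^sub>M e\<in>arcs G. count_space (UNIV :: bool set))"
    unfolding config_space_def by (rule measurable_vimage_algebra1) (auto simp: space_PiM)
  have "(\<lambda>g. g e) \<in> measurable (\<Pi>\<^sub>M e\<in>arcs G. count_space (UNIV :: bool set)) (count_space UNIV)"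
    using True by (rule measurable_component_singleton)
  from measurable_compose[OF 1 this] show ?thesis using True by simp
next
  case False
  then have "e \<in> f \<longleftrightarrow> False" if "f \<in> space config_space" for f using that by (auto simp: space_config_space)
  then show ?thesis by (simp cong: measurable_cong)
qed

text \<open>Prescribing only the presence of finitely many arcs gives a generator that is closed
  under intersections, so laws are determined by these events.\<close>

definition cylinders :: "'e set set set" where
  "cylinders = {{f \<in> Pow (arcs G). B \<subseteq> f} | B. finite B \<and> B \<subseteq> arcs G}"

lemma pred_config_subset:
  assumes "countable B" shows "Measurable.pred config_space (\<lambda>f. B \<subseteq> f)"
  unfolding subset_eq using assms pred_config_mem by (intro pred_countable_Ball)

lemma sets_config_space: "sets config_space = sigma_sets (Pow (arcs G)) cylinders"
proof
  let ?N = "sigma (Pow (arcs G)) cylinders"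
  have cyl: "cylinders \<subseteq> Pow (Pow (arcs G))" by (auto simp: cylinders_def)
  have "(\<lambda>f. f) \<in> measurable ?N config_space"
  proof (rule measurable_config_space)
    fix e assume "e \<in> arcs G"
    then have "{f \<in> Pow (arcs G). {e} \<subseteq> f} \<in> cylinders" unfolding cylinders_def by blast
    then show "Measurable.pred ?N (\<lambda>f. e \<in> f)"
      using cyl by (simp add: pred_def)
  qed (use cyl in simp)
  then show "sets config_space \<subseteq> sigma_sets (Pow (arcs G)) cylinders"
    using measurable_sets[of "\<lambda>f. f" ?N config_space] sets.sets_into_space[of _ config_space] cyl
    by (fastforce simp: space_config_space Int_absorb2)
  have "cylinders \<subseteq> sets config_space"
    using pred_config_subset[OF countable_finite] unfolding cylinders_def pred_def space_config_space by blast
  then show "sigma_sets (Pow (arcs G)) cylinders \<subseteq> sets config_space"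
    using sets.sigma_sets_subset[of cylinders config_space] by (simp add: space_config_space)
qed

lemma Int_stable_cylinders: "Int_stable cylinders"
proof (rule Int_stableI)
  fix A B assume "A \<in> cylinders" "B \<in> cylinders"
  then obtain a b where "A = {f \<in> Pow (arcs G). a \<subseteq> f}" "B = {f \<in> Pow (arcs G). b \<subseteq> f}"
    "finite a" "finite b" "a \<subseteq> arcs G" "b \<subseteq> arcs G" by (auto simp: cylinders_def)
  then show "A \<inter> B \<in> cylinders" unfolding cylinders_def by (auto intro!: exI[of _ "a \<union> b"])
qed

definition wilson_law :: "(nat \<Rightarrow> 'v) \<Rightarrow> 'e set measure" where
  "wilson_law en = distr (walks_law en) config_space wilson_forest"

lemma wilson_forest_eq: "wilson_forest X = (\<Union>i. wilson_from {} X i)"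
  by (simp add: wilson_forest_def wilson_eq)

lemma measurable_wilson_forest:
  assumes "range en \<subseteq> verts G"
  shows "wilson_forest \<in> measurable (walks_law en) config_space"
proof (rule measurable_config_space)
  show "wilson_forest \<in> space (walks_law en) \<rightarrow> Pow (arcs G)"
    using wilson_from_arcs[OF assms] unfolding wilson_forest_eq by blast
  show "Measurable.pred (walks_law en) (\<lambda>X. e \<in> wilson_forest X)" for e
    unfolding wilson_forest_eq UN_iff Bex_def using pred_wilson_from[OF assms]
    by (auto intro: pred_intros_countable)
qed

lemma sets_wilson_law [simp]: "sets (wilson_law en) = sets config_space"
  and space_wilson_law: "space (wilson_law en) = Pow (arcs G)"
  by (simp_all add: wilson_law_def space_config_space)

lemma prob_space_wilson_law: "range en \<subseteq> verts G \<Longrightarrow> prob_space (wilson_law en)"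
  unfolding wilson_law_def by (intro prob_space.prob_space_distr prob_space_walks_law measurable_wilson_forest)

lemma emeasure_wilson_law:
  assumes "range en \<subseteq> verts G" "Measurable.pred config_space Q"
  shows "emeasure (wilson_law en) {f \<in> Pow (arcs G). Q f} = emeasure (walks_law en) {X \<in> space (walks_law en). Q (wilson_forest X)}"
proof -
  have "{f \<in> Pow (arcs G). Q f} \<in> sets config_space" using assms(2) by (simp add: pred_def space_config_space)
  then show ?thesis
    unfolding wilson_law_def using measurable_space[OF measurable_wilson_forest[OF assms(1)]]
    by (subst emeasure_distr[OF measurable_wilson_forest[OF assms(1)]])
       (auto intro!: arg_cong[where f="emeasure (walks_law en)"] simp: space_config_space)
qed

lemma eventually_subset_wilson_forest:
  assumes "transient_walks en X" "range en = verts G"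
    and D: "\<And>u. u \<in> verts G \<Longrightarrow> \<forall>\<^sub>F k in sequentially. u \<in> D k"
    and "filterlim N at_top sequentially" and B: "finite B" "B \<subseteq> arcs G"
  shows "\<forall>\<^sub>F k in sequentially. B \<subseteq> wilson_from (- D k) X (N k) \<longleftrightarrow> B \<subseteq> wilson_forest X"
proof -
  have "\<forall>\<^sub>F k in sequentially. \<forall>e\<in>B. e \<in> wilson_from (- D k) X (N k) \<longleftrightarrow> e \<in> wilson_forest X"
    using B(1) by (rule eventually_ball_finite) (use B(2) in \<open>blast intro: wilson_forest_converges[OF assms(1-4)]\<close>)
  then show ?thesis by (rule eventually_mono) (auto simp: subset_iff)
qed

lemma wilson_law_enumeration:
  assumes en: "range en = verts G" "range en' = verts G"
  shows "wilson_law en = wilson_law en'"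
proof -
  \<comment> \<open>One exhaustion, built from \<open>en\<close>, serves both enumerations: both
    laws are limits of the same wired probabilities.\<close>
  define D where "D k = en ` {..<k}" for k :: nat
  have D: "finite (D k)" "D k \<subseteq> verts G" for k using en by (auto simp: D_def)
  have D_ev: "\<forall>\<^sub>F k in sequentially. u \<in> D k" if "u \<in> verts G" for u
  proof -
    from that en obtain i where "u = en i" by blast
    then show ?thesis unfolding D_def eventually_sequentially by (intro exI[of _ "Suc i"]) auto
  qed
  have lim: "(\<lambda>k. wired_prob (D k) (\<lambda>f. B \<subseteq> f)) \<longlonglongrightarrow> emeasure (wilson_law en) {f \<in> Pow (arcs G). B \<subseteq> f}"
    if B: "finite B" "B \<subseteq> arcs G" and en: "range en = verts G" for B en
  proof -
    obtain N where N: "filterlim N at_top sequentially" "\<And>k. D k \<subseteq> en ` {..<N k}"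
      using exhaustion_cover[where D = D, OF en D] by blast
    have sub: "range en \<subseteq> verts G" using en by simp
    have pB: "Measurable.pred config_space (\<lambda>f. B \<subseteq> f)" using B(1) by (intro pred_config_subset countable_finite)
    show ?thesis
      unfolding emeasure_wilson_law[OF sub pB]
    proof (rule wired_prob_tendsto[where N = N, OF sub D N(2)])
      show "Measurable.pred (walks_law en) (\<lambda>X. B \<subseteq> wilson_forest X)"
        by (rule measurable_compose[OF measurable_wilson_forest[OF sub] pB])
      show "AE X in walks_law en. (\<forall>k. wilson_from (- D k) X (N k) \<in> forests (D k)) \<longrightarrow>
         (\<forall>\<^sub>F k in sequentially. B \<subseteq> wilson_from (- D k) X (N k) \<longleftrightarrow> B \<subseteq> wilson_forest X)"
        using AE_transient_walks[OF sub]
        by (rule eventually_mono) (use eventually_subset_wilson_forest[OF _ en D_ev N(1) B] in blast)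
    qed
  qed
  show ?thesis
  proof (rule measure_eqI_generator_eq[where \<Omega> = "Pow (arcs G)" and E = cylinders and A = "\<lambda>_. Pow (arcs G)"])
    show "emeasure (wilson_law en) A = emeasure (wilson_law en') A" if "A \<in> cylinders" for A
      using that lim[OF _ _ en(1)] lim[OF _ _ en(2)] LIMSEQ_unique unfolding cylinders_def by blast
    have "Pow (arcs G) \<in> cylinders" unfolding cylinders_def by (auto intro!: exI[of _ "{}"])
    then show "range (\<lambda>_::nat. Pow (arcs G)) \<subseteq> cylinders" by auto
    show "emeasure (wilson_law en) (Pow (arcs G)) \<noteq> \<infinity>"
      using prob_space.emeasure_space_1[OF prob_space_wilson_law[of en]] en(1) by (simp add: space_wilson_law)
    show "cylinders \<subseteq> Pow (Pow (arcs G))" by (auto simp: cylinders_def)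
  qed (simp_all add: Int_stable_cylinders sets_config_space)
qed

lemma AE_wilson_forest_spanning:
  assumes en: "range en = verts G"
  shows "AE X in walks_law en. wilson_forest X \<in> forests (verts G)"
proof -
  define D where "D k = en ` {..<k}" for k :: nat
  have sub: "range en \<subseteq> verts G" using en by simp
  have D: "finite (D k)" "D k \<subseteq> verts G" "D k \<subseteq> en ` {..<k}" for k using en by (auto simp: D_def)
  have D_ev: "\<forall>\<^sub>F k in sequentially. u \<in> D k" if "u \<in> verts G" for u
  proof -
    from that en obtain i where "u = en i" by blast
    then show ?thesis unfolding D_def eventually_sequentially by (intro exI[of _ "Suc i"]) auto
  qed
  have "AE X in walks_law en. \<forall>k. wilson_from (- D k) X k \<in> forests (D k)"
    unfolding AE_all_countable using AE_wilson_from_forests[OF sub D] by blast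
  then show ?thesis using AE_transient_walks[OF sub]
  proof eventually_elim
    case (elim X)
    have "wilson_forest X \<subseteq> arcs G"
      using wilson_from_subset_arcs[OF elim(2)] by (auto simp: wilson_forest_eq)
    then show ?case
      by (rule limit_of_forests[where D = D and f = "\<lambda>k. wilson_from (- D k) X k"])
         (use elim(1) D_ev wilson_forest_converges[OF elim(2) en D_ev filterlim_ident] in blast)+
  qed
qed

subsection \<open>Stationarity\<close>

lemma spanning_forestsD:
  assumes "f \<in> spanning_forests"
  shows "f \<subseteq> arcs G" "inj_on (tail G) f" "u \<in> verts G \<Longrightarrow> out_arc f u \<in> f \<and> tail G (out_arc f u) = u"
proof -
  show fa: "f \<subseteq> arcs G" using assms by (simp add: spanning_forests_def)
  have ex: "\<exists>!e. e \<in> f \<and> tail G e = v" if "v \<in> verts G" for v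
    using assms that by (simp add: spanning_forests_def)
  show "inj_on (tail G) f"
  proof (rule inj_onI)
    fix x y assume xy: "x \<in> f" "y \<in> f" "tail G x = tail G y"
    then have "tail G x \<in> verts G" using fa by auto
    from ex[OF this] xy show "x = y" by metis
  qed
  show "out_arc f u \<in> f \<and> tail G (out_arc f u) = u" if "u \<in> verts G"
    unfolding out_arc_def using ex[OF that] by (rule theI')
qed

lemma countable_lists_arcs: "countable (lists (arcs G))"
  using countable_arcs by (rule countable_lists)

lemma pred_spanning_forests: "Measurable.pred config_space (\<lambda>f. f \<in> spanning_forests)"
proof -
  let ?P = "\<lambda>f. (\<forall>e\<in>arcs G. e \<in> f \<longrightarrow> arev e \<notin> f) \<and>
    \<not> (\<exists>p\<in>lists (arcs G). unoriented_cycle p \<and> (\<forall>e\<in>set p. e \<in> f \<or> arev e \<in> f)) \<and>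
    (\<forall>v\<in>verts G. (\<exists>e\<in>arcs G. e \<in> f \<and> tail G e = v) \<and>
      (\<forall>e\<in>arcs G. \<forall>a\<in>arcs G. e \<in> f \<and> tail G e = v \<and> a \<in> f \<and> tail G a = v \<longrightarrow> e = a))"
  have "Measurable.pred config_space ?P"
    by (intro pred_intros_logic pred_countable_Ball pred_countable_Bex countable_arcs countable_verts
        countable_lists_arcs pred_config_mem countable_finite finite_set) simp_all
  moreover have "?P f \<longleftrightarrow> f \<in> spanning_forests" if "f \<in> space config_space" for f
  proof -
    have fa: "\<And>e. e \<in> f \<Longrightarrow> e \<in> arcs G" using that by (auto simp: space_config_space)
    have "e \<in> arev ` f \<longleftrightarrow> arev e \<in> f" for e
    proof
      assume "e \<in> arev ` f"
      then obtain a where "a \<in> f" "e = arev a" by blast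
      then show "arev e \<in> f" by simp
    next
      assume "arev e \<in> f"
      then show "e \<in> arev ` f" by (rule rev_image_eqI) simp
    qed
    then have mem: "e \<in> f \<union> arev ` f \<longleftrightarrow> e \<in> f \<or> arev e \<in> f" for e
      by (simp only: Un_iff)
    have cyc: "p \<in> lists (arcs G)" if "unoriented_cycle p" for p
      using that by (auto simp: unoriented_cycle_def cycle_def awalk_def)
    have 1: "(\<exists>p\<in>lists (arcs G). unoriented_cycle p \<and> (\<forall>e\<in>set p. e \<in> f \<or> arev e \<in> f)) \<longleftrightarrow>
      (\<exists>p. unoriented_cycle p \<and> set p \<subseteq> f \<union> arev ` f)"
      unfolding subset_iff mem using cyc by blast
    have 2: "((\<exists>e\<in>arcs G. e \<in> f \<and> tail G e = v) \<and>
      (\<forall>e\<in>arcs G. \<forall>a\<in>arcs G. e \<in> f \<and> tail G e = v \<and> a \<in> f \<and> tail G a = v \<longrightarrow> e = a)) \<longleftrightarrow>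
      (\<exists>!e. e \<in> f \<and> tail G e = v)" for v
      unfolding Ex1_def using fa by blast
    have 3: "(\<forall>e\<in>arcs G. e \<in> f \<longrightarrow> arev e \<notin> f) \<longleftrightarrow> (\<forall>e\<in>f. arev e \<notin> f)" using fa by blast
    show ?thesis unfolding 1 2 3 spanning_forests_def mem_Collect_eq using fa by blast
  qed
  ultimately show ?thesis by (simp cong: measurable_cong)
qed

section \<open>Measurability of the update\<close>

definition trivial_update :: "'e set \<Rightarrow> 'e \<Rightarrow> bool" where
  "trivial_update f e \<longleftrightarrow> e \<in> f \<or> arev e \<in> f \<or> head G e = tail G e"

definition cycle_path :: "'e set \<Rightarrow> 'e \<Rightarrow> 'e list \<Rightarrow> bool" where
  "cycle_path f e p \<longleftrightarrow> directed_path f (head G e) p (tail G e)"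

lemma in_past_cycle_path:
  "head G e \<in> past f (tail G e) \<longleftrightarrow> (\<exists>p\<in>lists (arcs G). cycle_path f e p)"
  unfolding past_def cycle_path_def directed_path_def apath_def awalk_def by auto

text \<open>The definite description is replaced by a quantifier over the countable set of arc
  lists, which uniqueness of the path permits. Measurability of the update follows from this
  form.\<close>

lemma mem_update_iff:
  assumes f: "f \<in> spanning_forests" and e: "e \<in> arcs G"
  shows "a \<in> update f e \<longleftrightarrow>
    trivial_update f e \<and> a \<in> f \<or>
    \<not> trivial_update f e \<and> (\<exists>p\<in>lists (arcs G). cycle_path f e p \<and> (a \<in> f \<or> a \<in> set (reversed_path p e)) \<and> a \<notin> set p) \<or>
    \<not> trivial_update f e \<and> \<not> (\<exists>p\<in>lists (arcs G). cycle_path f e p) \<and> (a = e \<or> a \<in> f \<and> tail G a \<noteq> tail G e)"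
    (is ?A)
  and undo_arc_iff: "undo_arc f e = d \<longleftrightarrow>
    trivial_update f e \<and> d = e \<or>
    \<not> trivial_update f e \<and> (\<exists>p\<in>lists (arcs G). cycle_path f e p \<and> arev (last p) = d) \<or>
    \<not> trivial_update f e \<and> \<not> (\<exists>p\<in>lists (arcs G). cycle_path f e p) \<and> d \<in> f \<and> tail G d = tail G e"
    (is ?B)
proof -
  note fD = spanning_forestsD[OF f]
  have "?A \<and> ?B"
  proof (cases "trivial_update f e")
    case True
    then have "update f e = f" "undo_arc f e = e" using update_trivial[of e f] by (auto simp: trivial_update_def)
    then show ?thesis using True by auto
  next
    case nt: False
    then have nt': "e \<notin> f" "arev e \<notin> f" "head G e \<noteq> tail G e" by (auto simp: trivial_update_def)
    show ?thesis
    proof (cases "head G e \<in> past f (tail G e)")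
      case True
      then obtain p where p: "p \<in> lists (arcs G)" "cycle_path f e p" using in_past_cycle_path by blast
      then have dp: "directed_path f (head G e) p (tail G e)" by (simp add: cycle_path_def)
      have uniq: "q = p" if "cycle_path f e q" for q
        using that directed_path_unique[OF _ dp fD(2)] by (simp add: cycle_path_def)
      note U = update_path[OF fD(2) nt' dp]
      have "?A" unfolding U(1) using nt p uniq by blast
      moreover have "?B" unfolding U(2) using nt p uniq by blast
      ultimately show ?thesis ..
    next
      case False
      then have no: "\<not> (\<exists>p\<in>lists (arcs G). cycle_path f e p)" using in_past_cycle_path by blast
      have "tail G e \<in> verts G" using e by simp
      note o = fD(3)[OF this]
      have u: "undo_arc f e = out_arc f (tail G e)" using nt' False by (simp add: undo_arc_def)
      have "update f e = f \<union> {e} - {out_arc f (tail G e)}"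
        using nt' False by (simp add: update_def out_arc_def)
      moreover have "x = out_arc f (tail G e) \<longleftrightarrow> x \<in> f \<and> tail G x = tail G e" for x
        using o inj_onD[OF fD(2), of x "out_arc f (tail G e)"] by auto
      ultimately show ?thesis unfolding u using nt no nt'(1) o by auto
    qed
  qed
  then show ?A ?B by auto
qed

lemma pred_cycle_path: "Measurable.pred config_space (\<lambda>f. cycle_path f e p)"
  unfolding cycle_path_def directed_path_def
  by (intro pred_intros_logic pred_config_subset countable_finite finite_set) simp

lemma pred_trivial_update: "Measurable.pred config_space (\<lambda>f. trivial_update f e)"
  unfolding trivial_update_def by (intro pred_intros_logic pred_config_mem) simp

text \<open>Membership in \<open>spanning_forests\<close> is carried along because the description
  by countable quantifiers holds there.\<close>

lemma pred_mem_update: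
  assumes "e \<in> arcs G"
  shows "Measurable.pred config_space (\<lambda>f. f \<in> spanning_forests \<and> a \<in> update f e)"
    "Measurable.pred config_space (\<lambda>f. f \<in> spanning_forests \<and> undo_arc f e = d)"
proof -
  have "(\<lambda>f. f \<in> spanning_forests \<and> a \<in> update f e) = (\<lambda>f. f \<in> spanning_forests \<and> (
    trivial_update f e \<and> a \<in> f \<or>
    \<not> trivial_update f e \<and> (\<exists>p\<in>lists (arcs G). cycle_path f e p \<and> (a \<in> f \<or> a \<in> set (reversed_path p e)) \<and> a \<notin> set p) \<or>
    \<not> trivial_update f e \<and> \<not> (\<exists>p\<in>lists (arcs G). cycle_path f e p) \<and> (a = e \<or> a \<in> f \<and> tail G a \<noteq> tail G e)))"
    by (intro ext conj_cong refl mem_update_iff[OF _ assms])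
  also have "Measurable.pred config_space \<dots>"
    by (intro pred_intros_logic pred_countable_Bex countable_lists_arcs pred_cycle_path pred_trivial_update
        pred_config_mem pred_spanning_forests) simp_all
  finally show "Measurable.pred config_space (\<lambda>f. f \<in> spanning_forests \<and> a \<in> update f e)" .
  have "(\<lambda>f. f \<in> spanning_forests \<and> undo_arc f e = d) = (\<lambda>f. f \<in> spanning_forests \<and> (
    trivial_update f e \<and> d = e \<or>
    \<not> trivial_update f e \<and> (\<exists>p\<in>lists (arcs G). cycle_path f e p \<and> arev (last p) = d) \<or>
    \<not> trivial_update f e \<and> \<not> (\<exists>p\<in>lists (arcs G). cycle_path f e p) \<and> d \<in> f \<and> tail G d = tail G e))"
    by (intro ext conj_cong refl undo_arc_iff[OF _ assms])
  also have "Measurable.pred config_space \<dots>"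
    by (intro pred_intros_logic pred_countable_Bex countable_lists_arcs pred_cycle_path pred_trivial_update
        pred_config_mem pred_spanning_forests) simp_all
  finally show "Measurable.pred config_space (\<lambda>f. f \<in> spanning_forests \<and> undo_arc f e = d)" .
qed

lemma update_subset_arcs:
  assumes "f \<in> spanning_forests" "e \<in> arcs G"
  shows "update f e \<subseteq> arcs G"
proof
  fix a assume a: "a \<in> update f e"
  have "set (reversed_path p e) \<subseteq> arcs G" if "p \<in> lists (arcs G)" for p
    using that assms(2) by (auto simp: reversed_path_def dest: in_set_butlastD)
  then show "a \<in> arcs G"
    using a spanning_forestsD(1)[OF assms(1)] assms(2) unfolding mem_update_iff[OF assms] by blast
qed

lemma pred_subset_update:
  assumes "e \<in> arcs G" "countable B"
  shows "Measurable.pred config_space (\<lambda>f. f \<in> spanning_forests \<and> B \<subseteq> update f e)"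
proof -
  have "Measurable.pred config_space (\<lambda>f. f \<in> spanning_forests \<and> (\<forall>a\<in>B. f \<in> spanning_forests \<and> a \<in> update f e))"
    by (intro pred_intros_logic pred_countable_Ball assms(2) pred_spanning_forests pred_mem_update(1)[OF assms(1)])
  also have "(\<lambda>f. f \<in> spanning_forests \<and> (\<forall>a\<in>B. f \<in> spanning_forests \<and> a \<in> update f e)) =
    (\<lambda>f. f \<in> spanning_forests \<and> B \<subseteq> update f e)" by auto
  finally show ?thesis .
qed

text \<open>The identity for wired forests holds as soon as \<open>v\<close> belongs to
  \<open>D k\<close>, so it remains to take limits. The left side calls for the walk from
  \<open>head G e\<close> first, the right side for the one from \<open>head G d\<close>; as the law
  does not depend on the enumeration, each limit is computed with a suitable one.\<close>

lemma wilson_law_exchange: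
  assumes en: "range en = verts G" and e: "e \<in> out_arcs G v" and d: "d \<in> out_arcs G v"
    and B: "finite B" "B \<subseteq> arcs G"
  shows "ennreal (c e) * emeasure (wilson_law en) {f \<in> Pow (arcs G). f \<in> spanning_forests \<and> B \<subseteq> update f e \<and> undo_arc f e = d} =
    ennreal (c d) * emeasure (wilson_law en) {f \<in> Pow (arcs G). f \<in> spanning_forests \<and> B \<subseteq> f \<and> undo_arc f d = e}"
proof -
  define D where "D k = en ` {..<k}" for k :: nat
  have D: "finite (D k)" "D k \<subseteq> verts G" for k using en by (auto simp: D_def)
  have D_ev: "\<forall>\<^sub>F k in sequentially. u \<in> D k" if "u \<in> verts G" for u
  proof -
    from that en obtain i where "u = en i" by blast
    then show ?thesis unfolding D_def eventually_sequentially by (intro exI[of _ "Suc i"]) auto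
  qed
  have cB: "countable B" using B(1) by (rule countable_finite)
  have lim: "(\<lambda>k. wired_prob (D k) Q) \<longlonglongrightarrow> emeasure (wilson_law en) {f \<in> Pow (arcs G). f \<in> spanning_forests \<and> Q f}"
    if a: "a \<in> arcs G" and Q: "Measurable.pred config_space (\<lambda>f. f \<in> spanning_forests \<and> Q f)"
    and ev: "\<And>en' X N. transient_walks en' X \<Longrightarrow> range en' = verts G \<Longrightarrow> en' 0 = head G a \<Longrightarrow>
      filterlim N at_top sequentially \<Longrightarrow> (\<And>k. wilson_from (- D k) X (N k) \<in> forests (D k)) \<Longrightarrow>
      \<forall>\<^sub>F k in sequentially. Q (wilson_from (- D k) X (N k)) \<longleftrightarrow> Q (wilson_forest X)" for Q a
  proof -
    have "head G a \<in> range en" using a en by simp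
    then obtain j where j: "head G a = en j" by blast
    \<comment> \<open>The walk from \<open>head G a\<close> is run first; the vertex occurs again
      later, where its walk stops at once.\<close>
    define en' where "en' = case_nat (en j) en"
    have en': "range en' = verts G" "en' 0 = head G a"
    proof -
      show "en' 0 = head G a" using j by (simp add: en'_def)
      have "range en' = insert (en j) (range en)"
        by (auto simp: en'_def image_iff split: nat.splits intro: exI[of _ 0] exI[of _ "Suc _"])
      then show "range en' = verts G" using en by auto
    qed
    obtain N where N: "filterlim N at_top sequentially" "\<And>k. D k \<subseteq> en' ` {..<N k}"
      using exhaustion_cover[where D = D, OF en'(1) D] by blast
    have sub: "range en' \<subseteq> verts G" using en' by simp
    have eq: "wilson_law en = wilson_law en'" by (rule wilson_law_enumeration[OF en en'(1)])
    show ?thesis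
      unfolding eq emeasure_wilson_law[OF sub Q]
    proof (rule wired_prob_tendsto[where N = N, OF sub D N(2)])
      show "Measurable.pred (walks_law en') (\<lambda>X. wilson_forest X \<in> spanning_forests \<and> Q (wilson_forest X))"
        by (rule measurable_compose[OF measurable_wilson_forest[OF sub] Q])
      show "AE X in walks_law en'. (\<forall>k. wilson_from (- D k) X (N k) \<in> forests (D k)) \<longrightarrow>
        (\<forall>\<^sub>F k in sequentially. Q (wilson_from (- D k) X (N k)) \<longleftrightarrow> wilson_forest X \<in> spanning_forests \<and> Q (wilson_forest X))"
        using AE_transient_walks[OF sub] AE_wilson_forest_spanning[OF en'(1)]
      proof eventually_elim
        case (elim X)
        then have "wilson_forest X \<in> spanning_forests" using forests_verts_spanning by blast
        show ?case
        proof
          assume "\<forall>k. wilson_from (- D k) X (N k) \<in> forests (D k)"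
          then have "\<forall>\<^sub>F k in sequentially. Q (wilson_from (- D k) X (N k)) \<longleftrightarrow> Q (wilson_forest X)"
            using ev[OF elim(1) en' N(1)] by blast
          with \<open>wilson_forest X \<in> spanning_forests\<close>
          show "\<forall>\<^sub>F k in sequentially. Q (wilson_from (- D k) X (N k)) \<longleftrightarrow> wilson_forest X \<in> spanning_forests \<and> Q (wilson_forest X)"
            by simp
        qed
      qed
    qed
  qed
  have ea: "e \<in> arcs G" "d \<in> arcs G" "v \<in> verts G" using e d by auto
  have L1: "(\<lambda>k. wired_prob (D k) (\<lambda>f. B \<subseteq> update f e \<and> undo_arc f e = d)) \<longlonglongrightarrow>
    emeasure (wilson_law en) {f \<in> Pow (arcs G). f \<in> spanning_forests \<and> B \<subseteq> update f e \<and> undo_arc f e = d}"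
  proof (rule lim[OF ea(1)])
    have "Measurable.pred config_space (\<lambda>f. (f \<in> spanning_forests \<and> B \<subseteq> update f e) \<and> (f \<in> spanning_forests \<and> undo_arc f e = d))"
      by (intro pred_intros_logic(3) pred_subset_update pred_mem_update ea cB)
    then show "Measurable.pred config_space (\<lambda>f. f \<in> spanning_forests \<and> B \<subseteq> update f e \<and> undo_arc f e = d)"
      by (rule measurable_cong[THEN iffD1, rotated]) auto
  qed (rule update_converges[OF _ _ _ ea(1) D_ev _ _ B])
  have L2: "(\<lambda>k. wired_prob (D k) (\<lambda>f. B \<subseteq> f \<and> undo_arc f d = e)) \<longlonglongrightarrow>
    emeasure (wilson_law en) {f \<in> Pow (arcs G). f \<in> spanning_forests \<and> B \<subseteq> f \<and> undo_arc f d = e}"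
  proof (rule lim[OF ea(2)])
    have "Measurable.pred config_space (\<lambda>f. B \<subseteq> f \<and> (f \<in> spanning_forests \<and> undo_arc f d = e))"
      by (intro pred_intros_logic(3) pred_config_subset pred_mem_update ea cB)
    then show "Measurable.pred config_space (\<lambda>f. f \<in> spanning_forests \<and> B \<subseteq> f \<and> undo_arc f d = e)"
      by (rule measurable_cong[THEN iffD1, rotated]) auto
    fix en' X N assume A: "transient_walks en' X" "range en' = verts G" "en' 0 = head G d"
      "filterlim N at_top sequentially" "\<And>k. wilson_from (- D k) X (N k) \<in> forests (D k)"
    have "\<forall>\<^sub>F k in sequentially. B \<subseteq> wilson_from (- D k) X (N k) \<longleftrightarrow> B \<subseteq> wilson_forest X"
      by (rule eventually_subset_wilson_forest[OF A(1,2) D_ev A(4) B])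
    \<comment> \<open>The event concerns \<open>f\<close> and \<open>undo_arc\<close> only, so the
      convergence of the update is used with an empty set of arcs.\<close>
    moreover have "\<forall>\<^sub>F k in sequentially. ({} \<subseteq> update (wilson_from (- D k) X (N k)) d \<and> undo_arc (wilson_from (- D k) X (N k)) d = e)
      \<longleftrightarrow> ({} \<subseteq> update (wilson_forest X) d \<and> undo_arc (wilson_forest X) d = e)"
      by (rule update_converges[OF A(1-3) ea(2) D_ev A(4,5)]) auto
    ultimately show "\<forall>\<^sub>F k in sequentially. B \<subseteq> wilson_from (- D k) X (N k) \<and> undo_arc (wilson_from (- D k) X (N k)) d = e
      \<longleftrightarrow> B \<subseteq> wilson_forest X \<and> undo_arc (wilson_forest X) d = e"
      by eventually_elim simp
  qed
  have ev: "\<forall>\<^sub>F k in sequentially. ennreal (c e) * wired_prob (D k) (\<lambda>f. B \<subseteq> update f e \<and> undo_arc f e = d)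
    = ennreal (c d) * wired_prob (D k) (\<lambda>f. B \<subseteq> f \<and> undo_arc f d = e)"
    using D_ev[OF ea(3)] by (rule eventually_mono) (rule wired_prob_exchange[OF D _ e d])
  have "(\<lambda>k. ennreal (c e) * wired_prob (D k) (\<lambda>f. B \<subseteq> update f e \<and> undo_arc f e = d)) \<longlonglongrightarrow>
    ennreal (c e) * emeasure (wilson_law en) {f \<in> Pow (arcs G). f \<in> spanning_forests \<and> B \<subseteq> update f e \<and> undo_arc f e = d}"
    by (rule ennreal_tendsto_cmult[OF _ L1]) simp
  from Lim_transform_eventually[OF this ev] have "(\<lambda>k. ennreal (c d) * wired_prob (D k) (\<lambda>f. B \<subseteq> f \<and> undo_arc f d = e)) \<longlonglongrightarrow>
    ennreal (c e) * emeasure (wilson_law en) {f \<in> Pow (arcs G). f \<in> spanning_forests \<and> B \<subseteq> update f e \<and> undo_arc f e = d}"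
    .
  moreover have "(\<lambda>k. ennreal (c d) * wired_prob (D k) (\<lambda>f. B \<subseteq> f \<and> undo_arc f d = e)) \<longlonglongrightarrow>
    ennreal (c d) * emeasure (wilson_law en) {f \<in> Pow (arcs G). f \<in> spanning_forests \<and> B \<subseteq> f \<and> undo_arc f d = e}"
    by (rule ennreal_tendsto_cmult[OF _ L2]) simp
  ultimately show ?thesis by (rule LIMSEQ_unique)
qed

text \<open>Membership in \<open>forests (verts G)\<close> is known almost surely in terms of the
  walks; a property of these forests is transferred to the law through its own
  measurability.\<close>

lemma AE_wilson_law_forests:
  assumes en: "range en = verts G"
  shows "AE f in wilson_law en. f \<in> spanning_forests"
    "\<And>P. (\<And>f. f \<in> forests (verts G) \<Longrightarrow> P f) \<Longrightarrow> Measurable.pred config_space P \<Longrightarrow> AE f in wilson_law en. P f"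
proof -
  have sub: "range en \<subseteq> verts G" using en by simp
  show *: "AE f in wilson_law en. P f" if "\<And>f. f \<in> forests (verts G) \<Longrightarrow> P f" "Measurable.pred config_space P" for P
    unfolding wilson_law_def
    using that(2) AE_wilson_forest_spanning[OF en] that(1)
    by (subst AE_distr_iff[OF measurable_wilson_forest[OF sub]]) (auto simp: pred_def elim: eventually_mono)
  show "AE f in wilson_law en. f \<in> spanning_forests"
    by (rule *[OF _ pred_spanning_forests]) (use forests_verts_spanning in blast)
qed

lemma spanning_forests_sets: "spanning_forests \<in> sets config_space"
proof -
  have "{f \<in> space config_space. f \<in> spanning_forests} = spanning_forests"
    using spanning_forestsD(1) by (auto simp: space_config_space)
  then show ?thesis using pred_spanning_forests by (simp add: pred_def)
qed

lemma emeasure_undo_partition: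
  assumes en: "range en = verts G" and v: "v \<in> verts G" and e: "e \<in> out_arcs G v"
    and Q: "Measurable.pred config_space (\<lambda>f. f \<in> spanning_forests \<and> Q f)"
  shows "emeasure (wilson_law en) {f \<in> Pow (arcs G). f \<in> spanning_forests \<and> Q f} =
    (\<Sum>d\<in>out_arcs G v. emeasure (wilson_law en) {f \<in> Pow (arcs G). f \<in> spanning_forests \<and> Q f \<and> undo_arc f e = d})"
proof -
  let ?E = "\<lambda>d. {f \<in> Pow (arcs G). f \<in> spanning_forests \<and> Q f \<and> undo_arc f e = d}"
  have ea: "e \<in> arcs G" "tail G e = v" using e by auto
  have "Measurable.pred config_space (\<lambda>f. (f \<in> spanning_forests \<and> Q f) \<and> (f \<in> spanning_forests \<and> undo_arc f e = d))" for d
    by (intro pred_intros_logic(3) Q pred_mem_update ea)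
  then have p: "Measurable.pred config_space (\<lambda>f. f \<in> spanning_forests \<and> Q f \<and> undo_arc f e = d)" for d
    by (rule measurable_cong[THEN iffD1, rotated]) auto
  then have E: "?E d \<in> sets (wilson_law en)" for d by (simp add: pred_def space_config_space)
  have U: "(\<Union>d\<in>out_arcs G v. ?E d) \<in> sets (wilson_law en)"
    using E locally_finite[OF v] by (intro sets.finite_UN) auto
  \<comment> \<open>The involution on \<open>forests (verts G)\<close> shows that the removed arc
    leaves \<open>v\<close>, so almost surely it takes one of finitely many values.\<close>
  have "AE f in wilson_law en. f \<in> spanning_forests \<longrightarrow> undo_arc f e \<in> out_arcs G v"
  proof (rule AE_wilson_law_forests(2)[OF en])
    show "f \<in> spanning_forests \<longrightarrow> undo_arc f e \<in> out_arcs G v" if "f \<in> forests (verts G)" for f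
      using update_involution(2,3)[OF that ea(1)] ea v by simp
    have "Measurable.pred config_space (\<lambda>f. f \<in> spanning_forests \<longrightarrow> (\<exists>d\<in>out_arcs G v. f \<in> spanning_forests \<and> undo_arc f e = d))"
      by (intro pred_intros_logic pred_countable_Bex pred_mem_update(2) ea pred_spanning_forests
          countable_finite locally_finite v)
    then show "Measurable.pred config_space (\<lambda>f. f \<in> spanning_forests \<longrightarrow> undo_arc f e \<in> out_arcs G v)"
      by (rule measurable_cong[THEN iffD1, rotated]) auto
  qed
  then have "emeasure (wilson_law en) {f \<in> Pow (arcs G). f \<in> spanning_forests \<and> Q f} = emeasure (wilson_law en) (\<Union>d\<in>out_arcs G v. ?E d)"
    using Q U by (intro emeasure_eq_AE) (auto simp: pred_def space_config_space elim!: eventually_mono)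
  also have "\<dots> = (\<Sum>d\<in>out_arcs G v. emeasure (wilson_law en) (?E d))"
    using E locally_finite[OF v] by (intro sum_emeasure[symmetric]) (auto simp: disjoint_family_on_def)
  finally show ?thesis .
qed

text \<open>The exchange identity is summed over all pairs. The left side is partitioned according
  to the removed arc \<open>d\<close>; the right side, after swapping the sums, according to
  \<open>e\<close>.\<close>

lemma wilson_law_update_cylinder:
  assumes en: "range en = verts G" and v: "v \<in> verts G" and B: "finite B" "B \<subseteq> arcs G"
  shows "(\<Sum>e\<in>out_arcs G v. ennreal (c e) * emeasure (wilson_law en) {f \<in> Pow (arcs G). f \<in> spanning_forests \<and> B \<subseteq> update f e}) =
    ennreal (vertex_conductance v) * emeasure (wilson_law en) {f \<in> Pow (arcs G). f \<in> spanning_forests \<and> B \<subseteq> f}"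
proof -
  let ?T = "emeasure (wilson_law en)"
  have cB: "countable B" using B(1) by (rule countable_finite)
  have "(\<Sum>e\<in>out_arcs G v. ennreal (c e) * ?T {f \<in> Pow (arcs G). f \<in> spanning_forests \<and> B \<subseteq> update f e}) =
    (\<Sum>e\<in>out_arcs G v. \<Sum>d\<in>out_arcs G v. ennreal (c e) *
      ?T {f \<in> Pow (arcs G). f \<in> spanning_forests \<and> B \<subseteq> update f e \<and> undo_arc f e = d})"
    by (intro sum.cong refl, subst emeasure_undo_partition[OF en v])
       (auto simp: sum_distrib_left intro!: pred_subset_update cB)
  also have "\<dots> = (\<Sum>e\<in>out_arcs G v. \<Sum>d\<in>out_arcs G v. ennreal (c d) *
      ?T {f \<in> Pow (arcs G). f \<in> spanning_forests \<and> B \<subseteq> f \<and> undo_arc f d = e})"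
    by (intro sum.cong refl wilson_law_exchange[OF en _ _ B])
  also have "\<dots> = (\<Sum>d\<in>out_arcs G v. \<Sum>e\<in>out_arcs G v. ennreal (c d) *
      ?T {f \<in> Pow (arcs G). f \<in> spanning_forests \<and> B \<subseteq> f \<and> undo_arc f d = e})"
    by (rule sum.swap)
  also have "\<dots> = (\<Sum>d\<in>out_arcs G v. ennreal (c d) * ?T {f \<in> Pow (arcs G). f \<in> spanning_forests \<and> B \<subseteq> f})"
  proof (intro sum.cong refl)
    fix d assume d: "d \<in> out_arcs G v"
    have "Measurable.pred config_space (\<lambda>f. f \<in> spanning_forests \<and> B \<subseteq> f)"
      by (intro pred_intros_logic(3) pred_spanning_forests pred_config_subset cB)
    from emeasure_undo_partition[OF en v d this]
    show "(\<Sum>e\<in>out_arcs G v. ennreal (c d) * ?T {f \<in> Pow (arcs G). f \<in> spanning_forests \<and> B \<subseteq> f \<and> undo_arc f d = e}) =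
      ennreal (c d) * ?T {f \<in> Pow (arcs G). f \<in> spanning_forests \<and> B \<subseteq> f}"
      by (simp add: sum_distrib_left)
  qed
  also have "\<dots> = ennreal (vertex_conductance v) * ?T {f \<in> Pow (arcs G). f \<in> spanning_forests \<and> B \<subseteq> f}"
  proof -
    have "(\<Sum>d\<in>out_arcs G v. ennreal (c d)) = ennreal (vertex_conductance v)"
      unfolding vertex_conductance_def using conductance_pos by (intro sum_ennreal) (auto intro: less_imp_le)
    then show ?thesis by (simp add: sum_distrib_right[symmetric])
  qed
  finally show ?thesis .
qed

definition forest_law :: "(nat \<Rightarrow> 'v) \<Rightarrow> 'e set measure" where
  "forest_law en = restrict_space (wilson_law en) spanning_forests"

context
  fixes en :: "nat \<Rightarrow> 'v" and v :: 'v
  assumes en: "range en = verts G" and v: "v \<in> verts G"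
begin

lemma space_forest_law: "space (forest_law en) = spanning_forests"
  using spanning_forestsD(1) by (auto simp: forest_law_def space_restrict_space space_wilson_law)

lemma spanning_forests_Int_space: "spanning_forests \<inter> space (wilson_law en) = spanning_forests"
  using spanning_forestsD(1) by (auto simp: space_wilson_law)

lemma sets_forest_law: "A \<in> sets (forest_law en) \<longleftrightarrow> A \<subseteq> spanning_forests \<and> A \<in> sets config_space"
  unfolding forest_law_def
  by (subst sets_restrict_space_iff)
     (simp_all only: spanning_forests_Int_space sets_wilson_law spanning_forests_sets)

lemma emeasure_forest_law:
  "A \<subseteq> spanning_forests \<Longrightarrow> emeasure (forest_law en) A = emeasure (wilson_law en) A"
  unfolding forest_law_def
  by (rule emeasure_restrict_space)
     (simp_all only: spanning_forests_Int_space sets_wilson_law spanning_forests_sets)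

lemma prob_space_forest_law: "prob_space (forest_law en)"
proof
  interpret prob_space "wilson_law en" using en by (intro prob_space_wilson_law) simp
  have "emeasure (wilson_law en) spanning_forests = 1"
    using AE_wilson_law_forests(1)[OF en] spanning_forests_sets by (intro emeasure_eq_1_AE) auto
  then show "emeasure (forest_law en) (space (forest_law en)) = 1"
    unfolding space_forest_law by (simp add: emeasure_forest_law)
qed

lemma measurable_update:
  assumes "e \<in> out_arcs G v"
  shows "(\<lambda>f. update f e) \<in> measurable (forest_law en) config_space"
proof (rule measurable_config_space)
  have ea: "e \<in> arcs G" using assms by auto
  show "(\<lambda>f. update f e) \<in> space (forest_law en) \<rightarrow> Pow (arcs G)"
    using update_subset_arcs[OF _ ea] by (auto simp: space_forest_law)
  show "Measurable.pred (forest_law en) (\<lambda>f. a \<in> update f e)" for a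
  proof -
    have "{f \<in> space config_space. f \<in> spanning_forests \<and> a \<in> update f e} \<in> sets config_space"
      using pred_mem_update(1)[OF ea] by (simp add: pred_def)
    moreover have "{f \<in> space config_space. f \<in> spanning_forests \<and> a \<in> update f e} = {f \<in> spanning_forests. a \<in> update f e}"
      using spanning_forestsD(1) by (auto simp: space_config_space)
    ultimately show ?thesis unfolding pred_def space_forest_law sets_forest_law by auto
  qed
qed

definition update_law :: "'e \<Rightarrow> 'e set measure" where
  "update_law e = distr (forest_law en) config_space (\<lambda>f. update f e)"

text \<open>Both sides are probability measures as functions of \<open>A\<close>, and they agree on
  cylinders, so a Dynkin argument applies. It is carried out with real-valued measures, where
  complements are differences.\<close>

lemma forest_law_stationary:
  assumes "A \<in> sets config_space"
  shows "measure (wilson_law en) A = (\<Sum>e\<in>out_arcs G v. jump e * measure (update_law e) A)"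
proof -
  interpret T: prob_space "wilson_law en" using en by (intro prob_space_wilson_law) simp
  have U: "prob_space (update_law e)" if "e \<in> out_arcs G v" for e
    unfolding update_law_def by (rule prob_space.prob_space_distr[OF prob_space_forest_law measurable_update[OF that]])
  have su: "sets (update_law e) = sets config_space" "space (update_law e) = Pow (arcs G)" for e
    by (simp_all add: update_law_def space_config_space)
  have j: "jump e = c e / vertex_conductance v" if "e \<in> out_arcs G v" for e using that by (auto simp: jump_def)
  have cyl: "cylinders \<subseteq> Pow (Pow (arcs G))" by (auto simp: cylinders_def)
  have "A \<in> sigma_sets (Pow (arcs G)) cylinders" using assms sets_config_space by simp
  with Int_stable_cylinders cyl show ?thesis
  proof (induction rule: sigma_sets_induct_disjoint)
    case (basic A)
    then obtain B where B: "finite B" "B \<subseteq> arcs G" and A: "A = {f \<in> Pow (arcs G). B \<subseteq> f}" by (auto simp: cylinders_def)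
    have Ac: "A \<in> sets config_space" using basic sets_config_space by (auto intro: sigma_sets.Basic)
    have 1: "emeasure (update_law e) A = emeasure (wilson_law en) {f \<in> Pow (arcs G). f \<in> spanning_forests \<and> B \<subseteq> update f e}"
      if e: "e \<in> out_arcs G v" for e
    proof -
      have "emeasure (update_law e) A = emeasure (forest_law en) ((\<lambda>f. update f e) -` A \<inter> space (forest_law en))"
        unfolding update_law_def by (rule emeasure_distr[OF measurable_update[OF e] Ac])
      also have "(\<lambda>f. update f e) -` A \<inter> space (forest_law en) = {f \<in> Pow (arcs G). f \<in> spanning_forests \<and> B \<subseteq> update f e}"
        using update_subset_arcs e spanning_forestsD(1) unfolding A space_forest_law by fastforce
      finally show ?thesis by (simp add: emeasure_forest_law Collect_mono_iff subset_eq)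
    qed
    have 2: "emeasure (wilson_law en) A = emeasure (wilson_law en) {f \<in> Pow (arcs G). f \<in> spanning_forests \<and> B \<subseteq> f}"
    proof (rule emeasure_eq_AE)
      show "AE f in wilson_law en. f \<in> A \<longleftrightarrow> f \<in> {f \<in> Pow (arcs G). f \<in> spanning_forests \<and> B \<subseteq> f}"
        using AE_wilson_law_forests(1)[OF en] by (rule eventually_mono) (auto simp: A)
      have "{f \<in> Pow (arcs G). f \<in> spanning_forests \<and> B \<subseteq> f} = A \<inter> spanning_forests" by (auto simp: A)
      then show "{f \<in> Pow (arcs G). f \<in> spanning_forests \<and> B \<subseteq> f} \<in> sets (wilson_law en)"
        using Ac spanning_forests_sets by simp
    qed (use Ac in simp)
    have cn: "0 \<le> c e * measure (update_law e) A" if "e \<in> out_arcs G v" for e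
      using that conductance_pos[of e] by (intro mult_nonneg_nonneg measure_nonneg) auto
    have "ennreal (vertex_conductance v * T.prob A) = ennreal (vertex_conductance v) * emeasure (wilson_law en) A"
      using vertex_conductance_pos[OF v] by (simp add: T.emeasure_eq_measure ennreal_mult')
    also have "\<dots> = (\<Sum>e\<in>out_arcs G v. ennreal (c e) * emeasure (update_law e) A)"
      unfolding 2 wilson_law_update_cylinder[OF en v B, symmetric] by (intro sum.cong) (simp_all add: 1)
    also have "\<dots> = (\<Sum>e\<in>out_arcs G v. ennreal (c e * measure (update_law e) A))"
      using U conductance_pos
      by (intro sum.cong) (auto simp: finite_measure.emeasure_eq_measure[OF prob_space.finite_measure] ennreal_mult' less_imp_le)
    also have "\<dots> = ennreal (\<Sum>e\<in>out_arcs G v. c e * measure (update_law e) A)"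
      using cn by (rule sum_ennreal)
    finally have "vertex_conductance v * T.prob A = (\<Sum>e\<in>out_arcs G v. c e * measure (update_law e) A)"
      using vertex_conductance_pos[OF v] sum_nonneg[of "out_arcs G v", OF cn]
      by (subst (asm) ennreal_inj) auto
    then have "T.prob A = (\<Sum>e\<in>out_arcs G v. c e * measure (update_law e) A) / vertex_conductance v"
      using vertex_conductance_pos[OF v] by (simp add: field_simps)
    also have "\<dots> = (\<Sum>e\<in>out_arcs G v. jump e * measure (update_law e) A)"
      unfolding sum_divide_distrib by (intro sum.cong) (simp_all add: j)
    finally show ?case .
  next
    case empty
    then show ?case by simp
  next
    case (compl A)
    then have A: "A \<in> sets config_space" using sets_config_space by simp
    have "T.prob (Pow (arcs G) - A) = 1 - T.prob A"
      using T.prob_compl[of A] A by (simp add: space_wilson_law)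
    \<comment> \<open>The jump probabilities out of \<open>v\<close> sum to one, so the mixture on
      the right has total mass one.\<close>
    also have "\<dots> = (\<Sum>e\<in>out_arcs G v. jump e) - (\<Sum>e\<in>out_arcs G v. jump e * measure (update_law e) A)"
      using compl sum_jump[OF v] by simp
    also have "\<dots> = (\<Sum>e\<in>out_arcs G v. jump e * (1 - measure (update_law e) A))"
      by (simp add: sum_subtractf right_diff_distrib)
    also have "\<dots> = (\<Sum>e\<in>out_arcs G v. jump e * measure (update_law e) (Pow (arcs G) - A))"
      using prob_space.prob_compl[OF U] A su by (intro sum.cong) auto
    finally show ?case .
  next
    case (union A)
    then have A: "range A \<subseteq> sets config_space" using sets_config_space by auto
    have "(\<lambda>i. T.prob (A i)) sums T.prob (\<Union>i. A i)"
      using T.finite_measure_UNION[of A] A union(1) by simp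
    moreover have "(\<lambda>i. \<Sum>e\<in>out_arcs G v. jump e * measure (update_law e) (A i)) sums
      (\<Sum>e\<in>out_arcs G v. jump e * measure (update_law e) (\<Union>i. A i))"
    proof (intro sums_sum sums_mult)
      fix e assume e: "e \<in> out_arcs G v"
      interpret E: prob_space "update_law e" using U[OF e] .
      show "(\<lambda>i. E.prob (A i)) sums E.prob (\<Union>i. A i)"
        using E.finite_measure_UNION[of A] A union(1) su by simp
    qed
    ultimately show ?case using union(3) by (simp add: sums_iff)
  qed
qed

text \<open>Summing the transition probabilities over target states gives an average of
  \<open>indicator A (update x e)\<close> over the arcs \<open>e\<close>; its integral is the
  mixture of the laws \<open>update_law e\<close>.\<close>

lemma stationary_forest_law: "stationary_measure (transition_prob v) (forest_law en)"
  unfolding stationary_measure_def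
proof (intro conjI ballI prob_space_forest_law)
  fix A assume "A \<in> sets (forest_law en)"
  then have AS: "A \<subseteq> spanning_forests" and A: "A \<in> sets config_space" by (auto simp: sets_forest_law)
  interpret T: prob_space "wilson_law en" using en by (intro prob_space_wilson_law) simp
  have U: "prob_space (update_law e)" if "e \<in> out_arcs G v" for e
    unfolding update_law_def by (rule prob_space.prob_space_distr[OF prob_space_forest_law measurable_update[OF that]])
  have fin: "finite (out_arcs G v)" using locally_finite[OF v] .
  have jp: "0 \<le> jump e" if "e \<in> out_arcs G v" for e using that jump_pos by (auto intro: less_imp_le)
  \<comment> \<open>Several arcs may lead to the same state; the indicators keep them apart, so that
    the sum over \<open>y\<close> can be taken arc by arc.\<close>
  have tp: "ennreal (transition_prob v x y) = (\<Sum>e\<in>out_arcs G v. ennreal (jump e) * indicator {update x e} y)" for x y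
  proof -
    have "transition_prob v x y = (\<Sum>e\<in>{e \<in> out_arcs G v. update x e = y}. c e / vertex_conductance v)"
      by (simp add: transition_prob_def sum_divide_distrib)
    also have "\<dots> = (\<Sum>e\<in>out_arcs G v. jump e * indicator {update x e} y)"
      by (rule sum.mono_neutral_cong_left) (use fin in \<open>auto simp: jump_def indicator_def\<close>)
    finally have "ennreal (transition_prob v x y) = (\<Sum>e\<in>out_arcs G v. ennreal (jump e * indicator {update x e} y))"
      using jp by (subst sum_ennreal) auto
    also have "\<dots> = (\<Sum>e\<in>out_arcs G v. ennreal (jump e) * indicator {update x e} y)"
      by (intro sum.cong) (auto simp: indicator_def)
    finally show ?thesis .
  qed
  have ind: "(\<integral>\<^sup>+y. indicator {u} y \<partial>count_space A) = indicator A u" for u :: "'e set"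
    by (subst nn_integral_count_space'[of "A \<inter> {u}"]) (auto simp: indicator_def)
  have "(\<integral>\<^sup>+x. (\<integral>\<^sup>+y. ennreal (transition_prob v x y) \<partial>count_space A) \<partial>forest_law en) =
    (\<integral>\<^sup>+x. (\<Sum>e\<in>out_arcs G v. ennreal (jump e) * indicator A (update x e)) \<partial>forest_law en)"
    unfolding tp by (simp add: nn_integral_sum nn_integral_cmult ind)
  also have "\<dots> = (\<Sum>e\<in>out_arcs G v. ennreal (jump e) * (\<integral>\<^sup>+x. indicator A (update x e) \<partial>forest_law en))"
  proof -
    have m: "(\<lambda>x. indicator A (update x e) :: ennreal) \<in> borel_measurable (forest_law en)" if "e \<in> out_arcs G v" for e
      by (rule measurable_compose[OF measurable_update[OF that] borel_measurable_indicator[OF A]])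
    show ?thesis
      by (subst nn_integral_sum) (use m in \<open>auto intro!: sum.cong nn_integral_cmult\<close>)
  qed
  also have "\<dots> = (\<Sum>e\<in>out_arcs G v. ennreal (jump e) * emeasure (update_law e) A)"
  proof (intro sum.cong refl)
    fix e assume e: "e \<in> out_arcs G v"
    have "(\<integral>\<^sup>+x. indicator A (update x e) \<partial>forest_law en) = (\<integral>\<^sup>+y. indicator A y \<partial>update_law e)"
      unfolding update_law_def by (rule nn_integral_distr[symmetric, OF measurable_update[OF e]]) (use A in simp)
    also have "\<dots> = emeasure (update_law e) A"
      using A by (intro nn_integral_indicator) (simp add: update_law_def)
    finally show "ennreal (jump e) * (\<integral>\<^sup>+x. indicator A (update x e) \<partial>forest_law en) = ennreal (jump e) * emeasure (update_law e) A"
      by simp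
  qed
  also have "\<dots> = (\<Sum>e\<in>out_arcs G v. ennreal (jump e * measure (update_law e) A))"
    using U jp by (intro sum.cong) (auto simp: finite_measure.emeasure_eq_measure[OF prob_space.finite_measure] ennreal_mult')
  also have "\<dots> = ennreal (\<Sum>e\<in>out_arcs G v. jump e * measure (update_law e) A)"
    using jp by (intro sum_ennreal) (auto intro!: mult_nonneg_nonneg)
  also have "\<dots> = emeasure (wilson_law en) A"
    unfolding forest_law_stationary[OF A, symmetric] by (simp add: T.emeasure_eq_measure)
  finally show "emeasure (forest_law en) A = (\<integral>\<^sup>+x. (\<integral>\<^sup>+y. ennreal (transition_prob v x y) \<partial>count_space A) \<partial>forest_law en)"
    by (simp add: emeasure_forest_law[OF AS])
qed

end

lemma OWUSF_eq: "OWUSF en = forest_law en"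
  by (simp add: OWUSF_def forest_law_def wilson_law_def walks_law_def)

end

theorem proposition5:
  fixes G :: "('v, 'e) pre_digraph" and arev :: "'e \<Rightarrow> 'e" and c :: "'e \<Rightarrow> real"
    and enum :: "nat \<Rightarrow> 'v" and v :: 'v
  assumes "network G arev c"
    and "infinite (verts G)"
    and "network.transient G c"
    and "bij_betw enum UNIV (verts G)"
    and "v \<in> verts G"
  shows "stationary_measure (network.transition_prob G arev c v) (network.OWUSF G arev c enum)"
proof -
  have range: "range enum = verts G" using assms(4) by (rule bij_betw_imp_surj_on)
  then have "countable (verts G)" by (metis countable_image countableI_type)
  then have "transient_network G arev c"
    using assms(1-3) by (simp add: transient_network_def transient_network_axioms_def)
  then interpret transient_network G arev c .
  show ?thesis using stationary_forest_law[OF range assms(5)] by (simp only: OWUSF_eq)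
qed

end
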